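(* Let $0\le T_0<T_1\le+\infty$, let $\Gamma$ be a network with Hamiltonians $\{H_\gamma\}$ and flux limiter $x\mapsto c_x$ as described in the context. Let $g_n:\Gamma\to\mathbb{R}$ be a sequence of continuous functions converging uniformly on $\Gamma$ to a function $g$. Assume that for each $n$ there exists a (unique) uniformly continuous solution $u_n:\Gamma\times[T_0,T_1)\to\mathbb{R}$ of (HJ$\Gamma$) in $(T_0,T_1)$, with flux limiter $c_x$, such that $u_n(\cdot,T_0)=g_n$. Then the $u_n$ converge uniformly in $\Gamma\times[T_0,T_1)$ to a solution $u$ of (HJ$\Gamma$) in $(T_0,T_1)$ with $u(\cdot,T_0)=g$, and $$|u_n-u|_\infty\le|g_n-g|_\infty\qquad\text{for every } n,$$ where $|\cdot|_\infty$ denotes the uniform norm.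
   Context: Network. $\Gamma=\bigcup_{\gamma\in\mathcal{E}}\gamma([0,1])\subset\mathbb{R}^N$, where $\mathcal{E}$ is a finite collection of arcs, i.e. simple $C^1$ curves $\gamma:[0,1]\to\mathbb{R}^N$ with nonvanishing derivative. Together with each arc $\gamma$ one also considers its inverse arc $-\gamma(s)=\gamma(1-s)$ (so the collection of arcs is regarded as closed under inversion). It is assumed that $\gamma((0,1))\cap\gamma'([0,1])=\emptyset$ whenever $\gamma'\ne\gamma$, $\gamma'\neq-\gamma$. Vertices are the initial and terminal points of arcs; $\mathbf{V}$ is the set of vertices. The network is connected (any two vertices are linked by a finite concatenation of arcs) and has no loops ($\gamma(0)\ne\gamma(1)$ for every arc). For $x\in\mathbf{V}$, $\Gamma_x=\{\gamma : \gamma(1)=x\}$. Hamiltonians. For each arc $\gamma$ a function $H_\gamma:[0,1]\times\mathbb{R}\to\mathbb{R}$ is given, with $H_{-\gamma}(s,p)=H_\gamma(1-s,-p)$. Each $H_\gamma$ is continuous in $(s,p)$, convex in $p$, coercive in $p$ uniformly in $s$, and for every $M>0$ there is $C_M$ with $H_\gamma(s,p)-H_\gamma(s,q)\le C_M|p-q|$ for all $s\in[0,1]$, $p,q\in(-M,M)$. Set $c_\gamma=-\max_{s\in[0,1]}\min_{p\in\mathbb{R}}H_\gamma(s,p)$. A flux limiter is a function $x\mapsto c_x$ from $\mathbf{V}$ to $\mathbb{R}$ with $c_x\le\min_{\gamma\in\Gamma_x}c_\gamma$ for all $x$. Equation. For $v:\Gamma\times[T_0,T_1)\to\mathbb{R}$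 put $(v\circ\gamma)(s,t)=v(\gamma(s),t)$; $'$ denotes the derivative in $s$ and subscript $t$ that in $t$. (HJ$_\gamma$) is $w_t+H_\gamma(s,w')=0$ in $(0,1)\times(T_0,T_1)$. A subtangent (resp. supertangent) to a function at a point is a $C^1$ function $\varphi$ such that (function $-\varphi$) has a local minimum (resp. maximum) at that point; it is constrained to a closed set $C$ if the point is a minimizer (resp. maximizer) only relative to a neighborhood of it intersected with $C$. A continuous $v:\Gamma\times[T_0,T_1)\to\mathbb{R}$ is a supersolution of (HJ$\Gamma$) in $(T_0,T_1)$ if (i) $v\circ\gamma$ is a viscosity supersolution of (HJ$_\gamma$) for every arc $\gamma$; (ii) for every $x\in\mathbf{V}$, $t_0\in(T_0,T_1)$: if some $C^1$ subtangent $\phi$ to $v(x,\cdot)$ at $t_0$ satisfies $\frac{d}{dt}\phi(t_0)<c_x$, then there is an arc $\gamma\in\Gamma_x$ such that all $C^1$ subtangents $\varphi$, constrained to $[0,1]\times\overline{(T_0,T_1)}$, to $v\circ\gamma$ at $(1,t_0)$ satisfy $\varphi_t(1,t_0)+H_\gamma(1,\varphi'(1,t_0))\ge0$. It is a subsolution of (HJ$\Gamma$) in $(T_0,T_1)$ if (i) $v\circ\gamma$ is a viscosity subsolution of (HJ$_\gamma$) for every arc $\gamma$; (ii) for every $x\in\mathbf{V}$, $t_0\in(T_0,T_1)$, all $C^1$ supertangents $\psi$ to $v(x,\cdot)$ at $t_0$ satisfy $\frac{d}{dt}\psi(t_0)\le c_x$. A solution is a continuous function that is both a subsolution and a supersolution.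 *)

theory Defs
  imports "HOL-Analysis.Analysis"
begin

subsection \<open>Networks\<close>

text \<open>
  An arc is a curve parametrized by the unit interval. Arcs are represented by extensional
  functions, so that equality of HOL functions is equality of maps on the unit interval;
  the class of extensional functions on the unit interval is stable under
  \<^const>\<open>reversepath\<close>, which is the inverse arc. Derivatives at the end points are one-sided.
\<close>

definition C1_arc :: "(real \<Rightarrow> 'a::euclidean_space) \<Rightarrow> bool" where
  "C1_arc \<gamma> \<longleftrightarrow>
     \<gamma> \<in> extensional {0..1} \<and> simple_path \<gamma> \<and>
     (\<exists>D. continuous_on {0..1} D \<and>
          (\<forall>s\<in>{0..1}. (\<gamma> has_vector_derivative D s) (at s within {0..1}) \<and> D s \<noteq> 0))"

definition vertices :: "(real \<Rightarrow> 'a::euclidean_space) set \<Rightarrow> 'a set" where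
  "vertices E = pathstart ` E \<union> pathfinish ` E"

definition support :: "(real \<Rightarrow> 'a::euclidean_space) set \<Rightarrow> 'a set" where
  "support E = (\<Union>\<gamma>\<in>E. path_image \<gamma>)"

definition arcs_into :: "(real \<Rightarrow> 'a::euclidean_space) set \<Rightarrow> 'a \<Rightarrow> (real \<Rightarrow> 'a) set" where
  "arcs_into E x = {\<gamma> \<in> E. pathfinish \<gamma> = x}"

definition network :: "(real \<Rightarrow> 'a::euclidean_space) set \<Rightarrow> bool" where
  "network E \<longleftrightarrow>
     finite E \<and>
     (\<forall>\<gamma>\<in>E. C1_arc \<gamma>) \<and>
     (\<forall>\<gamma>\<in>E. reversepath \<gamma> \<in> E) \<and>
     (\<forall>\<gamma>\<in>E. \<forall>\<gamma>'\<in>E. \<gamma>' \<noteq> \<gamma> \<longrightarrow> \<gamma>' \<noteq> reversepath \<gamma> \<longrightarrow> \<gamma> ` {0<..<1} \<inter> \<gamma>' ` {0..1} = {}) \<and>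
     (\<forall>x\<in>vertices E. \<forall>y\<in>vertices E. (x, y) \<in> {(pathstart \<gamma>, pathfinish \<gamma>) | \<gamma>. \<gamma> \<in> E}\<^sup>*) \<and>
     (\<forall>\<gamma>\<in>E. pathstart \<gamma> \<noteq> pathfinish \<gamma>)"


subsection \<open>Hamiltonians and flux limiters\<close>

definition hamiltonians ::
    "(real \<Rightarrow> 'a::euclidean_space) set \<Rightarrow> ((real \<Rightarrow> 'a) \<Rightarrow> real \<Rightarrow> real \<Rightarrow> real) \<Rightarrow> bool" where
  "hamiltonians E H \<longleftrightarrow>
     (\<forall>\<gamma>\<in>E.
        (\<forall>s\<in>{0..1}. \<forall>p. H (reversepath \<gamma>) s p = H \<gamma> (1 - s) (- p)) \<and>
        continuous_on ({0..1} \<times> UNIV) (\<lambda>(s, p). H \<gamma> s p) \<and>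
        (\<forall>s\<in>{0..1}. convex_on UNIV (H \<gamma> s)) \<and>
        (\<forall>K. \<forall>\<^sub>F p in at_infinity. \<forall>s\<in>{0..1}. K \<le> H \<gamma> s p) \<and>
        (\<forall>M>0. \<exists>C. \<forall>s\<in>{0..1}. \<forall>p\<in>{-M<..<M}. \<forall>q\<in>{-M<..<M}.
           H \<gamma> s p - H \<gamma> s q \<le> C * \<bar>p - q\<bar>))"

text \<open>
  For a continuous and uniformly coercive Hamiltonian, the infimum and the supremum
  below are attained.
\<close>

definition arc_const :: "(real \<Rightarrow> real \<Rightarrow> real) \<Rightarrow> real" where
  "arc_const h = - (SUP s\<in>{0..1}. INF p. h s p)"

definition flux_limiter ::
    "(real \<Rightarrow> 'a::euclidean_space) set \<Rightarrow> ((real \<Rightarrow> 'a) \<Rightarrow> real \<Rightarrow> real \<Rightarrow> real)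
      \<Rightarrow> ('a \<Rightarrow> real) \<Rightarrow> bool" where
  "flux_limiter E H c \<longleftrightarrow>
     (\<forall>x\<in>vertices E. c x \<le> (MIN \<gamma>\<in>arcs_into E x. arc_const (H \<gamma>)))"


subsection \<open>Test functions\<close>

text \<open>Continuous differentiability in a neighbourhood of a point.\<close>

definition C1_near :: "('e::real_normed_vector \<Rightarrow> real) \<Rightarrow> 'e \<Rightarrow> bool" where
  "C1_near \<phi> z \<longleftrightarrow>
     (\<exists>U D. open U \<and> z \<in> U \<and> continuous_on U D \<and>
        (\<forall>w\<in>U. (\<phi> has_derivative blinfun_apply (D w)) (at w)))"

definition constrained_subtangent ::
    "'e::real_normed_vector set \<Rightarrow> ('e \<Rightarrow> real) \<Rightarrow> 'e \<Rightarrow> ('e \<Rightarrow> real) \<Rightarrow> bool" where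
  "constrained_subtangent C f z \<phi> \<longleftrightarrow>
     C1_near \<phi> z \<and> (\<forall>\<^sub>F w in at z within C. f z - \<phi> z \<le> f w - \<phi> w)"

definition constrained_supertangent ::
    "'e::real_normed_vector set \<Rightarrow> ('e \<Rightarrow> real) \<Rightarrow> 'e \<Rightarrow> ('e \<Rightarrow> real) \<Rightarrow> bool" where
  "constrained_supertangent C f z \<phi> \<longleftrightarrow>
     C1_near \<phi> z \<and> (\<forall>\<^sub>F w in at z within C. f w - \<phi> w \<le> f z - \<phi> z)"

abbreviation subtangent :: "('e::real_normed_vector \<Rightarrow> real) \<Rightarrow> 'e \<Rightarrow> ('e \<Rightarrow> real) \<Rightarrow> bool" where
  "subtangent \<equiv> constrained_subtangent UNIV"

abbreviation supertangent :: "('e::real_normed_vector \<Rightarrow> real) \<Rightarrow> 'e \<Rightarrow> ('e \<Rightarrow> real) \<Rightarrow> bool" where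
  "supertangent \<equiv> constrained_supertangent UNIV"

definition space_deriv :: "(real \<times> real \<Rightarrow> real) \<Rightarrow> real \<Rightarrow> real \<Rightarrow> real" where
  "space_deriv \<phi> s t = deriv (\<lambda>\<sigma>. \<phi> (\<sigma>, t)) s"

definition time_deriv :: "(real \<times> real \<Rightarrow> real) \<Rightarrow> real \<Rightarrow> real \<Rightarrow> real" where
  "time_deriv \<phi> s t = deriv (\<lambda>\<tau>. \<phi> (s, \<tau>)) t"


subsection \<open>The equation on a single arc\<close>

text \<open>
  The final time is an extended real, so that it may be infinite; the open time interval is
  \<^const>\<open>einterval\<close>. The points considered are interior to the domain, hence
  the values of \<open>w\<close> outside the domain are irrelevant.
\<close>

definition arc_supersolution ::
    "(real \<Rightarrow> real \<Rightarrow> real) \<Rightarrow> real \<Rightarrow> ereal \<Rightarrow> (real \<times> real \<Rightarrow> real) \<Rightarrow> bool" where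
  "arc_supersolution h T0 T1 w \<longleftrightarrow>
     (\<forall>s\<in>{0<..<1}. \<forall>t\<in>einterval T0 T1. \<forall>\<phi>. subtangent w (s, t) \<phi> \<longrightarrow>
        time_deriv \<phi> s t + h s (space_deriv \<phi> s t) \<ge> 0)"

definition arc_subsolution ::
    "(real \<Rightarrow> real \<Rightarrow> real) \<Rightarrow> real \<Rightarrow> ereal \<Rightarrow> (real \<times> real \<Rightarrow> real) \<Rightarrow> bool" where
  "arc_subsolution h T0 T1 w \<longleftrightarrow>
     (\<forall>s\<in>{0<..<1}. \<forall>t\<in>einterval T0 T1. \<forall>\<phi>. supertangent w (s, t) \<phi> \<longrightarrow>
        time_deriv \<phi> s t + h s (space_deriv \<phi> s t) \<le> 0)"


subsection \<open>The equation on the network\<close>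

definition spacetime ::
    "(real \<Rightarrow> 'a::euclidean_space) set \<Rightarrow> real \<Rightarrow> ereal \<Rightarrow> ('a \<times> real) set" where
  "spacetime E T0 T1 = support E \<times> {t. T0 \<le> t \<and> ereal t < T1}"

definition along :: "('a \<times> real \<Rightarrow> real) \<Rightarrow> (real \<Rightarrow> 'a) \<Rightarrow> real \<times> real \<Rightarrow> real" where
  "along v \<gamma> = (\<lambda>(s, t). v (\<gamma> s, t))"

definition HJ_supersolution ::
    "(real \<Rightarrow> 'a::euclidean_space) set \<Rightarrow> ((real \<Rightarrow> 'a) \<Rightarrow> real \<Rightarrow> real \<Rightarrow> real) \<Rightarrow> ('a \<Rightarrow> real)
      \<Rightarrow> real \<Rightarrow> ereal \<Rightarrow> ('a \<times> real \<Rightarrow> real) \<Rightarrow> bool" where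
  "HJ_supersolution E H c T0 T1 v \<longleftrightarrow>
     continuous_on (spacetime E T0 T1) v \<and>
     (\<forall>\<gamma>\<in>E. arc_supersolution (H \<gamma>) T0 T1 (along v \<gamma>)) \<and>
     (\<forall>x\<in>vertices E. \<forall>t\<^sub>0\<in>einterval T0 T1.
        (\<exists>\<phi>. subtangent (\<lambda>t. v (x, t)) t\<^sub>0 \<phi> \<and> deriv \<phi> t\<^sub>0 < c x) \<longrightarrow>
        (\<exists>\<gamma>\<in>arcs_into E x. \<forall>\<phi>.
           constrained_subtangent ({0..1} \<times> closure (einterval T0 T1)) (along v \<gamma>) (1, t\<^sub>0) \<phi> \<longrightarrow>
           time_deriv \<phi> 1 t\<^sub>0 + H \<gamma> 1 (space_deriv \<phi> 1 t\<^sub>0) \<ge> 0))"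

definition HJ_subsolution ::
    "(real \<Rightarrow> 'a::euclidean_space) set \<Rightarrow> ((real \<Rightarrow> 'a) \<Rightarrow> real \<Rightarrow> real \<Rightarrow> real) \<Rightarrow> ('a \<Rightarrow> real)
      \<Rightarrow> real \<Rightarrow> ereal \<Rightarrow> ('a \<times> real \<Rightarrow> real) \<Rightarrow> bool" where
  "HJ_subsolution E H c T0 T1 v \<longleftrightarrow>
     continuous_on (spacetime E T0 T1) v \<and>
     (\<forall>\<gamma>\<in>E. arc_subsolution (H \<gamma>) T0 T1 (along v \<gamma>)) \<and>
     (\<forall>x\<in>vertices E. \<forall>t\<^sub>0\<in>einterval T0 T1. \<forall>\<psi>.
        supertangent (\<lambda>t. v (x, t)) t\<^sub>0 \<psi> \<longrightarrow> deriv \<psi> t\<^sub>0 \<le> c x)"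

definition HJ_solution ::
    "(real \<Rightarrow> 'a::euclidean_space) set \<Rightarrow> ((real \<Rightarrow> 'a) \<Rightarrow> real \<Rightarrow> real \<Rightarrow> real) \<Rightarrow> ('a \<Rightarrow> real)
      \<Rightarrow> real \<Rightarrow> ereal \<Rightarrow> ('a \<times> real \<Rightarrow> real) \<Rightarrow> bool" where
  "HJ_solution E H c T0 T1 v \<longleftrightarrow> HJ_subsolution E H c T0 T1 v \<and> HJ_supersolution E H c T0 T1 v"

text \<open>The uniform norm takes the value infinity on unbounded functions.\<close>

definition uniform_norm :: "'b set \<Rightarrow> ('b \<Rightarrow> real) \<Rightarrow> ennreal" where
  "uniform_norm S f = (SUP x\<in>S. ennreal \<bar>f x\<bar>)"

end

theory Submission
  imports Defs
begin

text \<open>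
  The estimate is a comparison principle, and the existence of the limit solution is a stability
  property.

  For the comparison of a subsolution \<open>u\<close> with a supersolution \<open>v\<close>, sup- and inf-convolution in time
  make \<open>u\<close> semiconvex and \<open>v\<close> semiconcave in time; coercivity then makes \<open>u\<close> Lipschitz in space. At a
  maximum point of \<open>u - v\<close>, penalized in time, the time derivatives of both functions exist and are
  attained continuously, so that only a stationary problem on one arc is left. At a vertex the
  subsolution condition forces the slope of \<open>v\<close> to be below the flux limiter, which provides an arc
  along which \<open>v\<close> is a supersolution up to the end point; there a doubling of the space variable
  shifted into the arc concludes.

  Stability is standard touching except for the supersolution condition at a vertex, where the
  good arc of the approximating solutions varies with the time. Convexity of the Hamiltonians and
  the bound on the flux limiter allow the violating test functions of all arcs to be combined into
  one test function on the whole neighbourhood of the vertex.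
\<close>

subsection \<open>Touching by parabolas\<close>

text \<open>Doubling all variables at once would have to cross a vertex, where the arcs have no
  common coordinate, and the arc offered by the supersolution condition is known only once the
  contact point and its time are fixed. So time is regularised first, by convolutions that leave the
  space variable alone; this does no harm because the Hamiltonians do not depend on time and the
  convolved functions still live on the network. Only then is an arc selected and the space variable
  doubled on it. Coercivity bounds the slopes of the subsolution only, so every penalty estimate
  rests on the Lipschitz bound of \<open>u\<close> alone. The delicate passage leads back from the
  slice to space-time at the end point: a slope on the slice is no test function in both variables,
  and \<open>end_subjet_of_slice\<close> repairs this by interpolating in time. In the stability
  part strictness is guaranteed for only one of the combined affine functions at a time; the
  argument therefore needs a lower bound for its weight that does not depend on the smoothing
  parameter, and this dictates the order in which the constants are chosen.\<close>

definition superjet1 :: "(real \<Rightarrow> real) \<Rightarrow> real \<Rightarrow> real \<Rightarrow> bool" where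
  "superjet1 f s p \<longleftrightarrow> (\<exists>K. \<exists>r>0. \<forall>s'. \<bar>s' - s\<bar> < r \<longrightarrow>
     f s' \<le> f s + p * (s' - s) + K * (s' - s)\<^sup>2)"

text \<open>Like \<open>superjet1\<close>, a proximal supergradient. Parabolas are enough as test
  functions for the comparison, and they can be played off against parabolas supporting from the
  other side, which is how slopes get identified.\<close>

definition superjet2 :: "(real \<Rightarrow> real \<Rightarrow> real) \<Rightarrow> real \<Rightarrow> real \<Rightarrow> real \<Rightarrow> real \<Rightarrow> bool" where
  "superjet2 w s t p a \<longleftrightarrow> (\<exists>K. \<exists>r>0. \<forall>s' t'. \<bar>s' - s\<bar> < r \<longrightarrow> \<bar>t' - t\<bar> < r \<longrightarrow>
     w s' t' \<le> w s t + p * (s' - s) + a * (t' - t) + K * ((s' - s)\<^sup>2 + (t' - t)\<^sup>2))"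

definition end_subjet :: "(real \<Rightarrow> real \<Rightarrow> real) \<Rightarrow> real \<Rightarrow> real \<Rightarrow> real \<Rightarrow> bool" where
  "end_subjet w t p a \<longleftrightarrow> (\<exists>K. \<exists>r>0. \<forall>s' t'. 1 - r < s' \<longrightarrow> s' \<le> 1 \<longrightarrow> \<bar>t' - t\<bar> < r \<longrightarrow>
     w 1 t + p * (s' - 1) + a * (t' - t) - K * ((s' - 1)\<^sup>2 + (t' - t)\<^sup>2) \<le> w s' t')"

lemma superjet2_time:
  assumes "superjet2 w s t p a"
  shows "superjet1 (w s) t a"
proof -
  obtain K r where "r > 0" and K: "\<And>s' t'. \<bar>s' - s\<bar> < r \<Longrightarrow> \<bar>t' - t\<bar> < r \<Longrightarrow>
     w s' t' \<le> w s t + p * (s' - s) + a * (t' - t) + K * ((s' - s)\<^sup>2 + (t' - t)\<^sup>2)"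
    using assms unfolding superjet2_def by blast
  show ?thesis unfolding superjet1_def
    using K[of s] \<open>r > 0\<close> by (intro exI[of _ K] exI[of _ r]) auto
qed

lemma slope_unique:
  fixes a b :: real
  assumes "r > 0" "\<And>x. \<bar>x\<bar> < r \<Longrightarrow> a * x \<le> b * x + K * x\<^sup>2"
  shows "a = b"
proof (rule ccontr)
  assume "a \<noteq> b"
  \<comment> \<open>Small enough that the quadratic term cannot make up for the difference of the
    slopes at a point of size \<open>y\<close> with the sign of \<open>a - b\<close>.\<close>
  define y where "y = min (r/2) (\<bar>a - b\<bar> / (2 * (\<bar>K\<bar> + 1)))"
  have y: "y > 0" "y < r" using assms(1) \<open>a \<noteq> b\<close> by (auto simp: y_def)
  have "y * (2 * (\<bar>K\<bar> + 1)) \<le> \<bar>a - b\<bar>"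
    using pos_le_divide_eq[of "2 * (\<bar>K\<bar> + 1)" y "\<bar>a - b\<bar>"] by (simp add: y_def)
  hence 1: "y * (\<bar>K\<bar> + 1) < \<bar>a - b\<bar>" using y by (smt (verit, best) mult_pos_pos abs_ge_zero distrib_left)
  define x where "x = (if a > b then y else - y)"
  have "(a - b) * x = \<bar>a - b\<bar> * y" "x\<^sup>2 = y * y" "\<bar>x\<bar> < r"
    using y by (auto simp: x_def power2_eq_square abs_if algebra_simps)
  with assms(2)[of x] have "\<bar>a - b\<bar> * y \<le> K * (y * y)" by (simp add: algebra_simps)
  hence "\<bar>a - b\<bar> * y \<le> (K * y) * y" by (simp add: mult.assoc)
  hence "\<bar>a - b\<bar> \<le> K * y" using y by simp
  also have "\<dots> \<le> y * (\<bar>K\<bar> + 1)" using y by (smt (verit) mult.commute mult_left_mono abs_ge_self)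
  finally show False using 1 by simp
qed

text \<open>A function squeezed at \<open>t\<close> between two parabolas is differentiable there,
  and both slopes are its derivative. A sup-convolution has a supporting parabola from below
  everywhere, so each of its superjet slopes inherits the bounds known for that parabola.\<close>

lemma superjet1_support:
  assumes "superjet1 f t a" "\<delta> > 0"
    and "\<And>t'. \<bar>t' - t\<bar> < \<delta> \<Longrightarrow> f t + b * (t' - t) - C * (t' - t)\<^sup>2 \<le> f t'"
  shows "a = b"
proof -
  obtain K r where "r > 0" and K: "\<And>s'. \<bar>s' - t\<bar> < r \<Longrightarrow>
     f s' \<le> f t + a * (s' - t) + K * (s' - t)\<^sup>2"
    using assms(1) unfolding superjet1_def by blast
  have "b = a"
  proof (rule slope_unique[where r = "min r \<delta>" and K = "K + C"])
    fix x :: real assume "\<bar>x\<bar> < min r \<delta>"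
    thus "b * x \<le> a * x + (K + C) * x\<^sup>2"
      using K[of "t + x"] assms(3)[of "t + x"] by (simp add: algebra_simps)
  qed (use \<open>r > 0\<close> assms in auto)
  thus ?thesis ..
qed

text \<open>If the increment exceeded that of a line of slope \<open>L' > L\<close>, then
  \<open>f\<close> minus this line would be larger at \<open>b\<close> than at \<open>a\<close>.
  Subtracting a barrier that blows up at \<beta> forces an interior maximum, where the superjet
  slope exceeds \<open>L'\<close>. The right end point itself is reached by continuity.\<close>

lemma superjet1_slope_imp_lipschitz:
  fixes f :: "real \<Rightarrow> real"
  assumes cont: "continuous_on {\<alpha>..\<beta>} f"
    and slope: "\<And>s p. \<alpha> < s \<Longrightarrow> s < \<beta> \<Longrightarrow> superjet1 f s p \<Longrightarrow> p \<le> L"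
    and ab: "\<alpha> \<le> a" "a \<le> b" "b \<le> \<beta>"
  shows "f b - f a \<le> L * (b - a)"
proof -
  have main: "f b - f a \<le> L' * (b - a)" if "L < L'" "\<alpha> \<le> a" "a < b" "b < \<beta>" for L' a b
  proof (rule ccontr)
    assume neg: "\<not> ?thesis"
    define G where "G = f b - f a - L' * (b - a)"
    have gap: "G > 0" using neg by (simp add: G_def)
    \<comment> \<open>The barrier then costs half of the excess \<open>G\<close> at
      \<open>b\<close>, so \<open>b\<close> still beats \<open>a\<close>.\<close>
    define k where "k = G * (\<beta> - b) / 2"
    have k: "k > 0" "k / (\<beta> - b) < G"
      using gap that by (auto simp: k_def) (simp add: divide_simps)
    define \<phi> where "\<phi> = (\<lambda>s. f s - L' * s - k / (\<beta> - s))"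
    have "continuous_on {a..\<beta>} f" by (rule continuous_on_subset[OF cont]) (use that in auto)
    then have "compact (f ` {a..\<beta>})" by (intro compact_continuous_image) auto
    then obtain M where M: "\<And>s. s \<in> {a..\<beta>} \<Longrightarrow> \<bar>f s\<bar> \<le> M"
      by (metis bounded_iff compact_imp_bounded image_eqI real_norm_def)
    define M' where "M' = M + \<bar>L'\<bar> * (\<bar>a\<bar> + \<bar>\<beta>\<bar>)"
    have M': "f s - L' * s \<le> M'" if "s \<in> {a..\<beta>}" for s
    proof -
      have "\<bar>s\<bar> \<le> \<bar>a\<bar> + \<bar>\<beta>\<bar>" using that by auto
      hence "\<bar>L' * s\<bar> \<le> \<bar>L'\<bar> * (\<bar>a\<bar> + \<bar>\<beta>\<bar>)" by (simp add: abs_mult mult_left_mono)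
      thus ?thesis using M[OF that] unfolding M'_def by linarith
    qed
    \<comment> \<open>From \<beta>' on, the barrier pushes \<phi> below its value at
      \<open>a\<close>, so the maximum over the compact interval up to \<beta>' is not attained at
      its right end.\<close>
    define \<beta>' where "\<beta>' = max b (\<beta> - k / (\<bar>M' - \<phi> a\<bar> + 1))"
    have \<beta>': "b \<le> \<beta>'" "\<beta>' < \<beta>" using that k by (auto simp: \<beta>'_def)
    have far: "\<phi> s < \<phi> a" if "\<beta>' \<le> s" "s < \<beta>" for s
    proof -
      have "\<beta> - s \<le> k / (\<bar>M' - \<phi> a\<bar> + 1)" using that by (auto simp: \<beta>'_def)
      hence "\<bar>M' - \<phi> a\<bar> + 1 \<le> k / (\<beta> - s)"
        using that by (simp add: field_simps)
      thus ?thesis using M'[of s] that \<beta>' \<open>a < b\<close> unfolding \<phi>_def by auto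
    qed
    have "continuous_on {a..\<beta>'} \<phi>" unfolding \<phi>_def
      using \<beta>' by (intro continuous_intros continuous_on_subset[OF \<open>continuous_on {a..\<beta>} f\<close>]) auto
    then obtain s where s: "s \<in> {a..\<beta>'}" and smax: "\<And>s'. s' \<in> {a..\<beta>'} \<Longrightarrow> \<phi> s' \<le> \<phi> s"
      using continuous_attains_sup[of "{a..\<beta>'}" \<phi>] \<beta>'(1) \<open>a < b\<close> by fastforce
    have "\<phi> b > \<phi> a"
    proof -
      have "k / (\<beta> - a) > 0" using k that by simp
      thus ?thesis using k unfolding \<phi>_def G_def by (simp add: right_diff_distrib)
    qed
    hence "\<phi> s > \<phi> a" using smax[of b] \<beta>'(1) \<open>a < b\<close> by force
    hence s': "a < s" "s < \<beta>'" using s far[of s] \<beta>' by (force simp: order.order_iff_strict)+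
    define c where "c = \<beta> - s"
    have c: "c > 0" using s' \<beta>' by (simp add: c_def)
    have "superjet1 f s (L' + k / c\<^sup>2)"
      unfolding superjet1_def
    proof (intro exI conjI allI impI)
      show "min (c/2) (min (s - a) (\<beta>' - s)) > 0" using s' c by simp
      fix s1 assume s1: "\<bar>s1 - s\<bar> < min (c/2) (min (s - a) (\<beta>' - s))"
      define x where "x = s1 - s"
      have x: "\<bar>x\<bar> < c / 2" using s1 by (simp add: x_def)
      have "\<phi> s1 \<le> \<phi> s" by (rule smax) (use s1 in \<open>auto simp: abs_less_iff\<close>)
      hence "f s1 \<le> f s + L' * x + k / (c - x) - k / c"
        by (simp add: \<phi>_def c_def x_def algebra_simps)
      also have "k / (c - x) = k / c + k / c\<^sup>2 * x + k / (c\<^sup>2 * (c - x)) * x\<^sup>2"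
        using x c by (simp add: divide_simps) (simp add: algebra_simps power2_eq_square)
      also have "k / (c\<^sup>2 * (c - x)) * x\<^sup>2 \<le> (2 * k / c ^ 3) * x\<^sup>2"
      proof (rule mult_right_mono)
        have "c\<^sup>2 * (c / 2) \<le> c\<^sup>2 * (c - x)" using x c by (intro mult_left_mono) auto
        hence "k / (c\<^sup>2 * (c - x)) \<le> k / (c\<^sup>2 * (c / 2))"
          using k c by (intro divide_left_mono mult_pos_pos) (use x in auto)
        thus "k / (c\<^sup>2 * (c - x)) \<le> 2 * k / c ^ 3" by (simp add: power2_eq_square power3_eq_cube mult.commute)
      qed simp
      finally show "f s1 \<le> f s + (L' + k / c\<^sup>2) * (s1 - s) + (2 * k / c ^ 3) * (s1 - s)\<^sup>2"
        by (simp add: x_def algebra_simps)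
    qed
    with slope[of s "L' + k / c\<^sup>2"] s' that \<beta>' have "L' + k / c\<^sup>2 \<le> L" by auto
    moreover have "k / c\<^sup>2 > 0" using k c by simp
    ultimately show False using \<open>L < L'\<close> by linarith
  qed
  have main2: "f b - f a \<le> L * (b - a)" if "\<alpha> \<le> a" "a < b" "b < \<beta>" for a b
  proof (rule field_le_epsilon)
    fix e :: real assume "e > 0"
    then have "f b - f a \<le> (L + e / (b - a)) * (b - a)"
      using main[of "L + e / (b - a)" a b] that by simp
    also have "\<dots> = L * (b - a) + e" using that by (simp add: distrib_right)
    finally show "f b - f a \<le> L * (b - a) + e" .
  qed
  show ?thesis
  proof (cases "a < b")
    case True
    let ?g = "\<lambda>s. f s - f a - L * (s - a)"
    have "continuous_on {a..b} ?g"
      by (intro continuous_intros continuous_on_subset[OF cont]) (use ab in auto)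
    hence "(?g \<longlongrightarrow> ?g b) (at b within {a..b})" using True by (simp add: continuous_on)
    hence lim: "(?g \<longlongrightarrow> ?g b) (at_left b)" using True by (simp add: at_within_Icc_at_left)
    have "\<forall>\<^sub>F s in at_left b. ?g s \<le> 0"
      unfolding eventually_at_left[OF True]
    proof (intro exI[of _ a] conjI allI impI)
      fix y assume "a < y" "y < b"
      thus "?g y \<le> 0" using main2[of a y] ab by simp
    qed (use True in simp)
    hence "?g b \<le> 0" by (intro tendsto_upperbound[OF lim]) (auto simp: trivial_limit_at_left_real)
    thus ?thesis by simp
  qed (use ab in auto)
qed

section \<open>Time slopes near a contact point, time slices, and jets at the end of an arc\<close>

lemma dist_Pair_le:
  fixes s t s' t' :: real
  shows "dist (s, t) (s', t') \<le> \<bar>s - s'\<bar> + \<bar>t - t'\<bar>"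
  by (simp add: dist_Pair_Pair dist_real_def sqrt_sum_squares_le_sum_abs)

lemma continuous_on_box_eps_delta:
  fixes w :: "real \<Rightarrow> real \<Rightarrow> real"
  assumes "continuous_on (A \<times> B) (\<lambda>(s, t). w s t)" "s0 \<in> A" "t0 \<in> B" "e > 0"
  obtains \<delta> where "\<delta> > 0" "\<And>s t. s \<in> A \<Longrightarrow> t \<in> B \<Longrightarrow> \<bar>s - s0\<bar> < \<delta> \<Longrightarrow> \<bar>t - t0\<bar> < \<delta> \<Longrightarrow>
    \<bar>w s t - w s0 t0\<bar> < e"
proof -
  obtain d where d: "d > 0" "\<And>z. z \<in> A \<times> B \<Longrightarrow> dist z (s0, t0) < d \<Longrightarrow>
      dist (case z of (s, t) \<Rightarrow> w s t) (w s0 t0) < e"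
    using assms unfolding continuous_on_iff by fastforce
  show ?thesis
  proof (rule that[of "d / 2"])
    fix s t assume st: "s \<in> A" "t \<in> B" "\<bar>s - s0\<bar> < d / 2" "\<bar>t - t0\<bar> < d / 2"
    have "dist (s, t) (s0, t0) \<le> \<bar>s - s0\<bar> + \<bar>t - t0\<bar>" by (rule dist_Pair_le)
    hence "dist (s, t) (s0, t0) < d" using st by linarith
    thus "\<bar>w s t - w s0 t0\<bar> < e" using d(2)[of "(s, t)"] st by (simp add: dist_real_def)
  qed (use d in simp)
qed

text \<open>Lower semicontinuity of the time slope of a function that is semiconvex in time.
  Squeezing identifies \<open>a\<close> with the slope of the supporting parabola, so
  \<open>a\<close> dominates the backward difference quotient of step \<open>h\<close> up to
  \<open>C * h\<close>. For fixed \<open>h\<close> this quotient is continuous in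
  \<open>(s, t)\<close>, and at \<open>(s0, t0)\<close> it is at least
  \<open>b - C' * h\<close>.\<close>

lemma superjet1_slope_ge:
  fixes w :: "real \<Rightarrow> real \<Rightarrow> real"
  assumes cont: "continuous_on ({0..1} \<times> {t0 - r..t0 + r}) (\<lambda>(s, t). w s t)"
    and r: "r > 0" and s0: "s0 \<in> {0..1}" and \<theta>: "\<theta> > 0"
    and supp: "\<And>s t. s \<in> {0..1} \<Longrightarrow> \<bar>t - t0\<bar> \<le> r \<Longrightarrow>
      \<exists>b. \<forall>t'. \<bar>t' - t0\<bar> \<le> r \<longrightarrow> w s t + b * (t' - t) - C * (t' - t)\<^sup>2 \<le> w s t'"
    and upper: "\<And>t. \<bar>t - t0\<bar> \<le> r \<Longrightarrow> w s0 t \<le> w s0 t0 + b * (t - t0) + C' * (t - t0)\<^sup>2"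
  obtains r' where "r' > 0" "r' \<le> r"
    "\<And>s t a. s \<in> {0..1} \<Longrightarrow> \<bar>s - s0\<bar> < r' \<Longrightarrow> \<bar>t - t0\<bar> < r' \<Longrightarrow> superjet1 (w s) t a \<Longrightarrow> b - \<theta> \<le> a"
proof -
  define B where "B = \<bar>C\<bar> + \<bar>C'\<bar> + 1"
  have B: "B > 0" "C + C' \<le> B" by (auto simp: B_def)
  \<comment> \<open>The step is fixed before the neighbourhood: one third of \<theta> pays for the
    curvatures, and another third for the continuity errors of two values of
    \<open>w\<close>.\<close>
  define h where "h = min (r/2) (\<theta> / (3 * B))"
  have h: "h > 0" "h \<le> r / 2" "h * B \<le> \<theta> / 3"
    using r \<theta> B by (auto simp: h_def min_def field_simps)
  obtain \<delta>1 where \<delta>1: "\<delta>1 > 0" "\<And>s t. s \<in> {0..1} \<Longrightarrow> t \<in> {t0 - r..t0 + r} \<Longrightarrow> \<bar>s - s0\<bar> < \<delta>1 \<Longrightarrow>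
      \<bar>t - t0\<bar> < \<delta>1 \<Longrightarrow> \<bar>w s t - w s0 t0\<bar> < \<theta> * h / 6"
    by (rule continuous_on_box_eps_delta[OF cont s0, of t0 "\<theta> * h / 6"]) (use r h \<theta> in auto)
  obtain \<delta>2 where \<delta>2: "\<delta>2 > 0" "\<And>s t. s \<in> {0..1} \<Longrightarrow> t \<in> {t0 - r..t0 + r} \<Longrightarrow> \<bar>s - s0\<bar> < \<delta>2 \<Longrightarrow>
      \<bar>t - (t0 - h)\<bar> < \<delta>2 \<Longrightarrow> \<bar>w s t - w s0 (t0 - h)\<bar> < \<theta> * h / 6"
    by (rule continuous_on_box_eps_delta[OF cont s0, of "t0 - h" "\<theta> * h / 6"]) (use r h \<theta> in auto)
  show ?thesis
  proof (rule that[of "min (r / 2) (min \<delta>1 \<delta>2)"])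
    fix s t a assume st: "s \<in> {0..1}" "\<bar>s - s0\<bar> < min (r / 2) (min \<delta>1 \<delta>2)"
      "\<bar>t - t0\<bar> < min (r / 2) (min \<delta>1 \<delta>2)" and jet: "superjet1 (w s) t a"
    have tr: "\<bar>t - t0\<bar> \<le> r" using st r by linarith
    obtain b' where b': "\<And>t'. \<bar>t' - t0\<bar> \<le> r \<Longrightarrow> w s t + b' * (t' - t) - C * (t' - t)\<^sup>2 \<le> w s t'"
      using supp[OF st(1) tr] by blast
    have "a = b'"
    proof (rule superjet1_support[OF jet, of "r / 2" b' C])
      fix t' assume "\<bar>t' - t\<bar> < r / 2"
      hence "\<bar>t' - t0\<bar> \<le> r" using st(3) by linarith
      thus "w s t + b' * (t' - t) - C * (t' - t)\<^sup>2 \<le> w s t'" by (rule b')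
    qed (use r in simp)
    have "w s t + a * (- h) - C * h\<^sup>2 \<le> w s (t - h)"
      using b'[of "t - h"] st h \<open>a = b'\<close> by (simp add: abs_if split: if_splits)
    moreover have "\<bar>w s t - w s0 t0\<bar> < \<theta> * h / 6" using \<delta>1(2)[of s t] st tr by (auto simp: abs_if split: if_splits)
    moreover have "\<bar>w s (t - h) - w s0 (t0 - h)\<bar> < \<theta> * h / 6"
      using \<delta>2(2)[of s "t - h"] st h by (auto simp: abs_if split: if_splits)
    moreover have "w s0 (t0 - h) \<le> w s0 t0 - b * h + C' * h\<^sup>2"
      using upper[of "t0 - h"] h r by (simp add: abs_if)
    moreover have "(C + C') * h\<^sup>2 = C * h\<^sup>2 + C' * h\<^sup>2" by (simp add: distrib_right)
    ultimately have "a * h \<ge> b * h - (C + C') * h\<^sup>2 - \<theta> * h / 3"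
      by linarith
    moreover have "(C + C') * h\<^sup>2 \<le> \<theta> / 3 * h"
    proof -
      have "(C + C') * h * h \<le> B * h * h" using B h by (intro mult_right_mono) auto
      also have "B * h * h \<le> \<theta> / 3 * h" using h by (intro mult_right_mono) (auto simp: mult.commute)
      finally show ?thesis by (simp add: power2_eq_square mult.assoc)
    qed
    moreover have "\<theta> * h > 0" using \<theta> h by simp
    ultimately have "(b - \<theta>) * h \<le> a * h" by (simp add: algebra_simps)
    thus "b - \<theta> \<le> a" using h by simp
  qed (use \<delta>1 \<delta>2 r in auto)
qed

text \<open>A bound on the time slopes of a subsolution turns its restriction to a fixed time into a
  subsolution of a stationary equation.\<close>

lemma superjet1_slice_subsolution:
  fixes w h :: "real \<Rightarrow> real \<Rightarrow> real"
  assumes cont: "continuous_on ({0..1} \<times> {t0 - r..t0 + r}) (\<lambda>(s, t). w s t)"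
    and hcont: "continuous_on ({0..1} \<times> UNIV) (\<lambda>(s, p). h s p)"
    and r: "r > 0" and s0: "0 < s0" "s0 < 1"
    and sub: "\<And>s t p a. \<bar>s - s0\<bar> < r \<Longrightarrow> \<bar>t - t0\<bar> < r \<Longrightarrow> 0 < s \<Longrightarrow> s < 1 \<Longrightarrow>
      superjet2 w s t p a \<Longrightarrow> a + h s p \<le> 0"
    and slope: "\<And>s t a. \<bar>s - s0\<bar> < r \<Longrightarrow> \<bar>t - t0\<bar> < r \<Longrightarrow> 0 < s \<Longrightarrow> s < 1 \<Longrightarrow>
      superjet1 (w s) t a \<Longrightarrow> A \<le> a"
    and jet: "superjet1 (\<lambda>s. w s t0) s0 p"
  shows "A + h s0 p \<le> 0"
proof (rule ccontr)
  assume "\<not> ?thesis"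
  hence pos: "A + h s0 p > 0" by simp
  obtain K rj where rj: "rj > 0" and K: "\<And>s. \<bar>s - s0\<bar> < rj \<Longrightarrow>
     w s t0 \<le> w s0 t0 + p * (s - s0) + K * (s - s0)\<^sup>2"
    using jet unfolding superjet1_def by blast
  obtain \<delta> where \<delta>: "\<delta> > 0" "\<And>s p'. s \<in> {0..1} \<Longrightarrow> p' \<in> UNIV \<Longrightarrow> \<bar>s - s0\<bar> < \<delta> \<Longrightarrow> \<bar>p' - p\<bar> < \<delta> \<Longrightarrow>
    \<bar>h s p' - h s0 p\<bar> < A + h s0 p"
    by (rule continuous_on_box_eps_delta[OF hcont, of s0 p "A + h s0 p"]) (use pos s0 in auto)
  \<comment> \<open>Exceeding \<open>K\<close> by at least one makes the contact at
    \<open>s0\<close> strict along the slice, with a margin that covers the continuity error allowed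
    at the two ends of the box.\<close>
  define K' where "K' = \<bar>K\<bar> + 1"
  have K': "K' \<ge> 1" "K + 1 \<le> K'" by (auto simp: K'_def)
  define \<rho> where "\<rho> = min (min (rj / 2) (r / 2)) (min (min (s0 / 2) ((1 - s0) / 2)) (\<delta> / (4 * K')))"
  have \<rho>: "\<rho> > 0" "\<rho> < rj" "\<rho> < r" "\<rho> < s0" "\<rho> < 1 - s0" "2 * K' * \<rho> < \<delta>"
  proof -
    have "\<rho> \<le> \<delta> / (4 * K')" unfolding \<rho>_def by simp
    hence "\<rho> * (4 * K') \<le> \<delta>" using K' by (simp add: pos_le_divide_eq)
    thus "2 * K' * \<rho> < \<delta>" using \<delta> by (simp add: algebra_simps)
    have "\<rho> \<le> (1 - s0) / 2" unfolding \<rho>_def by (intro min.coboundedI2 min.coboundedI1 order_refl)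
    also have "(1 - s0) / 2 < 1 - s0" using s0 by simp
    finally show "\<rho> < 1 - s0" .
  qed (use rj r s0 \<delta> K' in \<open>auto simp: \<rho>_def\<close>)
  have "\<rho> \<le> 2 * K' * \<rho>" using K' \<rho> by simp
  hence \<rho>\<delta>: "\<rho> < \<delta>" using \<rho> by linarith
  define I where "I = {t0 - r..t0 + r}"
  obtain d1 where d1: "d1 > 0" "\<And>s t. s \<in> {0..1} \<Longrightarrow> t \<in> I \<Longrightarrow> \<bar>s - (s0 + \<rho>)\<bar> < d1 \<Longrightarrow>
      \<bar>t - t0\<bar> < d1 \<Longrightarrow> \<bar>w s t - w (s0 + \<rho>) t0\<bar> < \<rho>\<^sup>2" unfolding I_def
    by (rule continuous_on_box_eps_delta[OF cont, of "s0 + \<rho>" t0 "\<rho>\<^sup>2"]) (use \<rho> r s0 in auto)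
  obtain d2 where d2: "d2 > 0" "\<And>s t. s \<in> {0..1} \<Longrightarrow> t \<in> I \<Longrightarrow> \<bar>s - (s0 - \<rho>)\<bar> < d2 \<Longrightarrow>
      \<bar>t - t0\<bar> < d2 \<Longrightarrow> \<bar>w s t - w (s0 - \<rho>) t0\<bar> < \<rho>\<^sup>2" unfolding I_def
    by (rule continuous_on_box_eps_delta[OF cont, of "s0 - \<rho>" t0 "\<rho>\<^sup>2"]) (use \<rho> r s0 in auto)
  define \<rho>' where "\<rho>' = min (r / 2) (min (d1 / 2) (d2 / 2))"
  have \<rho>': "\<rho>' > 0" "\<rho>' < r" "\<rho>' < d1" "\<rho>' < d2" using r d1 d2 by (auto simp: \<rho>'_def)
  have "compact ((\<lambda>(s, t). w s t) ` ({0..1} \<times> I))" unfolding I_def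
    by (intro compact_continuous_image[OF cont] compact_Times) auto
  then obtain M where "\<forall>y \<in> (\<lambda>(s, t). w s t) ` ({0..1} \<times> I). \<bar>y\<bar> \<le> M"
    using compact_imp_bounded bounded_real by blast
  hence M: "\<bar>w s t\<bar> \<le> M" if "s \<in> {0..1}" "t \<in> I" for s t
    using that by force
  \<comment> \<open>At distance \<rho>' in time the penalty costs more than \<open>w\<close> and the
    linear term together can gain, so the maximum stays in the interior of the box.\<close>
  define n where "n = (2 * M + \<bar>p\<bar> * \<rho> + 1) / \<rho>'\<^sup>2"
  have "M \<ge> 0" using M[of s0 t0] s0 r by (force simp: I_def)
  hence n: "n \<ge> 0" "n * \<rho>'\<^sup>2 = 2 * M + \<bar>p\<bar> * \<rho> + 1" using \<rho>' \<rho> by (auto simp: n_def)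
  define \<Phi> where "\<Phi> = (\<lambda>(s, t). w s t - p * (s - s0) - K' * (s - s0)\<^sup>2 - n * (t - t0)\<^sup>2)"
  define Q where "Q = {s0 - \<rho>..s0 + \<rho>} \<times> {t0 - \<rho>'..t0 + \<rho>'}"
  have Qsub: "Q \<subseteq> {0..1} \<times> I" using \<rho> \<rho>' by (auto simp: Q_def I_def)
  have "continuous_on Q (\<lambda>(s, t). w s t)"
    using continuous_on_subset[OF cont] Qsub unfolding I_def by blast
  hence "continuous_on Q \<Phi>"
    unfolding \<Phi>_def case_prod_beta by (intro continuous_intros)
  moreover have "compact Q" "Q \<noteq> {}" using \<rho> \<rho>' by (auto simp: Q_def intro: compact_Times)
  ultimately obtain z where z: "z \<in> Q" "\<And>z'. z' \<in> Q \<Longrightarrow> \<Phi> z' \<le> \<Phi> z"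
    using continuous_attains_sup[of Q \<Phi>] by metis
  obtain s1 t1 where z_eq: "z = (s1, t1)" by fastforce
  have st1: "s1 \<in> {s0 - \<rho>..s0 + \<rho>}" "t1 \<in> {t0 - \<rho>'..t0 + \<rho>'}" using z(1) by (auto simp: Q_def z_eq)
  have max: "\<Phi> (s, t) \<le> \<Phi> (s1, t1)" if "\<bar>s - s0\<bar> \<le> \<rho>" "\<bar>t - t0\<bar> \<le> \<rho>'" for s t
    using z(2)[of "(s, t)"] that by (auto simp: Q_def z_eq abs_le_iff)
  have ge: "\<Phi> (s1, t1) \<ge> w s0 t0" using max[of s0 t0] \<rho> \<rho>' by (simp add: \<Phi>_def)
  have t1I: "t1 \<in> I" and s1I: "s1 \<in> {0..1}" using z(1) Qsub z_eq by auto
  have nt: "0 \<le> n * (t1 - t0)\<^sup>2" using n by simp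
  have "s1 \<noteq> s0 + \<rho>"
  proof
    assume eq: "s1 = s0 + \<rho>"
    have "w s1 t1 < w s1 t0 + \<rho>\<^sup>2" using d1(2)[of s1 t1] st1 t1I s1I eq \<rho>' d1(1) by (auto simp: abs_less_iff)
    also have "w s1 t0 \<le> w s0 t0 + p * \<rho> + K * \<rho>\<^sup>2" using K[of s1] eq \<rho> by simp
    finally have "\<Phi> (s1, t1) < w s0 t0 + (K + 1 - K') * \<rho>\<^sup>2" using nt unfolding \<Phi>_def eq by (simp add: algebra_simps)
    moreover have "(K + 1 - K') * \<rho>\<^sup>2 \<le> 0" using K' by (intro mult_nonpos_nonneg) auto
    ultimately show False using ge by linarith
  qed
  moreover have "s1 \<noteq> s0 - \<rho>"
  proof
    assume eq: "s1 = s0 - \<rho>"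
    have "w s1 t1 < w s1 t0 + \<rho>\<^sup>2" using d2(2)[of s1 t1] st1 t1I s1I eq \<rho>' d2(1) by (auto simp: abs_less_iff)
    also have "w s1 t0 \<le> w s0 t0 - p * \<rho> + K * \<rho>\<^sup>2" using K[of s1] eq \<rho> by simp
    finally have "\<Phi> (s1, t1) < w s0 t0 + (K + 1 - K') * \<rho>\<^sup>2" using nt unfolding \<Phi>_def eq by (simp add: algebra_simps)
    moreover have "(K + 1 - K') * \<rho>\<^sup>2 \<le> 0" using K' by (intro mult_nonpos_nonneg) auto
    ultimately show False using ge by linarith
  qed
  moreover have "\<bar>t1 - t0\<bar> \<noteq> \<rho>'"
  proof
    assume "\<bar>t1 - t0\<bar> = \<rho>'"
    hence "(t1 - t0)\<^sup>2 = \<rho>'\<^sup>2" by (metis power2_abs)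
    hence eq: "\<Phi> (s1, t1) = w s1 t1 - p * (s1 - s0) - K' * (s1 - s0)\<^sup>2 - (2 * M + \<bar>p\<bar> * \<rho> + 1)"
      using n(2) by (simp add: \<Phi>_def)
    have "\<bar>p * (s1 - s0)\<bar> \<le> \<bar>p\<bar> * \<rho>"
      using st1 unfolding abs_mult by (intro mult_left_mono) auto
    moreover have "K' * (s1 - s0)\<^sup>2 \<ge> 0" using K' by simp
    moreover have "\<bar>w s1 t1\<bar> \<le> M" "\<bar>w s0 t0\<bar> \<le> M" using M[OF s1I t1I] M[of s0 t0] s0 r by (auto simp: I_def)
    ultimately show False using eq ge by linarith
  qed
  ultimately have int: "\<bar>s1 - s0\<bar> < \<rho>" "\<bar>t1 - t0\<bar> < \<rho>'" using st1 by auto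
  have "superjet2 w s1 t1 (p + 2 * K' * (s1 - s0)) (2 * n * (t1 - t0))"
    unfolding superjet2_def
  proof (intro exI conjI allI impI)
    show "min (\<rho> - \<bar>s1 - s0\<bar>) (\<rho>' - \<bar>t1 - t0\<bar>) > 0" using int by simp
    fix s t assume "\<bar>s - s1\<bar> < min (\<rho> - \<bar>s1 - s0\<bar>) (\<rho>' - \<bar>t1 - t0\<bar>)" "\<bar>t - t1\<bar> < min (\<rho> - \<bar>s1 - s0\<bar>) (\<rho>' - \<bar>t1 - t0\<bar>)"
    hence "\<Phi> (s, t) \<le> \<Phi> (s1, t1)" by (intro max) linarith+
    hence "w s t \<le> w s1 t1 + (p + 2 * K' * (s1 - s0)) * (s - s1) + 2 * n * (t1 - t0) * (t - t1)
        + (K' * (s - s1)\<^sup>2 + n * (t - t1)\<^sup>2)"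
      unfolding \<Phi>_def by (simp add: algebra_simps power2_eq_square)
    moreover have "K' * (s - s1)\<^sup>2 + n * (t - t1)\<^sup>2 \<le> (K' + n) * ((s - s1)\<^sup>2 + (t - t1)\<^sup>2)"
      using n K' by (simp add: algebra_simps)
    ultimately show "w s t \<le> w s1 t1 + (p + 2 * K' * (s1 - s0)) * (s - s1) + 2 * n * (t1 - t0) * (t - t1)
        + (K' + n) * ((s - s1)\<^sup>2 + (t - t1)\<^sup>2)" by linarith
  qed
  note j2 = this
  have bnd: "\<bar>s1 - s0\<bar> < r" "\<bar>t1 - t0\<bar> < r" "0 < s1" "s1 < 1" using int \<rho> \<rho>' by auto
  \<comment> \<open>The time slope of the contact parabola is produced by the penalty and is not
    controlled by its construction; the assumed bound on all time slopes is what gives it a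
    meaning.\<close>
  have "A \<le> 2 * n * (t1 - t0)" by (rule slope[OF bnd superjet2_time[OF j2]])
  moreover have "2 * n * (t1 - t0) + h s1 (p + 2 * K' * (s1 - s0)) \<le> 0" by (rule sub[OF bnd j2])
  moreover have "\<bar>h s1 (p + 2 * K' * (s1 - s0)) - h s0 p\<bar> < A + h s0 p"
  proof (rule \<delta>(2))
    have "\<bar>2 * K' * (s1 - s0)\<bar> \<le> 2 * K' * \<rho>"
      unfolding abs_mult using int K' by (intro mult_mono) auto
    thus "\<bar>p + 2 * K' * (s1 - s0) - p\<bar> < \<delta>" using \<rho> by linarith
  qed (use s1I int \<rho>\<delta> in auto)
  ultimately show False by linarith
qed

text \<open>Neither bound suffices alone: \<open>slice\<close> has the right slope in space but only
  at \<open>t0\<close>, while \<open>lower\<close> has the right slope in time but only slope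
  \<open>L\<close> in space. Semiconcavity in time puts \<open>v s t\<close> above an interpolation
  between \<open>v s t0\<close> and the value at a time beyond \<open>t\<close>, up to a controlled
  error. The remaining cross term is a product of \<open>sqrt (1 - s)\<close> and the time
  difference, which is absorbed by an arbitrarily small change of the slope.\<close>

lemma end_subjet_of_slice:
  fixes v :: "real \<Rightarrow> real \<Rightarrow> real"
  assumes r: "r > 0" and C: "C \<ge> 0" and L: "L \<ge> 0" and e: "e > 0"
    and supp: "\<And>s t. s \<in> {0..1} \<Longrightarrow> \<bar>t - t0\<bar> \<le> r \<Longrightarrow>
      \<exists>b. \<forall>t'. \<bar>t' - t0\<bar> \<le> r \<longrightarrow> v s t' \<le> v s t + b * (t' - t) + C * (t' - t)\<^sup>2"
    and lower: "\<And>s t. s \<in> {0..1} \<Longrightarrow> \<bar>t - t0\<bar> \<le> r \<Longrightarrow>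
      v 1 t0 + a * (t - t0) - 2 * C * (t - t0)\<^sup>2 - L * (1 - s) \<le> v s t"
    and slice: "\<And>s. s \<in> {0..1} \<Longrightarrow> v 1 t0 + q * (s - 1) - D * (s - 1)\<^sup>2 \<le> v s t0"
  shows "end_subjet v t0 (q + e) a"
proof -
  define B where "B = 3 * C + L + \<bar>q\<bar>"
  define K where "K = \<bar>D\<bar> + 2 * C + B\<^sup>2 / (4 * e)"
  have B: "B \<ge> 0" using C L by (simp add: B_def)
  define r' where "r' = min (1/2) (min (r / 2) (r\<^sup>2 / 4))"
  have r': "r' > 0" "r' \<le> 1/2" "r' \<le> r/2" "r' \<le> r\<^sup>2/4" using r by (auto simp: r'_def)
  show ?thesis unfolding end_subjet_def
  proof (intro exI conjI allI impI)
    show "r' > 0" by fact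
    fix s t assume s: "1 - r' < s" "s \<le> 1" and t: "\<bar>t - t0\<bar> < r'"
    define \<sigma> where "\<sigma> = 1 - s"
    define \<tau> where "\<tau> = t - t0"
    \<comment> \<open>The interpolation node lies this far beyond \<open>t\<close>. The space error
      \<open>L * \<sigma>\<close> then enters with weight
      \<open>abs \<tau> / (abs \<tau> + k)\<close>, hence with at most
      \<open>L * k * abs \<tau>\<close>.\<close>
    define k where "k = sqrt \<sigma>"
    have \<sigma>: "\<sigma> \<ge> 0" "\<sigma> < r'" "s \<in> {0..1}" using s r' by (auto simp: \<sigma>_def)
    have k: "k \<ge> 0" "k\<^sup>2 = \<sigma>" using \<sigma> by (auto simp: k_def)
    have "k < r / 2"
    proof (rule power2_less_imp_less)
      show "k\<^sup>2 < (r/2)\<^sup>2" using k \<sigma> r' by (simp add: power2_eq_square)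
    qed (use r in simp)
    have \<tau>: "\<bar>\<tau>\<bar> < r / 2" using t r' by (simp add: \<tau>_def)
    have slice': "v 1 t0 - q * \<sigma> - \<bar>D\<bar> * \<sigma>\<^sup>2 \<le> v s t0"
    proof -
      have "D * \<sigma>\<^sup>2 \<le> \<bar>D\<bar> * \<sigma>\<^sup>2" by (intro mult_right_mono) auto
      moreover have "(s - 1)\<^sup>2 = \<sigma>\<^sup>2" by (simp add: \<sigma>_def power2_eq_square algebra_simps)
      moreover have "q * (s - 1) = - (q * \<sigma>)" by (simp add: \<sigma>_def algebra_simps)
      ultimately show ?thesis using slice[OF \<sigma>(3)] by simp
    qed
    have main: "v 1 t0 - q * \<sigma> + a * \<tau> - \<bar>D\<bar> * \<sigma>\<^sup>2 - 2 * C * \<tau>\<^sup>2 - B * k * \<bar>\<tau>\<bar> \<le> v s t"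
    proof (cases "\<tau> = 0")
      case True
      hence "t = t0" by (simp add: \<tau>_def)
      thus ?thesis using slice' True by simp
    next
      case False
      define m where "m = k + \<bar>\<tau>\<bar>"
      have m: "m > 0" "m < r" using False k \<open>k < r / 2\<close> \<tau> by (auto simp: m_def)
      \<comment> \<open>The sign of \<tau>, so that \<open>t\<close> lies between \<open>t0\<close>
        and the node \<open>t2\<close>.\<close>
      define \<iota> where "\<iota> = (if \<tau> > 0 then 1 else - 1 :: real)"
      have \<iota>: "\<iota> * \<iota> = 1" "\<bar>\<iota>\<bar> = 1" "\<tau> = \<iota> * \<bar>\<tau>\<bar>" by (auto simp: \<iota>_def)
      define t2 where "t2 = t + \<iota> * k"
      have t2: "t2 - t0 = \<iota> * m" using \<iota>(3) by (simp add: t2_def m_def \<tau>_def algebra_simps)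
      have t2r: "\<bar>t2 - t0\<bar> \<le> r" unfolding t2 abs_mult using \<iota> m by simp
      obtain b where b: "\<And>t'. \<bar>t' - t0\<bar> \<le> r \<Longrightarrow> v s t' \<le> v s t + b * (t' - t) + C * (t' - t)\<^sup>2"
      proof -
        have "\<bar>t - t0\<bar> \<le> r" using \<tau> unfolding \<tau>_def by linarith
        thus ?thesis using supp[OF \<sigma>(3)] that by blast
      qed
      have 1: "v s t0 \<le> v s t - b * \<tau> + C * \<tau>\<^sup>2" using b[of t0] r by (simp add: \<tau>_def power2_eq_square algebra_simps)
      have 2: "v s t2 \<le> v s t + b * (\<iota> * k) + C * (\<iota> * k)\<^sup>2" using b[OF t2r] by (simp add: t2_def)
      have "(\<iota> * k)\<^sup>2 = k\<^sup>2" using \<iota>(1) by (simp add: power2_eq_square algebra_simps)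
      have "k * v s t0 + \<bar>\<tau>\<bar> * v s t2 \<le> k * (v s t - b * \<tau> + C * \<tau>\<^sup>2) + \<bar>\<tau>\<bar> * (v s t + b * (\<iota> * k) + C * k\<^sup>2)"
        using 1 2 k \<open>(\<iota> * k)\<^sup>2 = k\<^sup>2\<close> by (intro add_mono mult_left_mono) auto
      also have "\<dots> = m * v s t + (\<bar>\<tau>\<bar> * \<iota> - \<tau>) * (b * k) + C * k * (\<tau>\<^sup>2 + \<bar>\<tau>\<bar> * k)"
        by (simp add: m_def algebra_simps power2_eq_square)
      also have "\<bar>\<tau>\<bar> * \<iota> - \<tau> = 0" by (simp add: \<iota>_def)
      also have "\<tau>\<^sup>2 + \<bar>\<tau>\<bar> * k = \<bar>\<tau>\<bar> * m" by (simp add: m_def algebra_simps power2_eq_square abs_if)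
      finally have 3: "k * v s t0 + \<bar>\<tau>\<bar> * v s t2 \<le> m * v s t + C * k * (\<bar>\<tau>\<bar> * m)" by simp
      have "v 1 t0 + a * (\<iota> * m) - 2 * C * m\<^sup>2 - L * \<sigma> \<le> v s t2"
      proof -
        have "(\<iota> * m)\<^sup>2 = m\<^sup>2" using \<iota>(1) by (simp add: power2_eq_square algebra_simps)
        thus ?thesis using lower[OF \<sigma>(3) t2r] unfolding t2 \<sigma>_def by simp
      qed
      hence "k * (v 1 t0 - q * \<sigma> - \<bar>D\<bar> * \<sigma>\<^sup>2) + \<bar>\<tau>\<bar> * (v 1 t0 + a * (\<iota> * m) - 2 * C * m\<^sup>2 - L * \<sigma>)
          \<le> k * v s t0 + \<bar>\<tau>\<bar> * v s t2"
        using slice' k by (intro add_mono mult_left_mono) auto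
      hence 4: "m * v 1 t0 + a * m * (\<bar>\<tau>\<bar> * \<iota>) - k * q * \<sigma> - k * \<bar>D\<bar> * \<sigma>\<^sup>2 - 2 * C * m\<^sup>2 * \<bar>\<tau>\<bar> - \<bar>\<tau>\<bar> * L * \<sigma>
          - C * k * (\<bar>\<tau>\<bar> * m) \<le> m * v s t"
        using 3 by (simp add: m_def algebra_simps)
      have 5: "k * q * \<sigma> + \<bar>\<tau>\<bar> * L * \<sigma> \<le> m * (q * \<sigma>) + m * ((L + \<bar>q\<bar>) * k * \<bar>\<tau>\<bar>)"
      proof -
        have "k * q * \<sigma> + \<bar>\<tau>\<bar> * L * \<sigma> = m * (q * \<sigma>) + (L - q) * (\<bar>\<tau>\<bar> * \<sigma>)" by (simp add: m_def algebra_simps)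
        also have "(L - q) * (\<bar>\<tau>\<bar> * \<sigma>) \<le> (L + \<bar>q\<bar>) * (\<bar>\<tau>\<bar> * (k * m))"
        proof (intro mult_mono)
          show "\<sigma> \<le> k * m" using k by (simp add: m_def power2_eq_square[symmetric] algebra_simps)
        qed (use \<sigma> k L m in auto)
        finally show ?thesis by (simp add: algebra_simps)
      qed
      have 6: "k * \<bar>D\<bar> * \<sigma>\<^sup>2 \<le> m * (\<bar>D\<bar> * \<sigma>\<^sup>2)"
        unfolding mult.assoc by (intro mult_right_mono) (auto simp: m_def)
      have "m * (v 1 t0 - q * \<sigma> + a * \<tau> - \<bar>D\<bar> * \<sigma>\<^sup>2 - 2 * C * \<tau>\<^sup>2 - B * k * \<bar>\<tau>\<bar>)
         = m * v 1 t0 + a * m * \<tau> - m * (q * \<sigma>) - m * (\<bar>D\<bar> * \<sigma>\<^sup>2) - 2 * C * m * \<bar>\<tau>\<bar> * (\<bar>\<tau>\<bar> + k)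
             - m * ((L + \<bar>q\<bar>) * k * \<bar>\<tau>\<bar>) - C * k * (\<bar>\<tau>\<bar> * m)"
        by (simp add: B_def algebra_simps power2_eq_square)
      also have "\<dots> = m * v 1 t0 + a * m * \<tau> - m * (q * \<sigma>) - m * (\<bar>D\<bar> * \<sigma>\<^sup>2) - 2 * C * m\<^sup>2 * \<bar>\<tau>\<bar>
             - m * ((L + \<bar>q\<bar>) * k * \<bar>\<tau>\<bar>) - C * k * (\<bar>\<tau>\<bar> * m)"
      proof -
        have "\<bar>\<tau>\<bar> + k = m" by (simp add: m_def)
        thus ?thesis by (simp add: power2_eq_square mult_ac)
      qed
      also have "\<dots> \<le> m * v s t" using 4 5 6 \<iota>(3) by (simp add: mult.commute)
      finally show ?thesis using m by simp
    qed
    \<comment> \<open>Young's inequality. Here the slope loses \<open>e\<close>; the price is a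
      large curvature, which a jet permits.\<close>
    have "B * k * \<bar>\<tau>\<bar> \<le> e * \<sigma> + B\<^sup>2 / (4 * e) * \<tau>\<^sup>2"
    proof -
      have "0 \<le> (2 * e * k - B * \<bar>\<tau>\<bar>)\<^sup>2" by simp
      also have "\<dots> = 4 * e * (e * \<sigma> - B * k * \<bar>\<tau>\<bar>) + B\<^sup>2 * \<tau>\<^sup>2"
        using k(2) by (simp add: power2_diff power_mult_distrib) (simp add: algebra_simps power2_eq_square)
      finally have "0 \<le> (4 * e * (e * \<sigma> - B * k * \<bar>\<tau>\<bar>) + B\<^sup>2 * \<tau>\<^sup>2) / (4 * e)" using e by simp
      thus ?thesis using e by (simp add: add_divide_distrib)
    qed
    moreover have "\<bar>D\<bar> * \<sigma>\<^sup>2 + 2 * C * \<tau>\<^sup>2 + B\<^sup>2 / (4 * e) * \<tau>\<^sup>2 \<le> K * (\<sigma>\<^sup>2 + \<tau>\<^sup>2)"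
      using C e by (simp add: K_def distrib_left distrib_right)
    ultimately have "v 1 t0 - (q + e) * \<sigma> + a * \<tau> - K * (\<sigma>\<^sup>2 + \<tau>\<^sup>2) \<le> v s t"
      using main by (simp add: algebra_simps)
    moreover have "(s - 1)\<^sup>2 = \<sigma>\<^sup>2" by (simp add: \<sigma>_def power2_eq_square algebra_simps)
    moreover have "(q + e) * (s - 1) = - ((q + e) * \<sigma>)" by (simp add: \<sigma>_def algebra_simps)
    ultimately show "v 1 t0 + (q + e) * (s - 1) + a * (t - t0) - K * ((s - 1)\<^sup>2 + (t - t0)\<^sup>2) \<le> v s t"
      by (simp add: \<tau>_def)
  qed
qed

subsection \<open>Comparison on a single arc\<close>

lemma continuous_on_reflect_snd:
  fixes h :: "real \<Rightarrow> real \<Rightarrow> real"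
  assumes "continuous_on (A \<times> UNIV) (\<lambda>(s, p). h s p)"
  shows "continuous_on (A \<times> UNIV) (\<lambda>(s, p). - h s (- p))"
proof -
  have "continuous_on (A \<times> UNIV) ((\<lambda>(s, p). h s p) \<circ> (\<lambda>z. (fst z, - snd z)))"
    by (rule continuous_on_compose) (auto intro!: continuous_intros continuous_on_subset[OF assms])
  thus ?thesis by (simp add: o_def case_prod_unfold continuous_on_minus)
qed

text \<open>
  At a maximum point of \<open>u - v\<close>, semiconvexity of \<open>u\<close> and semiconcavity of \<open>v\<close> in time pin the time
  derivatives of both functions, and what remains is a stationary comparison on the slice \<open>t = t0\<close>.
  The doubling of the space variable is shifted so that the point of \<open>u\<close> stays away from the end
  point \<open>1\<close>, where only \<open>v\<close> satisfies an equation.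
\<close>

lemma no_touching_on_arc:
  fixes u v h :: "real \<Rightarrow> real \<Rightarrow> real"
  assumes r: "r > 0" and s0: "0 < s0" "s0 \<le> 1" and C: "C \<ge> 0" and L: "L \<ge> 0" and d: "d > 0"
    and hcont: "continuous_on ({0..1} \<times> UNIV) (\<lambda>(s, p). h s p)"
    and ucont: "continuous_on ({0..1} \<times> {t0 - r..t0 + r}) (\<lambda>(s, t). u s t)"
    and vcont: "continuous_on ({0..1} \<times> {t0 - r..t0 + r}) (\<lambda>(s, t). v s t)"
    and usub: "\<And>s t p a. 0 < s \<Longrightarrow> s < 1 \<Longrightarrow> \<bar>t - t0\<bar> < r \<Longrightarrow> superjet2 u s t p a \<Longrightarrow> a + h s p \<le> 0"
    and vsuper: "\<And>s t p a. 0 < s \<Longrightarrow> s < 1 \<Longrightarrow> \<bar>t - t0\<bar> < r \<Longrightarrow>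
      superjet2 (\<lambda>s t. - v s t) s t (- p) (- a) \<Longrightarrow> 0 \<le> a + h s p"
    and vend: "\<And>p a. s0 = 1 \<Longrightarrow> end_subjet v t0 p a \<Longrightarrow> 0 \<le> a + h 1 p"
    and usupp: "\<And>s t. s \<in> {0..1} \<Longrightarrow> \<bar>t - t0\<bar> \<le> r \<Longrightarrow>
      \<exists>b. \<forall>t'. \<bar>t' - t0\<bar> \<le> r \<longrightarrow> u s t + b * (t' - t) - C * (t' - t)\<^sup>2 \<le> u s t'"
    and vsupp: "\<And>s t. s \<in> {0..1} \<Longrightarrow> \<bar>t - t0\<bar> \<le> r \<Longrightarrow>
      \<exists>b. \<forall>t'. \<bar>t' - t0\<bar> \<le> r \<longrightarrow> v s t' \<le> v s t + b * (t' - t) + C * (t' - t)\<^sup>2"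
    and ulip: "\<And>s s' t. s \<in> {0..1} \<Longrightarrow> s' \<in> {0..1} \<Longrightarrow> \<bar>t - t0\<bar> \<le> r \<Longrightarrow> \<bar>u s t - u s' t\<bar> \<le> L * \<bar>s - s'\<bar>"
    and touch: "\<And>s t. s \<in> {0..1} \<Longrightarrow> \<bar>t - t0\<bar> \<le> r \<Longrightarrow>
      u s t - v s t \<le> u s0 t0 - v s0 t0 + d * (t - t0) + C * (t - t0)\<^sup>2"
  shows False
proof -
  have s0I: "s0 \<in> {0..1}" using s0 by simp
  obtain bu where bu: "\<And>t. \<bar>t - t0\<bar> \<le> r \<Longrightarrow> u s0 t0 + bu * (t - t0) - C * (t - t0)\<^sup>2 \<le> u s0 t"
    using usupp[OF s0I, of t0] r by auto
  obtain bv where bv: "\<And>t. \<bar>t - t0\<bar> \<le> r \<Longrightarrow> v s0 t \<le> v s0 t0 + bv * (t - t0) + C * (t - t0)\<^sup>2"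
    using vsupp[OF s0I, of t0] r by auto
  \<comment> \<open>The supports of \<open>u\<close> from below and of \<open>v\<close> from above,
    together with \<open>touch\<close>, squeeze the difference at \<open>s0\<close>. The surplus
    \<open>d\<close> is what the final contradiction lives on.\<close>
  have bubv: "bu = bv + d"
  proof (rule slope_unique[OF r])
    fix x :: real assume "\<bar>x\<bar> < r"
    thus "bu * x \<le> (bv + d) * x + (3 * C) * x\<^sup>2"
      using bu[of "t0 + x"] bv[of "t0 + x"] touch[OF s0I, of "t0 + x"] by (simp add: algebra_simps)
  qed
  \<comment> \<open>Three losses are paid out of \<open>d\<close>: one for the time slopes of
    \<open>u\<close>, one for those of \<open>v\<close>, and one for the modulus of continuity of
    \<open>h\<close>.\<close>
  define \<theta> where "\<theta> = d / 3"
  have \<theta>: "\<theta> > 0" using d by (simp add: \<theta>_def)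
  \<comment> \<open>The same squeeze provides the parabola on the other side of each function, as
    needed for the semicontinuity of its time slopes.\<close>
  have uup: "u s0 t \<le> u s0 t0 + bu * (t - t0) + (2 * C) * (t - t0)\<^sup>2" if "\<bar>t - t0\<bar> \<le> r" for t
    using bv[OF that] touch[OF s0I that] by (simp add: bubv algebra_simps)
  have vlow: "- v s0 t \<le> - v s0 t0 + (- bv) * (t - t0) + (2 * C) * (t - t0)\<^sup>2" if "\<bar>t - t0\<bar> \<le> r" for t
    using bu[OF that] touch[OF s0I that] by (simp add: bubv algebra_simps)
  obtain r1 where r1: "r1 > 0" "r1 \<le> r" "\<And>s t a. s \<in> {0..1} \<Longrightarrow> \<bar>s - s0\<bar> < r1 \<Longrightarrow> \<bar>t - t0\<bar> < r1 \<Longrightarrow>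
      superjet1 (u s) t a \<Longrightarrow> bu - \<theta> \<le> a"
    by (rule superjet1_slope_ge[OF ucont r s0I \<theta> usupp uup]) blast+
  have mvcont: "continuous_on ({0..1} \<times> {t0 - r..t0 + r}) (\<lambda>(s, t). - v s t)"
    using continuous_on_minus[OF vcont] by (simp add: case_prod_unfold)
  have mvsupp: "\<exists>b. \<forall>t'. \<bar>t' - t0\<bar> \<le> r \<longrightarrow> - v s t + b * (t' - t) - C * (t' - t)\<^sup>2 \<le> - v s t'"
    if st: "s \<in> {0..1}" "\<bar>t - t0\<bar> \<le> r" for s t
  proof -
    obtain b where b: "\<And>t'. \<bar>t' - t0\<bar> \<le> r \<Longrightarrow> v s t' \<le> v s t + b * (t' - t) + C * (t' - t)\<^sup>2"
      using vsupp[OF st] by blast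
    show ?thesis
      by (rule exI[of _ "- b"]) (use b in \<open>simp add: algebra_simps\<close>)
  qed
  obtain r2 where r2: "r2 > 0" "r2 \<le> r" "\<And>s t a. s \<in> {0..1} \<Longrightarrow> \<bar>s - s0\<bar> < r2 \<Longrightarrow> \<bar>t - t0\<bar> < r2 \<Longrightarrow>
      superjet1 (\<lambda>t. - v s t) t a \<Longrightarrow> - bv - \<theta> \<le> a"
    by (rule superjet1_slope_ge[OF mvcont r s0I \<theta> mvsupp vlow]) blast+
  define r3 where "r3 = min r1 r2"
  have r3: "r3 > 0" "r3 \<le> r" using r1 r2 by (auto simp: r3_def)
  have uslice: "bu - \<theta> + h s q \<le> 0"
    if s: "0 < s" "s < 1" "\<bar>s - s0\<bar> < r3" and jet: "superjet1 (\<lambda>s. u s t0) s q" for s q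
  proof (rule superjet1_slice_subsolution[where w = u and ?t0.0 = t0, OF _ hcont _ s(1,2) _ _ jet])
    show pos: "r3 - \<bar>s - s0\<bar> > 0" using s by simp
    show "continuous_on ({0..1} \<times> {t0 - (r3 - \<bar>s - s0\<bar>)..t0 + (r3 - \<bar>s - s0\<bar>)}) (\<lambda>(s, t). u s t)"
      by (rule continuous_on_subset[OF ucont]) (use r3 in auto)
  next
    fix s' t p a assume A: "\<bar>s' - s\<bar> < r3 - \<bar>s - s0\<bar>" "\<bar>t - t0\<bar> < r3 - \<bar>s - s0\<bar>" "0 < s'" "s' < 1"
      "superjet2 u s' t p a"
    have "\<bar>t - t0\<bar> < r" using A r3 by linarith
    thus "a + h s' p \<le> 0" by (intro usub) (use A in auto)
  next
    fix s' t a assume A: "\<bar>s' - s\<bar> < r3 - \<bar>s - s0\<bar>" "\<bar>t - t0\<bar> < r3 - \<bar>s - s0\<bar>" "0 < s'" "s' < 1"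
      "superjet1 (u s') t a"
    have "\<bar>s' - s0\<bar> < r1" "\<bar>t - t0\<bar> < r1" using A unfolding r3_def by linarith+
    thus "bu - \<theta> \<le> a" by (intro r1(3)[of s' t]) (use A in auto)
  qed
  note hcont' = continuous_on_reflect_snd[OF hcont]
  have vslice: "0 \<le> bv + \<theta> + h s q"
    if s: "0 < s" "s < 1" "\<bar>s - s0\<bar> < r3" and jet: "superjet1 (\<lambda>s. - v s t0) s (- q)" for s q
  proof -
    have "(- bv - \<theta>) + - h s (- (- q)) \<le> 0"
    proof (rule superjet1_slice_subsolution[where w = "\<lambda>s t. - v s t" and ?t0.0 = t0, OF _ hcont' _ s(1,2) _ _ jet])
      show pos: "r3 - \<bar>s - s0\<bar> > 0" using s by simp
      show "continuous_on ({0..1} \<times> {t0 - (r3 - \<bar>s - s0\<bar>)..t0 + (r3 - \<bar>s - s0\<bar>)}) (\<lambda>(s, t). - v s t)"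
        by (rule continuous_on_subset[OF mvcont]) (use r3 in auto)
    next
      fix s' t p a assume A: "\<bar>s' - s\<bar> < r3 - \<bar>s - s0\<bar>" "\<bar>t - t0\<bar> < r3 - \<bar>s - s0\<bar>" "0 < s'" "s' < 1"
        "superjet2 (\<lambda>s t. - v s t) s' t p a"
      have "\<bar>t - t0\<bar> < r" using A r3 by linarith
      hence "0 \<le> - a + h s' (- p)" by (intro vsuper) (use A in auto)
      thus "a + - h s' (- p) \<le> 0" by simp
    next
      fix s' t a assume A: "\<bar>s' - s\<bar> < r3 - \<bar>s - s0\<bar>" "\<bar>t - t0\<bar> < r3 - \<bar>s - s0\<bar>" "0 < s'" "s' < 1"
        "superjet1 (\<lambda>t. - v s' t) t a"
      have "\<bar>s' - s0\<bar> < r2" "\<bar>t - t0\<bar> < r2" using A unfolding r3_def by linarith+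
      thus "- bv - \<theta> \<le> a" by (intro r2(3)[of s' t]) (use A in auto)
    qed
    thus ?thesis by simp
  qed
  define f where "f = (\<lambda>s. u s t0)"
  define g where "g = (\<lambda>s. v s t0)"
  have fg: "f s - g s \<le> f s0 - g s0" if "s \<in> {0..1}" for s
    using touch[OF that, of t0] r by (simp add: f_def g_def)
  have flip: "\<bar>f s - f s'\<bar> \<le> L * \<bar>s - s'\<bar>" if "s \<in> {0..1}" "s' \<in> {0..1}" for s s'
    using ulip[OF that, of t0] r by (simp add: f_def)
  define L' where "L' = L + 2"
  have L': "L' \<ge> 2" "L + 1 \<le> L'" "L \<le> L'" using L by (auto simp: L'_def)
  define Q where "Q = 8 * L' + 4"
  have "uniformly_continuous_on ({0..1} \<times> {-Q..Q}) (\<lambda>(s, p). h s p)"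
    by (intro compact_uniformly_continuous continuous_on_subset[OF hcont] compact_Times) auto
  then obtain \<omega> where \<omega>: "\<omega> > 0" "\<And>z z'. z \<in> {0..1} \<times> {-Q..Q} \<Longrightarrow> z' \<in> {0..1} \<times> {-Q..Q} \<Longrightarrow> dist z' z < \<omega> \<Longrightarrow>
      dist ((\<lambda>(s, p). h s p) z') ((\<lambda>(s, p). h s p) z) < \<theta>"
    using \<theta> unfolding uniformly_continuous_on_def by metis
  have huc: "\<bar>h s' p' - h s p\<bar> < \<theta>"
    if "s \<in> {0..1}" "s' \<in> {0..1}" "\<bar>p\<bar> \<le> Q" "\<bar>p'\<bar> \<le> Q" "\<bar>s' - s\<bar> < \<omega> / 2" "\<bar>p' - p\<bar> < \<omega> / 2" for s s' p p'
  proof -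
    have "dist (s', p') (s, p) \<le> \<bar>s' - s\<bar> + \<bar>p' - p\<bar>" by (rule dist_Pair_le)
    hence "dist (s', p') (s, p) < \<omega>" using that by linarith
    thus ?thesis using \<omega>(2)[of "(s, p)" "(s', p')"] that by (auto simp: dist_real_def abs_le_iff)
  qed
  \<comment> \<open>The entry \<open>1 - s0\<close> keeps \<open>s2\<close> below 1 unless
    \<open>s0 = 1\<close>, so the end condition on \<open>v\<close> is invoked only when it is
    available.\<close>
  define \<rho> where "\<rho> = min (min r3 (s0 / 2)) (min (if s0 = 1 then 1 else 1 - s0) (min 1 (\<omega> / 8)))"
  have \<rho>: "\<rho> > 0" "\<rho> \<le> r3" "\<rho> < s0" "\<rho> \<le> 1" "\<rho> \<le> \<omega> / 8" "s0 \<noteq> 1 \<Longrightarrow> s0 + \<rho> \<le> 1"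
    using r3 s0 \<omega> by (auto simp: \<rho>_def min_less_iff_disj)
  define \<delta> where "\<delta> = min (\<rho> / 4) (\<rho>\<^sup>2 / (16 * L'))"
  have \<delta>: "\<delta> > 0" "\<delta> \<le> \<rho> / 4" "16 * L' * \<delta> \<le> \<rho>\<^sup>2"
  proof -
    have "\<delta> \<le> \<rho>\<^sup>2 / (16 * L')" by (simp add: \<delta>_def)
    thus "16 * L' * \<delta> \<le> \<rho>\<^sup>2" using L' by (simp add: pos_le_divide_eq mult.commute)
  qed (use \<rho> L' in \<open>auto simp: \<delta>_def\<close>)
  \<comment> \<open>Strong enough to force \<open>abs x < \<delta>\<close>, so that the shift keeps
    its sign and \<open>s1 < s2\<close>; weak enough that the slope
    \<open>2 * \<kappa> * abs x\<close> stays within \<open>8 * L'\<close>, a bound independent of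
    \<delta>.\<close>
  define \<kappa> where "\<kappa> = 4 * L' / \<delta>"
  have \<kappa>: "\<kappa> > 0" "\<kappa> * \<delta> = 4 * L'" using \<delta> L' by (auto simp: \<kappa>_def)
  \<comment> \<open>The contact on the slice need not be strict; the square around \<open>s0\<close>
    localises the maximum, and its contribution to the slope is small with \<rho>.\<close>
  define P where "P = (\<lambda>(s, s'). f s - (s - s0)\<^sup>2 - g s' - \<kappa> * (s' - s - \<delta>)\<^sup>2)"
  have fcont: "continuous_on {0..1} f" and gcont: "continuous_on {0..1} g"
  proof -
    have "continuous_on {0..1} ((\<lambda>(s, t). u s t) \<circ> (\<lambda>s. (s, t0)))"
      by (rule continuous_on_compose) (use r in \<open>auto intro!: continuous_intros continuous_on_subset[OF ucont]\<close>)
    thus "continuous_on {0..1} f" by (simp add: f_def o_def)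
    have "continuous_on {0..1} ((\<lambda>(s, t). v s t) \<circ> (\<lambda>s. (s, t0)))"
      by (rule continuous_on_compose) (use r in \<open>auto intro!: continuous_intros continuous_on_subset[OF vcont]\<close>)
    thus "continuous_on {0..1} g" by (simp add: g_def o_def)
  qed
  have "continuous_on ({0..1} \<times> {0..1}) P"
    unfolding P_def case_prod_beta
    by (intro continuous_intros continuous_on_compose2[OF fcont] continuous_on_compose2[OF gcont]) auto
  moreover have "compact ({0..1::real} \<times> {0..1::real})" by (intro compact_Times) auto
  ultimately obtain z where z: "z \<in> {0..1} \<times> {0..1}" "\<And>z'. z' \<in> {0..1} \<times> {0..1} \<Longrightarrow> P z' \<le> P z"
    using continuous_attains_sup[of "{0..1::real} \<times> {0..1::real}" P] by fastforce
  obtain s1 s2 where z_eq: "z = (s1, s2)" by fastforce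
  have s12: "s1 \<in> {0..1}" "s2 \<in> {0..1}" using z by (auto simp: z_eq)
  have max: "P (s, s') \<le> P (s1, s2)" if "s \<in> {0..1}" "s' \<in> {0..1}" for s s'
    using z(2)[of "(s, s')"] that by (simp add: z_eq)
  define x where "x = s2 - s1 - \<delta>"
  \<comment> \<open>The competitor \<open>(s0 - \<delta>, s0)\<close> has no doubling penalty.
    Shifting the argument of \<open>u\<close> costs only its Lipschitz constant, and
    \<open>v\<close> is handled by comparing \<open>f - g\<close> at \<open>s2\<close> and at
    \<open>s0\<close>, so no regularity of \<open>v\<close> in space is used.\<close>
  have key: "(s1 - s0)\<^sup>2 + \<kappa> * x\<^sup>2 \<le> L' * \<bar>x\<bar> + 2 * L' * \<delta>"
  proof -
    have "s0 - \<delta> \<in> {0..1}" using \<delta> \<rho> s0 by auto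
    hence "f (s0 - \<delta>) - \<delta>\<^sup>2 - g s0 \<le> f s1 - (s1 - s0)\<^sup>2 - g s2 - \<kappa> * x\<^sup>2"
      using max[of "s0 - \<delta>" s0] s0I by (simp add: P_def x_def)
    moreover have "f s0 - L * \<delta> \<le> f (s0 - \<delta>)"
      using flip[OF s0I \<open>s0 - \<delta> \<in> {0..1}\<close>] \<delta> by (simp add: abs_if split: if_splits)
    moreover have "\<delta>\<^sup>2 \<le> \<delta>" using \<delta> \<rho> by (simp add: power2_eq_square mult_left_le)
    moreover have "f s1 \<le> f s2 + L * \<bar>s1 - s2\<bar>" using flip[OF s12] by linarith
    moreover have "f s2 - g s2 \<le> f s0 - g s0" by (rule fg[OF s12(2)])
    ultimately have "(s1 - s0)\<^sup>2 + \<kappa> * x\<^sup>2 \<le> L * \<bar>s1 - s2\<bar> + L * \<delta> + \<delta>" by linarith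
    also have "L * \<bar>s1 - s2\<bar> \<le> L * (\<bar>x\<bar> + \<delta>)"
      using L \<delta> by (intro mult_left_mono) (auto simp: x_def)
    also have "L * (\<bar>x\<bar> + \<delta>) + L * \<delta> + \<delta> \<le> L' * \<bar>x\<bar> + 2 * L' * \<delta>"
      using \<delta> by (simp add: L'_def algebra_simps)
    finally show ?thesis by simp
  qed
  have x: "\<bar>x\<bar> < \<delta>"
  proof (rule ccontr)
    assume "\<not> ?thesis"
    hence ge: "\<delta> \<le> \<bar>x\<bar>" by simp
    have "4 * L' * \<bar>x\<bar> = \<kappa> * (\<delta> * \<bar>x\<bar>)" using \<kappa>(2) by simp
    also have "\<dots> \<le> \<kappa> * (\<bar>x\<bar> * \<bar>x\<bar>)" using ge \<kappa> by (intro mult_left_mono mult_right_mono) auto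
    also have "\<dots> = \<kappa> * x\<^sup>2" by (simp add: power2_eq_square)
    also have "\<dots> \<le> L' * \<bar>x\<bar> + 2 * L' * \<delta>" using key zero_le_power2[of "s1 - s0"] by linarith
    also have "\<dots> \<le> L' * \<bar>x\<bar> + 2 * L' * \<bar>x\<bar>" using ge L' by simp
    finally have "L' * \<bar>x\<bar> \<le> 0" by simp
    moreover have "L' * \<bar>x\<bar> > 0" using L' ge \<delta> by (intro mult_pos_pos) auto
    ultimately show False by simp
  qed
  have near: "\<bar>s1 - s0\<bar> < \<rho> / 2"
  proof (rule power2_less_imp_less)
    have "L' * \<bar>x\<bar> \<le> L' * \<delta>" using x L' by simp
    moreover have "\<kappa> * x\<^sup>2 \<ge> 0" using \<kappa> by simp
    ultimately have "(s1 - s0)\<^sup>2 \<le> 3 * (L' * \<delta>)" using key by linarith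
    also have "3 * (L' * \<delta>) < \<rho>\<^sup>2 / 4"
    proof -
      have "\<rho>\<^sup>2 > 0" using \<rho> by simp
      thus ?thesis using \<delta>(3) by linarith
    qed
    also have "\<rho>\<^sup>2 / 4 = (\<rho> / 2)\<^sup>2" by (simp add: power_divide)
    finally show "\<bar>s1 - s0\<bar>\<^sup>2 < (\<rho> / 2)\<^sup>2" by simp
  qed (use \<rho> in simp)
  have s21: "0 < s2 - s1" "s2 - s1 < 2 * \<delta>" using x by (auto simp: x_def)
  have near2: "\<bar>s2 - s0\<bar> < \<rho>" using s21 near \<delta> \<rho> by linarith
  have s1: "0 < s1" "s1 < 1" using near \<rho>(1,3) s21 s12 unfolding atLeastAtMost_iff by linarith+
  define q where "q = - 2 * \<kappa> * x"
  have q: "\<bar>q\<bar> \<le> 8 * L'"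
  proof -
    have "\<bar>q\<bar> = 2 * (\<kappa> * \<bar>x\<bar>)" using \<kappa> by (simp add: q_def abs_mult)
    also have "\<kappa> * \<bar>x\<bar> \<le> \<kappa> * \<delta>" using x \<kappa> by (intro mult_left_mono) auto
    finally show ?thesis using \<kappa> by simp
  qed
  have "superjet1 f s1 (q + 2 * (s1 - s0))"
    unfolding superjet1_def
  proof (intro exI conjI allI impI)
    show "min s1 (1 - s1) > 0" using s1 by simp
    fix s assume s: "\<bar>s - s1\<bar> < min s1 (1 - s1)"
    have "P (s, s2) \<le> P (s1, s2)" by (rule max) (use s s12 in auto)
    hence "f s \<le> f s1 + (s - s0)\<^sup>2 - (s1 - s0)\<^sup>2 + \<kappa> * ((s2 - s - \<delta>)\<^sup>2 - x\<^sup>2)"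
      by (simp add: P_def x_def algebra_simps)
    also have "\<dots> = f s1 + (q + 2 * (s1 - s0)) * (s - s1) + (1 + \<kappa>) * (s - s1)\<^sup>2"
      by (simp add: q_def x_def power2_eq_square algebra_simps)
    finally show "f s \<le> f s1 + (q + 2 * (s1 - s0)) * (s - s1) + (1 + \<kappa>) * (s - s1)\<^sup>2" .
  qed
  hence le: "bu - \<theta> + h s1 (q + 2 * (s1 - s0)) \<le> 0"
    unfolding f_def by (intro uslice) (use s1 near \<rho> in auto)
  have gsub: "g s2 + q * (s - s2) - \<kappa> * (s - s2)\<^sup>2 \<le> g s" if "s \<in> {0..1}" for s
  proof -
    have "P (s1, s) \<le> P (s1, s2)" by (rule max) (use that s12 in auto)
    hence "g s2 + \<kappa> * (x\<^sup>2 - (s - s1 - \<delta>)\<^sup>2) \<le> g s"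
      by (simp add: P_def x_def algebra_simps)
    moreover have "\<kappa> * (x\<^sup>2 - (s - s1 - \<delta>)\<^sup>2) = q * (s - s2) - \<kappa> * (s - s2)\<^sup>2"
      by (simp add: q_def x_def power2_eq_square algebra_simps)
    ultimately show ?thesis by simp
  qed
  define e where "e = min 1 (\<omega> / 8)"
  have e: "e > 0" "e \<le> 1" "e \<le> \<omega> / 8" using \<omega> by (auto simp: e_def)
  have cmp: "\<bar>h s1 (q + 2 * (s1 - s0)) - h s2 p\<bar> < \<theta>" if "q \<le> p" "p \<le> q + e" for p
  proof (rule huc)
    show "\<bar>p\<bar> \<le> Q" using q e that L' unfolding Q_def by linarith
    show "\<bar>q + 2 * (s1 - s0)\<bar> \<le> Q" 
    proof -
      have "q \<le> 8 * L'" "- q \<le> 8 * L'" "s1 - s0 < \<rho> / 2" "- (s1 - s0) < \<rho> / 2"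
        using q near by linarith+
      thus ?thesis using \<rho>(4) unfolding Q_def by (intro abs_leI) (simp_all add: algebra_simps)
    qed
    show "\<bar>s1 - s2\<bar> < \<omega> / 2" using s21 \<delta>(2) \<rho>(5) \<omega>(1) by linarith
    show "\<bar>q + 2 * (s1 - s0) - p\<bar> < \<omega> / 2"
    proof -
      have "s1 - s0 < \<omega> / 16" "- (s1 - s0) < \<omega> / 16" using near \<rho>(5) by linarith+
      hence "q + 2 * (s1 - s0) - p < \<omega> / 2" "- (q + 2 * (s1 - s0) - p) < \<omega> / 2"
        using e(3) that \<omega>(1) by (simp_all add: algebra_simps)
      thus ?thesis unfolding abs_less_iff by blast
    qed
  qed (use s12 in auto)
  have "\<exists>p. q \<le> p \<and> p \<le> q + e \<and> 0 \<le> bv + \<theta> + h s2 p"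
  proof (cases "s2 = 1")
    case False
    have "superjet1 (\<lambda>s. - v s t0) s2 (- q)"
      unfolding superjet1_def
    proof (intro exI conjI allI impI)
      show "min s2 (1 - s2) > 0" using s1 s21 False s12 by auto
      fix s assume "\<bar>s - s2\<bar> < min s2 (1 - s2)"
      hence "s \<in> {0..1}" by auto
      from gsub[OF this] show "- v s t0 \<le> - v s2 t0 + - q * (s - s2) + \<kappa> * (s - s2)\<^sup>2"
        by (simp add: g_def)
    qed
    hence "0 \<le> bv + \<theta> + h s2 q"
      by (intro vslice) (use s1 s21 s12 False near2 \<rho> in auto)
    thus ?thesis using e by (intro exI[of _ q]) auto
  next
    case True
    have "s0 = 1" using \<rho>(6) near2 True s0 by (cases "s0 = 1") auto
    \<comment> \<open>The bound from below with slope \<open>L\<close> in space is inherited from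
      \<open>u\<close> through \<open>touch\<close>: as \<open>s0 = 1\<close>, the function
      \<open>v\<close> lies above \<open>u\<close> minus a function of time.\<close>
    have "end_subjet v t0 (q + e) bv"
    proof (rule end_subjet_of_slice[OF r C L e(1) vsupp])
      fix s t :: real assume st: "s \<in> {0..1}" "\<bar>t - t0\<bar> \<le> r"
      have "u s t - v s t \<le> u 1 t0 - v 1 t0 + d * (t - t0) + C * (t - t0)\<^sup>2"
        using touch[OF st] \<open>s0 = 1\<close> by simp
      moreover have "u 1 t - L * (1 - s) \<le> u s t" using ulip[of s 1 t] st by (auto simp: abs_if split: if_splits)
      moreover have "u 1 t0 + bu * (t - t0) - C * (t - t0)\<^sup>2 \<le> u 1 t" using bu[OF st(2)] \<open>s0 = 1\<close> by simp
      ultimately show "v 1 t0 + bv * (t - t0) - 2 * C * (t - t0)\<^sup>2 - L * (1 - s) \<le> v s t"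
        by (simp add: bubv algebra_simps)
    next
      fix s :: real assume "s \<in> {0..1}"
      from gsub[OF this] show "v 1 t0 + q * (s - 1) - \<kappa> * (s - 1)\<^sup>2 \<le> v s t0"
        by (simp add: g_def True)
    qed
    hence "0 \<le> bv + h 1 (q + e)" by (rule vend[OF \<open>s0 = 1\<close>])
    thus ?thesis using e \<theta> True by (intro exI[of _ "q + e"]) auto
  qed
  then obtain p where p: "q \<le> p" "p \<le> q + e" "0 \<le> bv + \<theta> + h s2 p" by blast
  show False using cmp[OF p(1,2)] p(3) le bubv unfolding \<theta>_def by linarith
qed

subsection \<open>Test functions\<close>

lemma C1_nearI_gradient:
  fixes \<phi> :: "'e::real_inner \<Rightarrow> real"
  assumes "open U" "z \<in> U" "continuous_on U G"
    and "\<And>w. w \<in> U \<Longrightarrow> (\<phi> has_derivative (\<lambda>h. G w \<bullet> h)) (at w)"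
  shows "C1_near \<phi> z"
  unfolding C1_near_def
proof (intro exI conjI ballI)
  show "open U" "z \<in> U" by fact+
  show "continuous_on U (\<lambda>w. blinfun_inner_right (G w))"
    by (rule bounded_linear.continuous_on[OF bounded_linear_blinfun_inner_right assms(3)])
  show "(\<phi> has_derivative blinfun_apply (blinfun_inner_right (G w))) (at w)" if "w \<in> U" for w
    using assms(4)[OF that] by (simp add: blinfun_inner_right.rep_eq)
qed

lemma C1_near_add:
  assumes "C1_near \<phi> z" "C1_near \<psi> z"
  shows "C1_near (\<lambda>w. \<phi> w + \<psi> w) z"
proof -
  obtain U D where U: "open U" "z \<in> U" "continuous_on U D"
    "\<And>w. w \<in> U \<Longrightarrow> (\<phi> has_derivative blinfun_apply (D w)) (at w)"
    using assms(1) unfolding C1_near_def by blast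
  obtain U' D' where U': "open U'" "z \<in> U'" "continuous_on U' D'"
    "\<And>w. w \<in> U' \<Longrightarrow> (\<psi> has_derivative blinfun_apply (D' w)) (at w)"
    using assms(2) unfolding C1_near_def by blast
  show ?thesis unfolding C1_near_def
  proof (intro exI conjI ballI)
    show "open (U \<inter> U')" "z \<in> U \<inter> U'" using U U' by auto
    show "continuous_on (U \<inter> U') (\<lambda>w. D w + D' w)"
      by (intro continuous_intros continuous_on_subset[OF U(3)] continuous_on_subset[OF U'(3)]) auto
    show "((\<lambda>w. \<phi> w + \<psi> w) has_derivative blinfun_apply (D w + D' w)) (at w)" if "w \<in> U \<inter> U'" for w
      using has_derivative_add[OF U(4) U'(4)] that by (simp add: plus_blinfun.rep_eq)
  qed
qed

lemma C1_near_minus: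
  assumes "C1_near \<phi> z"
  shows "C1_near (\<lambda>w. - \<phi> w) z"
proof -
  obtain U D where U: "open U" "z \<in> U" "continuous_on U D"
    "\<And>w. w \<in> U \<Longrightarrow> (\<phi> has_derivative blinfun_apply (D w)) (at w)"
    using assms(1) unfolding C1_near_def by blast
  show ?thesis unfolding C1_near_def
  proof (intro exI conjI ballI)
    show "continuous_on U (\<lambda>w. - D w)" by (intro continuous_intros U)
    show "((\<lambda>w. - \<phi> w) has_derivative blinfun_apply (- D w)) (at w)" if "w \<in> U" for w
      using has_derivative_minus[OF U(4)[OF that]] by (simp add: uminus_blinfun.rep_eq)
  qed fact+
qed

lemma has_derivative_imp_DERIV:
  fixes f :: "real \<Rightarrow> real"
  assumes "(f has_derivative f') (at x)"
  shows "(f has_real_derivative f' 1) (at x)"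
proof (rule has_derivative_imp_has_field_derivative[OF assms])
  fix h
  show "h * f' 1 = f' h" using linear_scale[OF has_derivative_linear[OF assms], of h 1] by simp
qed

lemma space_deriv_eq:
  assumes "(\<phi> has_derivative f') (at (s, t))"
  shows "space_deriv \<phi> s t = f' (1, 0)"
proof -
  have "((\<lambda>\<sigma>. (\<sigma>, t)) has_derivative (\<lambda>h. (h, 0))) (at s)"
    by (auto intro!: derivative_eq_intros)
  from has_derivative_imp_DERIV[OF diff_chain_at[OF this assms]]
  have "((\<phi> \<circ> (\<lambda>\<sigma>. (\<sigma>, t))) has_real_derivative f' (1, 0)) (at s)" by simp
  thus ?thesis unfolding space_deriv_def o_def by (rule DERIV_imp_deriv)
qed

lemma time_deriv_eq:
  assumes "(\<phi> has_derivative f') (at (s, t))"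
  shows "time_deriv \<phi> s t = f' (0, 1)"
proof -
  have "((\<lambda>\<tau>. (s, \<tau>)) has_derivative (\<lambda>h. (0, h))) (at t)"
    by (auto intro!: derivative_eq_intros)
  from has_derivative_imp_DERIV[OF diff_chain_at[OF this assms]]
  have "((\<phi> \<circ> (\<lambda>\<tau>. (s, \<tau>))) has_real_derivative f' (0, 1)) (at t)" by simp
  thus ?thesis unfolding time_deriv_def o_def by (rule DERIV_imp_deriv)
qed

definition parabola :: "real \<Rightarrow> real \<Rightarrow> real \<Rightarrow> real \<Rightarrow> real \<Rightarrow> real \<times> real \<Rightarrow> real" where
  "parabola s t p a K z =
     p * (fst z - s) + a * (snd z - t) + K * ((fst z - s)\<^sup>2 + (snd z - t)\<^sup>2)"

lemma parabola_has_derivative: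
  "(parabola s t p a K has_derivative
     (\<lambda>h. (p + 2 * K * (fst z - s), a + 2 * K * (snd z - t)) \<bullet> h)) (at z)"
  unfolding parabola_def[abs_def]
  by (auto intro!: derivative_eq_intros simp: inner_prod_def algebra_simps)

lemma C1_near_parabola: "C1_near (parabola s t p a K) z"
  by (rule C1_nearI_gradient[OF open_UNIV UNIV_I _ parabola_has_derivative])
     (auto intro!: continuous_intros)

lemma parabola_derivs:
  "space_deriv (parabola s t p a K) s t = p" "time_deriv (parabola s t p a K) s t = a"
  using space_deriv_eq[OF parabola_has_derivative] time_deriv_eq[OF parabola_has_derivative]
  by auto

lemma C1_near_quadratic: "C1_near (\<lambda>x::real. a * (x - t) + K * (x - t)\<^sup>2) z"
  by (rule C1_nearI_gradient[where U = UNIV and G = "\<lambda>x. a + 2 * K * (x - t)"])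
     (auto intro!: continuous_intros derivative_eq_intros simp: algebra_simps)

lemma deriv_quadratic: "deriv (\<lambda>x::real. a * (x - t) + K * (x - t)\<^sup>2) t = a"
  by (rule DERIV_imp_deriv) (auto intro!: derivative_eq_intros)

lemma eventually_at_box:
  fixes s t \<delta> :: real
  assumes "\<delta> > 0"
  shows "\<forall>\<^sub>F z in at (s, t) within A. \<bar>fst z - s\<bar> < \<delta> \<and> \<bar>snd z - t\<bar> < \<delta>"
  unfolding eventually_at
proof (intro exI conjI ballI impI)
  fix z assume "z \<noteq> (s, t) \<and> dist z (s, t) < \<delta>"
  thus "\<bar>fst z - s\<bar> < \<delta>" "\<bar>snd z - t\<bar> < \<delta>"
    using dist_fst_le[of z "(s, t)"] dist_snd_le[of z "(s, t)"] by (auto simp: dist_real_def)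
qed (use assms in auto)

lemma arc_subsolution_superjet2:
  assumes "arc_subsolution h T0 T1 w" "0 < s" "s < 1" "t \<in> einterval T0 T1"
    and jet: "superjet2 (\<lambda>s t. w (s, t)) s t p a"
  shows "a + h s p \<le> 0"
proof -
  obtain K r where r: "r > 0" and K: "\<And>s' t'. \<bar>s' - s\<bar> < r \<Longrightarrow> \<bar>t' - t\<bar> < r \<Longrightarrow>
     w (s', t') \<le> w (s, t) + p * (s' - s) + a * (t' - t) + K * ((s' - s)\<^sup>2 + (t' - t)\<^sup>2)"
    using jet unfolding superjet2_def by blast
  have "supertangent w (s, t) (parabola s t p a K)"
    unfolding constrained_supertangent_def
    using eventually_at_box[OF r, of s t UNIV]
  proof (intro conjI C1_near_parabola, elim eventually_mono)
    fix z assume "\<bar>fst z - s\<bar> < r \<and> \<bar>snd z - t\<bar> < r"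
    thus "w z - parabola s t p a K z \<le> w (s, t) - parabola s t p a K (s, t)"
      using K[of "fst z" "snd z"] by (simp add: parabola_def)
  qed
  hence "time_deriv (parabola s t p a K) s t + h s (space_deriv (parabola s t p a K) s t) \<le> 0"
    using assms unfolding arc_subsolution_def by auto
  thus ?thesis by (simp add: parabola_derivs)
qed

lemma arc_supersolution_superjet2:
  assumes "arc_supersolution h T0 T1 w" "0 < s" "s < 1" "t \<in> einterval T0 T1"
    and jet: "superjet2 (\<lambda>s t. - w (s, t)) s t (- p) (- a)"
  shows "0 \<le> a + h s p"
proof -
  obtain K r where r: "r > 0" and K: "\<And>s' t'. \<bar>s' - s\<bar> < r \<Longrightarrow> \<bar>t' - t\<bar> < r \<Longrightarrow>
     - w (s', t') \<le> - w (s, t) + - p * (s' - s) + - a * (t' - t) + K * ((s' - s)\<^sup>2 + (t' - t)\<^sup>2)"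
    using jet unfolding superjet2_def by blast
  have "subtangent w (s, t) (parabola s t p a (- K))"
    unfolding constrained_subtangent_def
    using eventually_at_box[OF r, of s t UNIV]
  proof (intro conjI C1_near_parabola, elim eventually_mono)
    fix z assume "\<bar>fst z - s\<bar> < r \<and> \<bar>snd z - t\<bar> < r"
    thus "w (s, t) - parabola s t p a (- K) (s, t) \<le> w z - parabola s t p a (- K) z"
      using K[of "fst z" "snd z"] by (simp add: parabola_def)
  qed
  hence "0 \<le> time_deriv (parabola s t p a (- K)) s t + h s (space_deriv (parabola s t p a (- K)) s t)"
    using assms unfolding arc_supersolution_def by auto
  thus ?thesis by (simp add: parabola_derivs)
qed

lemma constrained_subtangent_end_subjet:
  assumes jet: "end_subjet (\<lambda>s t. w (s, t)) t p a"
  obtains K where "constrained_subtangent ({0..1} \<times> I) w (1, t) (parabola 1 t p a K)"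
proof -
  obtain K r where r: "r > 0" and K: "\<And>s' t'. 1 - r < s' \<Longrightarrow> s' \<le> 1 \<Longrightarrow> \<bar>t' - t\<bar> < r \<Longrightarrow>
     w (1, t) + p * (s' - 1) + a * (t' - t) - K * ((s' - 1)\<^sup>2 + (t' - t)\<^sup>2) \<le> w (s', t')"
    using jet unfolding end_subjet_def by blast
  have "\<forall>\<^sub>F z in at (1, t) within {0..1} \<times> I. z \<in> {0..1} \<times> I"
    by (simp add: eventually_at_filter)
  hence "constrained_subtangent ({0..1} \<times> I) w (1, t) (parabola 1 t p a (- K))"
    unfolding constrained_subtangent_def
    using eventually_at_box[OF r, of 1 t "{0..1} \<times> I"]
  proof (intro conjI C1_near_parabola, elim eventually_elim2)
    fix z :: "real \<times> real" assume "z \<in> {0..1} \<times> I" "\<bar>fst z - 1\<bar> < r \<and> \<bar>snd z - t\<bar> < r"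
    thus "w (1, t) - parabola 1 t p a (- K) (1, t) \<le> w z - parabola 1 t p a (- K) z"
      using K[of "fst z" "snd z"] by (auto simp: parabola_def mem_Times_iff)
  qed
  thus ?thesis by (rule that)
qed

lemma supertangent_superjet1:
  assumes "superjet1 f t a"
  obtains \<psi> where "supertangent f t \<psi>" "deriv \<psi> t = a"
proof -
  obtain K r where r: "r > 0" and K: "\<And>s'. \<bar>s' - t\<bar> < r \<Longrightarrow>
     f s' \<le> f t + a * (s' - t) + K * (s' - t)\<^sup>2"
    using assms unfolding superjet1_def by blast
  have "\<forall>\<^sub>F x in at t. \<bar>x - t\<bar> < r"
    unfolding eventually_at using r by (intro exI[of _ r]) (auto simp: dist_real_def)
  hence "supertangent f t (\<lambda>x. a * (x - t) + K * (x - t)\<^sup>2)"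
    unfolding constrained_supertangent_def
    by (intro conjI C1_near_quadratic, elim eventually_mono) (use K in force)
  thus ?thesis by (rule that[OF _ deriv_quadratic])
qed

lemma subtangent_uminus: "subtangent (\<lambda>x. - f x) t \<phi> \<longleftrightarrow> supertangent f t (\<lambda>x. - \<phi> x)"
proof -
  have "C1_near \<phi> t \<longleftrightarrow> C1_near (\<lambda>x. - \<phi> x) t"
    using C1_near_minus[of \<phi> t] C1_near_minus[of "\<lambda>x. - \<phi> x" t] by auto
  thus ?thesis
    unfolding constrained_subtangent_def constrained_supertangent_def by (simp add: algebra_simps)
qed

lemma HJ_subsolution_vertex_superjet1:
  assumes "HJ_subsolution E H c T0 T1 v" "x \<in> vertices E" "t \<in> einterval T0 T1"
    and "superjet1 (\<lambda>t. v (x, t)) t a"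
  shows "a \<le> c x"
  using supertangent_superjet1[OF assms(4)] assms unfolding HJ_subsolution_def by metis

text \<open>The order of the choices matters: one arc serves all end jets at \<open>(x, t)\<close>,
  so the jet may be constructed later, by doubling on that very arc.\<close>

lemma HJ_supersolution_vertex_superjet1:
  assumes v: "HJ_supersolution E H c T0 T1 v" and x: "x \<in> vertices E" and t: "t \<in> einterval T0 T1"
    and jet: "superjet1 (\<lambda>t. - v (x, t)) t (- a)" and a: "a < c x"
  obtains \<gamma> where "\<gamma> \<in> arcs_into E x"
    "\<And>p a. end_subjet (\<lambda>s t. v (\<gamma> s, t)) t p a \<Longrightarrow> 0 \<le> a + H \<gamma> 1 p"
proof -
  obtain \<psi> where "supertangent (\<lambda>t. - v (x, t)) t \<psi>" and \<psi>: "deriv \<psi> t = - a"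
    by (rule supertangent_superjet1[OF jet])
  hence sub: "subtangent (\<lambda>t. v (x, t)) t (\<lambda>t. - \<psi> t)"
    using subtangent_uminus[of "\<lambda>t. - v (x, t)" t "\<lambda>t. - \<psi> t"] by simp
  have "C1_near \<psi> t" using \<open>supertangent _ t \<psi>\<close> by (simp add: constrained_supertangent_def)
  then obtain D where "(\<psi> has_derivative D) (at t)" unfolding C1_near_def by blast
  hence "\<psi> field_differentiable at t"
    using differentiable_def field_differentiable_def real_differentiable_def by metis
  hence "deriv (\<lambda>t. - \<psi> t) t = a" using \<psi> by simp
  with v x t sub a obtain \<gamma> where \<gamma>: "\<gamma> \<in> arcs_into E x" "\<And>\<phi>.
     constrained_subtangent ({0..1} \<times> closure (einterval T0 T1)) (along v \<gamma>) (1, t) \<phi> \<Longrightarrow>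
           time_deriv \<phi> 1 t + H \<gamma> 1 (space_deriv \<phi> 1 t) \<ge> 0"
    unfolding HJ_supersolution_def by metis
  show ?thesis
  proof (rule that[OF \<gamma>(1)])
    fix p a assume "end_subjet (\<lambda>s t. v (\<gamma> s, t)) t p a"
    hence "end_subjet (\<lambda>s t. along v \<gamma> (s, t)) t p a" by (simp add: along_def)
    then obtain K where "constrained_subtangent ({0..1} \<times> closure (einterval T0 T1)) (along v \<gamma>) (1, t) (parabola 1 t p a K)"
      by (rule constrained_subtangent_end_subjet)
    from \<gamma>(2)[OF this] show "0 \<le> a + H \<gamma> 1 p" by (simp add: parabola_derivs)
  qed
qed

subsection \<open>Sup-convolution in time\<close>

text \<open>The point \<open>y\<close> is a parameter, so the result is again a function on the
  network and all arcs meeting at a vertex see the same trace. Applied to \<open>- v\<close> it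
  gives minus the inf-convolution of \<open>v\<close>. A large \<open>k\<close> means little
  regularisation.\<close>

definition sup_conv :: "real \<Rightarrow> real \<Rightarrow> real \<Rightarrow> ('b \<times> real \<Rightarrow> real) \<Rightarrow> 'b \<Rightarrow> real \<Rightarrow> real" where
  "sup_conv k T0 T u y t = (SUP r\<in>{T0..T}. u (y, r) - k * (t - r)\<^sup>2)"

lemma sup_conv_attained:
  fixes u :: "'b::topological_space \<times> real \<Rightarrow> real"
  assumes cont: "continuous_on (A \<times> {T0..T}) u" and "y \<in> A" "T0 \<le> T"
  shows "\<exists>r\<in>{T0..T}. sup_conv k T0 T u y t = u (y, r) - k * (t - r)\<^sup>2"
    and "r \<in> {T0..T} \<Longrightarrow> u (y, r) - k * (t - r)\<^sup>2 \<le> sup_conv k T0 T u y t"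
proof -
  let ?f = "\<lambda>r. u (y, r) - k * (t - r)\<^sup>2"
  have "continuous_on {T0..T} ?f"
    by (intro continuous_intros continuous_on_compose2[OF cont]) (use assms in auto)
  then obtain r0 where r0: "r0 \<in> {T0..T}" "\<And>r. r \<in> {T0..T} \<Longrightarrow> ?f r \<le> ?f r0"
    using continuous_attains_sup[of "{T0..T}" ?f] \<open>T0 \<le> T\<close> by fastforce
  have eq: "sup_conv k T0 T u y t = ?f r0"
    unfolding sup_conv_def by (rule cSup_eq_maximum) (use r0 in auto)
  thus "\<exists>r\<in>{T0..T}. sup_conv k T0 T u y t = ?f r" using r0 by blast
  show "r \<in> {T0..T} \<Longrightarrow> ?f r \<le> sup_conv k T0 T u y t" using eq r0 by simp
qed

text \<open>As a function of time this is a supremum of parabolas of one curvature; the parabola of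
  the maximiser supports it. The explicit bound on \<open>b\<close> later turns, by coercivity, into
  a Lipschitz bound in space.\<close>

lemma sup_conv_support:
  fixes u :: "'b::topological_space \<times> real \<Rightarrow> real"
  assumes cont: "continuous_on (A \<times> {T0..T}) u" and y: "y \<in> A" and T: "T0 \<le> T" and t: "t \<in> {T0..T}"
    and k: "k \<ge> 0"
  obtains b where "\<bar>b\<bar> \<le> 2 * k * (T - T0)"
    "\<And>t'. sup_conv k T0 T u y t + b * (t' - t) - k * (t' - t)\<^sup>2 \<le> sup_conv k T0 T u y t'"
proof -
  obtain r where r: "r \<in> {T0..T}" "sup_conv k T0 T u y t = u (y, r) - k * (t - r)\<^sup>2"
    using sup_conv_attained(1)[OF cont y T] by blast
  show ?thesis
  proof (rule that[of "2 * k * (r - t)"])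
    have "\<bar>2 * k * (r - t)\<bar> = 2 * k * \<bar>r - t\<bar>" using k by (simp add: abs_mult)
    also have "\<dots> \<le> 2 * k * (T - T0)" using r t k by (intro mult_left_mono) auto
    finally show "\<bar>2 * k * (r - t)\<bar> \<le> 2 * k * (T - T0)" .
    fix t'
    show "sup_conv k T0 T u y t + 2 * k * (r - t) * (t' - t) - k * (t' - t)\<^sup>2 \<le> sup_conv k T0 T u y t'"
      using sup_conv_attained(2)[OF cont y T r(1), of k t'] r(2) by (simp add: power2_eq_square algebra_simps)
  qed
qed

lemma continuous_on_sup_conv:
  fixes u :: "'b::metric_space \<times> real \<Rightarrow> real"
  assumes cont: "continuous_on (A \<times> {T0..T}) u" and A: "compact A" and T: "T0 < T" and k: "k \<ge> 0"
  shows "continuous_on (A \<times> {T0..T}) (\<lambda>(y, t). sup_conv k T0 T u y t)"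
  unfolding continuous_on_iff
proof (intro ballI allI impI)
  fix z e assume "z \<in> A \<times> {T0..T}" "e > (0::real)"
  have "uniformly_continuous_on (A \<times> {T0..T}) u"
    by (intro compact_uniformly_continuous[OF cont] compact_Times A) auto
  then obtain \<delta> where \<delta>: "\<delta> > 0" "\<And>z z'. z \<in> A \<times> {T0..T} \<Longrightarrow> z' \<in> A \<times> {T0..T} \<Longrightarrow> dist z' z < \<delta> \<Longrightarrow>
     dist (u z') (u z) < e / 2"
    unfolding uniformly_continuous_on_def using \<open>e > 0\<close> by (meson half_gt_zero)
  \<comment> \<open>A Lipschitz constant in \<open>t\<close> for all penalties
    \<open>k * (t - r)^2\<close> on the interval; the added 1 keeps it positive for
    \<open>k = 0\<close>.\<close>
  define \<Lambda> where "\<Lambda> = 2 * k * (T - T0) + 1"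
  have \<Lambda>: "\<Lambda> > 0" using k T by (simp add: \<Lambda>_def add_nonneg_pos)
  define \<delta>' where "\<delta>' = min \<delta> (e / (2 * \<Lambda>))"
  have "\<delta>' > 0" using \<delta> \<Lambda> \<open>e > 0\<close> by (simp add: \<delta>'_def)
  have le: "sup_conv k T0 T u y t - sup_conv k T0 T u y' t' < e"
    if yt: "y \<in> A" "y' \<in> A" "t \<in> {T0..T}" "t' \<in> {T0..T}" "dist y y' < \<delta>'" "dist t t' < \<delta>'" for y y' t t'
  proof -
    obtain r where r: "r \<in> {T0..T}" "sup_conv k T0 T u y t = u (y, r) - k * (t - r)\<^sup>2"
      using sup_conv_attained(1)[OF cont yt(1)] T by fastforce
    have "u (y', r) - k * (t' - r)\<^sup>2 \<le> sup_conv k T0 T u y' t'"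
      using sup_conv_attained(2)[OF cont yt(2) _ r(1)] T by simp
    moreover have "dist (u (y, r)) (u (y', r)) < e / 2"
      by (rule \<delta>(2)) (use yt r in \<open>auto simp: dist_Pair_Pair \<delta>'_def\<close>)
    moreover have "k * (t' - r)\<^sup>2 - k * (t - r)\<^sup>2 \<le> e / 2"
    proof -
      have "k * (t' - r)\<^sup>2 - k * (t - r)\<^sup>2 = k * ((t' - t) * (t' - r + (t - r)))"
        by (simp add: power2_eq_square algebra_simps)
      also have "\<dots> \<le> k * \<bar>(t' - t) * (t' - r + (t - r))\<bar>" using k by (intro mult_left_mono) auto
      also have "\<bar>(t' - t) * (t' - r + (t - r))\<bar> \<le> \<delta>' * (2 * (T - T0))"
        unfolding abs_mult using yt r by (intro mult_mono) (auto simp: dist_real_def)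
      also have "k * (\<delta>' * (2 * (T - T0))) \<le> \<Lambda> * \<delta>'"
        using \<open>\<delta>' > 0\<close> by (simp add: \<Lambda>_def algebra_simps)
      also have "\<Lambda> * \<delta>' \<le> \<Lambda> * (e / (2 * \<Lambda>))" using \<Lambda> by (intro mult_left_mono) (auto simp: \<delta>'_def)
      also have "\<dots> = e / 2" using \<Lambda> by simp
      finally show ?thesis using k by (simp add: mult_left_mono)
    qed
    ultimately show ?thesis using r(2) by (simp add: dist_real_def abs_if split: if_splits)
  qed
  obtain y t where z: "z = (y, t)" by fastforce
  show "\<exists>d>0. \<forall>x'\<in>A \<times> {T0..T}. dist x' z < d \<longrightarrow>
      dist (case x' of (y, t) \<Rightarrow> sup_conv k T0 T u y t) (case z of (y, t) \<Rightarrow> sup_conv k T0 T u y t) < e"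
  proof (intro exI conjI ballI impI)
    show "\<delta>' > 0" by fact
    fix x' assume x': "x' \<in> A \<times> {T0..T}" "dist x' z < \<delta>'"
    obtain y' t' where x'_eq: "x' = (y', t')" by fastforce
    have d: "dist y' y < \<delta>'" "dist t' t < \<delta>'"
      using x'(2) dist_fst_le[of x' z] dist_snd_le[of x' z] by (auto simp: x'_eq z)
    have mem: "y \<in> A" "y' \<in> A" "t \<in> {T0..T}" "t' \<in> {T0..T}" using x'(1) \<open>z \<in> _\<close> by (auto simp: x'_eq z)
    have "sup_conv k T0 T u y' t' - sup_conv k T0 T u y t < e" by (rule le) (use d mem in auto)
    moreover have "sup_conv k T0 T u y t - sup_conv k T0 T u y' t' < e"
      by (rule le) (use d mem in \<open>auto simp: dist_commute\<close>)
    ultimately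
    show "dist (case x' of (y, t) \<Rightarrow> sup_conv k T0 T u y t) (case z of (y, t) \<Rightarrow> sup_conv k T0 T u y t) < e"
      by (simp add: x'_eq z dist_real_def abs_less_iff)
  qed
qed

text \<open>The choice \<open>r = t\<close> is free of penalty, so a maximiser pays at most the
  oscillation \<open>2 * M\<close>. This is what keeps maximisers inside the open time interval,
  where the equation holds.\<close>

lemma sup_conv_argmax_near:
  fixes u :: "'b::topological_space \<times> real \<Rightarrow> real"
  assumes cont: "continuous_on (A \<times> {T0..T}) u" and y: "y \<in> A" and T: "T0 \<le> T" and t: "t \<in> {T0..T}"
    and bound: "\<And>z. z \<in> A \<times> {T0..T} \<Longrightarrow> \<bar>u z\<bar> \<le> M" and k: "2 * M < k * \<rho>\<^sup>2" "k > 0" and \<rho>: "\<rho> > 0"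
  obtains r where "r \<in> {T0..T}" "\<bar>r - t\<bar> < \<rho>" "sup_conv k T0 T u y t = u (y, r) - k * (t - r)\<^sup>2"
proof -
  obtain r where r: "r \<in> {T0..T}" "sup_conv k T0 T u y t = u (y, r) - k * (t - r)\<^sup>2"
    using sup_conv_attained(1)[OF cont y T] by blast
  have "u (y, t) \<le> sup_conv k T0 T u y t" using sup_conv_attained(2)[OF cont y T t, of k t] by simp
  hence "k * (t - r)\<^sup>2 \<le> u (y, r) - u (y, t)" using r by simp
  also have "\<dots> \<le> 2 * M" using bound[of "(y, r)"] bound[of "(y, t)"] r t y by (auto simp: abs_le_iff)
  also have "\<dots> < k * \<rho>\<^sup>2" by fact
  finally have "(t - r)\<^sup>2 < \<rho>\<^sup>2" using k by simp
  hence "\<bar>t - r\<bar> < \<rho>" using \<rho> power2_less_imp_less[of "\<bar>t - r\<bar>" \<rho>] by simp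
  thus ?thesis using that[OF r(1) _ r(2)] by (simp add: abs_minus_commute)
qed

text \<open>With the penalty frozen at its value for \<open>r\<close>, a translation in time by
  \<open>t - r\<close> puts \<open>u\<close> below the convolution, with contact at
  \<open>(s, r)\<close>. A parabola above the convolution therefore yields one above
  \<open>u\<close> with the same slopes, and a Hamiltonian independent of time does not notice the
  translation.\<close>

lemma superjet2_sup_conv:
  fixes u :: "'b::topological_space \<times> real \<Rightarrow> real"
  assumes cont: "continuous_on (A \<times> {T0..T}) u" and T: "T0 \<le> T"
    and \<gamma>: "\<And>s. s \<in> {0..1} \<Longrightarrow> \<gamma> s \<in> A" and s: "0 < s" "s < 1"
    and r: "T0 < r" "r < T" "sup_conv k T0 T u (\<gamma> s) t = u (\<gamma> s, r) - k * (t - r)\<^sup>2"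
    and jet: "superjet2 (\<lambda>s t. sup_conv k T0 T u (\<gamma> s) t) s t p a"
  shows "superjet2 (\<lambda>s t. u (\<gamma> s, t)) s r p a"
proof -
  obtain K d where d: "d > 0" and K: "\<And>s' t'. \<bar>s' - s\<bar> < d \<Longrightarrow> \<bar>t' - t\<bar> < d \<Longrightarrow>
     sup_conv k T0 T u (\<gamma> s') t' \<le> sup_conv k T0 T u (\<gamma> s) t
       + p * (s' - s) + a * (t' - t) + K * ((s' - s)\<^sup>2 + (t' - t)\<^sup>2)"
    using jet unfolding superjet2_def by blast
  show ?thesis unfolding superjet2_def
  proof (intro exI conjI allI impI)
    show "min d (min (min s (1 - s)) (min (r - T0) (T - r))) > 0" using d r s by simp
    fix s' r' assume *: "\<bar>s' - s\<bar> < min d (min (min s (1 - s)) (min (r - T0) (T - r)))"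
      "\<bar>r' - r\<bar> < min d (min (min s (1 - s)) (min (r - T0) (T - r)))"
    have "s' \<in> {0..1}" "r' \<in> {T0..T}" using * by (auto simp: abs_less_iff)
    from sup_conv_attained(2)[OF cont \<gamma>[OF this(1)] T this(2), of k "t + (r' - r)"]
    have "u (\<gamma> s', r') - k * (t - r)\<^sup>2 \<le> sup_conv k T0 T u (\<gamma> s') (t + (r' - r))"
      by (simp add: algebra_simps)
    also have "\<dots> \<le> u (\<gamma> s, r) - k * (t - r)\<^sup>2 + p * (s' - s) + a * (r' - r) + K * ((s' - s)\<^sup>2 + (r' - r)\<^sup>2)"
      using K[of s' "t + (r' - r)"] * r(3) by simp
    finally show "u (\<gamma> s', r') \<le> u (\<gamma> s, r) + p * (s' - s) + a * (r' - r) + K * ((s' - s)\<^sup>2 + (r' - r)\<^sup>2)"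
      by simp
  qed
qed

lemma superjet1_sup_conv:
  fixes u :: "'b::topological_space \<times> real \<Rightarrow> real"
  assumes cont: "continuous_on (A \<times> {T0..T}) u" and T: "T0 \<le> T" and y: "y \<in> A"
    and r: "T0 < r" "r < T" "sup_conv k T0 T u y t = u (y, r) - k * (t - r)\<^sup>2"
    and jet: "superjet1 (sup_conv k T0 T u y) t a"
  shows "superjet1 (\<lambda>t. u (y, t)) r a"
proof -
  obtain K d where d: "d > 0" and K: "\<And>t'. \<bar>t' - t\<bar> < d \<Longrightarrow>
     sup_conv k T0 T u y t' \<le> sup_conv k T0 T u y t + a * (t' - t) + K * (t' - t)\<^sup>2"
    using jet unfolding superjet1_def by blast
  show ?thesis unfolding superjet1_def
  proof (intro exI conjI allI impI)
    show "min d (min (r - T0) (T - r)) > 0" using d r by simp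
    fix r' assume *: "\<bar>r' - r\<bar> < min d (min (r - T0) (T - r))"
    have "r' \<in> {T0..T}" using * by (auto simp: abs_less_iff)
    from sup_conv_attained(2)[OF cont y T this, of k "t + (r' - r)"]
    have "u (y, r') - k * (t - r)\<^sup>2 \<le> sup_conv k T0 T u y (t + (r' - r))"
      by (simp add: algebra_simps)
    also have "\<dots> \<le> u (y, r) - k * (t - r)\<^sup>2 + a * (r' - r) + K * (r' - r)\<^sup>2"
      using K[of "t + (r' - r)"] * r(3) by simp
    finally show "u (y, r') \<le> u (y, r) + a * (r' - r) + K * (r' - r)\<^sup>2" by simp
  qed
qed

text \<open>The time \<open>r\<close> belongs to the point \<open>\<gamma> 1\<close> and to
  \<open>t\<close>, not to the jet. All end jets at \<open>t\<close> thus become end jets of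
  \<open>v\<close> at one single time, and the arc chosen at that time serves them all.\<close>

lemma end_subjet_inf_conv:
  fixes v :: "'b::topological_space \<times> real \<Rightarrow> real"
  assumes cont: "continuous_on (A \<times> {T0..T}) (\<lambda>z. - v z)" and T: "T0 \<le> T"
    and \<gamma>: "\<And>s. s \<in> {0..1} \<Longrightarrow> \<gamma> s \<in> A"
    and r: "T0 < r" "r < T" "sup_conv k T0 T (\<lambda>z. - v z) (\<gamma> 1) t = - v (\<gamma> 1, r) - k * (t - r)\<^sup>2"
    and jet: "end_subjet (\<lambda>s t. - sup_conv k T0 T (\<lambda>z. - v z) (\<gamma> s) t) t p a"
  shows "end_subjet (\<lambda>s t. v (\<gamma> s, t)) r p a"
proof -
  let ?V = "sup_conv k T0 T (\<lambda>z. - v z)"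
  obtain K d where d: "d > 0" and K: "\<And>s' t'. 1 - d < s' \<Longrightarrow> s' \<le> 1 \<Longrightarrow> \<bar>t' - t\<bar> < d \<Longrightarrow>
     - ?V (\<gamma> 1) t + p * (s' - 1) + a * (t' - t) - K * ((s' - 1)\<^sup>2 + (t' - t)\<^sup>2) \<le> - ?V (\<gamma> s') t'"
    using jet unfolding end_subjet_def by blast
  show ?thesis unfolding end_subjet_def
  proof (intro exI conjI allI impI)
    show "min d (min 1 (min (r - T0) (T - r))) > 0" using d r by simp
    fix s' r' assume *: "1 - min d (min 1 (min (r - T0) (T - r))) < s'" "s' \<le> 1"
      "\<bar>r' - r\<bar> < min d (min 1 (min (r - T0) (T - r)))"
    have "s' \<in> {0..1}" using *(1,2) by (auto simp: min_def split: if_splits)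
    moreover have "r' \<in> {T0..T}" using *(3) by (auto simp: abs_less_iff)
    ultimately have "- v (\<gamma> s', r') - k * (t - r)\<^sup>2 \<le> ?V (\<gamma> s') (t + (r' - r))"
      using sup_conv_attained(2)[OF cont \<gamma> T, of s' r' k "t + (r' - r)"] by (simp add: algebra_simps)
    moreover have "1 - d < s'" using *(1) by simp
    ultimately show "v (\<gamma> 1, r) + p * (s' - 1) + a * (r' - r) - K * ((s' - 1)\<^sup>2 + (r' - r)\<^sup>2) \<le> v (\<gamma> s', r')"
      using K[of s' "t + (r' - r)"] * r(3) by simp
  qed
qed

subsection \<open>Comparison on the network\<close>

text \<open>Upper bounds on superjet slopes control only increments of one sign. For the other sign
  \<open>f\<close> is reflected in the middle of the interval, which keeps superjets and reverses
  their slopes; passing to \<open>- f\<close> would give subjets, about which nothing is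
  assumed.\<close>

lemma superjet1_bounded_imp_lipschitz:
  fixes f :: "real \<Rightarrow> real"
  assumes cont: "continuous_on {0..1} f"
    and slope: "\<And>s p. 0 < s \<Longrightarrow> s < 1 \<Longrightarrow> superjet1 f s p \<Longrightarrow> \<bar>p\<bar> \<le> L"
    and s: "s \<in> {0..1}" "s' \<in> {0..1}"
  shows "\<bar>f s - f s'\<bar> \<le> L * \<bar>s - s'\<bar>"
proof -
  have up: "f b - f a \<le> L * (b - a)" if "0 \<le> a" "a \<le> b" "b \<le> 1" for a b
    by (rule superjet1_slope_imp_lipschitz[OF cont _ that]) (use slope in force)
  have "continuous_on {0..1} (\<lambda>s. f (1 - s))"
    by (intro continuous_on_compose2[OF cont] continuous_intros) auto
  moreover have "p \<le> L" if s: "0 < s" "s < 1" and jet: "superjet1 (\<lambda>s. f (1 - s)) s p" for s p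
  proof -
    obtain K r where r: "r > 0" and K: "\<And>s'. \<bar>s' - s\<bar> < r \<Longrightarrow>
       f (1 - s') \<le> f (1 - s) + p * (s' - s) + K * (s' - s)\<^sup>2"
      using jet unfolding superjet1_def by blast
    have "superjet1 f (1 - s) (- p)"
      unfolding superjet1_def
    proof (intro exI conjI allI impI)
      fix s' assume "\<bar>s' - (1 - s)\<bar> < r"
      thus "f s' \<le> f (1 - s) + - p * (s' - (1 - s)) + K * (s' - (1 - s))\<^sup>2"
        using K[of "1 - s'"] by (simp add: abs_minus_commute algebra_simps power2_eq_square)
    qed fact
    thus ?thesis using slope[of "1 - s" "- p"] s by auto
  qed
  ultimately have "f (1 - b) - f (1 - a) \<le> L * (b - a)" if "0 \<le> a" "a \<le> b" "b \<le> 1" for a b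
    using superjet1_slope_imp_lipschitz[of 0 1 "\<lambda>s. f (1 - s)" L a b] that by blast
  from this[of "1 - b" "1 - a" for a b]
  have down: "f a - f b \<le> L * (b - a)" if "0 \<le> a" "a \<le> b" "b \<le> 1" for a b
    using that by simp
  show ?thesis using s up[of s s'] up[of s' s] down[of s s'] down[of s' s]
    by (cases "s \<le> s'") (auto simp: abs_if)
qed

lemma network_arc:
  assumes "network E" "\<gamma> \<in> E"
  shows "continuous_on {0..1} \<gamma>" "s \<in> {0..1} \<Longrightarrow> \<gamma> s \<in> support E"
proof -
  have "path \<gamma>" using assms unfolding network_def C1_arc_def by (meson simple_path_imp_path)
  thus "continuous_on {0..1} \<gamma>" by (simp add: path_def)
  show "s \<in> {0..1} \<Longrightarrow> \<gamma> s \<in> support E" using assms unfolding support_def path_image_def by blast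
qed

lemma compact_support:
  assumes "network E"
  shows "compact (support E)"
proof -
  have "compact (path_image \<gamma>)" if "\<gamma> \<in> E" for \<gamma>
    unfolding path_image_def using network_arc[OF assms that] by (intro compact_continuous_image) auto
  thus ?thesis unfolding support_def using assms by (intro compact_UN) (auto simp: network_def)
qed

lemma einterval_real: "t \<in> einterval (ereal a) T1 \<longleftrightarrow> a < t \<and> ereal t < T1"
  by (simp add: einterval_def)

lemma hamiltonian_coercive:
  assumes "hamiltonians E H" "\<gamma> \<in> E"
  obtains L where "L \<ge> 0" "\<And>s p. s \<in> {0..1} \<Longrightarrow> H \<gamma> s p < K \<Longrightarrow> \<bar>p\<bar> \<le> L"
proof -
  have "\<forall>\<^sub>F p in at_infinity. \<forall>s\<in>{0..1}. K \<le> H \<gamma> s p"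
    using assms by (simp add: hamiltonians_def)
  then obtain b where b: "\<And>p. b \<le> norm p \<Longrightarrow> \<forall>s\<in>{0..1}. K \<le> H \<gamma> s p"
    unfolding eventually_at_infinity by blast
  show ?thesis
  proof (rule that[of "max b 0"])
    fix s p :: real assume "s \<in> {0..1}" "H \<gamma> s p < K"
    with b[of p] show "\<bar>p\<bar> \<le> max b 0" by force
  qed simp
qed

theorem HJ_comparison:
  fixes E :: "(real \<Rightarrow> 'a::euclidean_space) set"
  assumes net: "network E" and ham: "hamiltonians E H"
    and u: "HJ_subsolution E H c T0 T1 u" and v: "HJ_supersolution E H c T0 T1 v"
    and init: "\<And>x. x \<in> support E \<Longrightarrow> u (x, T0) - v (x, T0) \<le> m"
    and z1: "(y1, t1) \<in> spacetime E T0 T1"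
  shows "u (y1, t1) - v (y1, t1) \<le> m"
proof (rule ccontr)
  assume neg: "\<not> ?thesis"
  \<comment> \<open>A quarter of the excess: one share is spent on the linear part of \<zeta>, two
    on the oscillation of \<open>u\<close> and \<open>v\<close> near \<open>T0\<close>, and one is
    left for the contradiction.\<close>
  define \<kappa> where "\<kappa> = (u (y1, t1) - v (y1, t1) - m) / 4"
  have \<kappa>: "\<kappa> > 0" "u (y1, t1) - v (y1, t1) = m + 4 * \<kappa>" using neg by (simp_all add: \<kappa>_def field_simps)
  define \<Gamma> where "\<Gamma> = support E"
  have y1: "y1 \<in> \<Gamma>" and t1: "T0 \<le> t1" "ereal t1 < T1" using z1 by (auto simp: spacetime_def \<Gamma>_def)
  have "t1 \<noteq> T0" using init[of y1] y1 \<kappa> by (auto simp: \<Gamma>_def)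
  hence t1': "T0 < t1" using t1 by simp
  \<comment> \<open>\<open>T1\<close> may be infinite and the functions unbounded near it; all that
    follows takes place on the compact strip up to \<open>T\<close>.\<close>
  obtain T where T: "t1 < T" "ereal T < T1" using ereal_dense2[OF t1(2)] by auto
  have T0T: "T0 < T" and T0T': "T0 \<le> T" using t1' T by auto
  have \<Gamma>: "compact \<Gamma>" unfolding \<Gamma>_def by (rule compact_support[OF net])
  have sub: "\<Gamma> \<times> {T0..T} \<subseteq> spacetime E T0 T1"
    using T(2) by (auto simp: spacetime_def \<Gamma>_def intro: le_less_trans[OF _ T(2)])
  have ucont: "continuous_on (\<Gamma> \<times> {T0..T}) u"
    using u continuous_on_subset[OF _ sub] by (auto simp: HJ_subsolution_def)
  have vcont: "continuous_on (\<Gamma> \<times> {T0..T}) v"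
    using v continuous_on_subset[OF _ sub] by (auto simp: HJ_supersolution_def)
  have mvcont: "continuous_on (\<Gamma> \<times> {T0..T}) (\<lambda>z. - v z)" by (intro continuous_intros vcont)
  have cptZ: "compact (\<Gamma> \<times> {T0..T})" by (intro compact_Times \<Gamma>) auto
  obtain M1 where M1: "\<And>z. z \<in> \<Gamma> \<times> {T0..T} \<Longrightarrow> \<bar>u z\<bar> \<le> M1"
    using compact_imp_bounded[OF compact_continuous_image[OF ucont cptZ]] unfolding bounded_real by blast
  obtain M2 where M2: "\<And>z. z \<in> \<Gamma> \<times> {T0..T} \<Longrightarrow> \<bar>v z\<bar> \<le> M2"
    using compact_imp_bounded[OF compact_continuous_image[OF vcont cptZ]] unfolding bounded_real by blast
  define M where "M = max 0 (max M1 M2)"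
  have M: "M \<ge> 0" "\<And>z. z \<in> \<Gamma> \<times> {T0..T} \<Longrightarrow> \<bar>u z\<bar> \<le> M" "\<And>z. z \<in> \<Gamma> \<times> {T0..T} \<Longrightarrow> \<bar>- v z\<bar> \<le> M"
    using M1 M2 by (force simp: M_def)+
  obtain \<omega>1 where \<omega>1: "\<omega>1 > 0" "\<And>z z'. z \<in> \<Gamma> \<times> {T0..T} \<Longrightarrow> z' \<in> \<Gamma> \<times> {T0..T} \<Longrightarrow> dist z' z < \<omega>1 \<Longrightarrow>
     dist (u z') (u z) < \<kappa>"
    using compact_uniformly_continuous[OF ucont cptZ] \<kappa>(1) unfolding uniformly_continuous_on_def by metis
  obtain \<omega>2 where \<omega>2: "\<omega>2 > 0" "\<And>z z'. z \<in> \<Gamma> \<times> {T0..T} \<Longrightarrow> z' \<in> \<Gamma> \<times> {T0..T} \<Longrightarrow> dist z' z < \<omega>2 \<Longrightarrow>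
     dist (v z') (v z) < \<kappa>"
    using compact_uniformly_continuous[OF vcont cptZ] \<kappa>(1) unfolding uniformly_continuous_on_def by metis
  \<comment> \<open>With \<open>k\<close> chosen below, maximisers of the convolutions stay within
    \<rho>. Those for times between \<tau>0 and \<tau>1 are then interior, and those for \<tau>0 lie
    within \<open>2 * \<rho>\<close> of \<open>T0\<close>, inside both moduli of continuity.\<close>
  define \<rho> where "\<rho> = min (min \<omega>1 \<omega>2) (min (t1 - T0) (T - t1)) / 4"
  have \<rho>: "\<rho> > 0" "4 * \<rho> \<le> \<omega>1" "4 * \<rho> \<le> \<omega>2" "4 * \<rho> \<le> t1 - T0" "4 * \<rho> \<le> T - t1"
    using \<omega>1 \<omega>2 t1' T by (auto simp: \<rho>_def)
  define \<tau>0 where "\<tau>0 = T0 + \<rho>"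
  define \<tau>1 where "\<tau>1 = T - \<rho>"
  have \<tau>: "T0 < \<tau>0" "\<tau>0 < t1" "t1 < \<tau>1" "\<tau>1 < T" using \<rho> by (auto simp: \<tau>0_def \<tau>1_def)
  define k where "k = (2 * M + 1) / \<rho>\<^sup>2"
  have k: "k > 0" "2 * M < k * \<rho>\<^sup>2" using M(1) \<rho>(1) by (auto simp: k_def)
  define U where "U = sup_conv k T0 T u"
  define V where "V = sup_conv k T0 T (\<lambda>z. - v z)"
  have argU: "\<exists>r. T0 \<le> r \<and> r \<le> T \<and> \<bar>r - t\<bar> < \<rho> \<and> U y t = u (y, r) - k * (t - r)\<^sup>2"
    if y: "y \<in> \<Gamma>" and t: "t \<in> {T0..T}" for y t
    using sup_conv_argmax_near[OF ucont y T0T' t M(2) k(2,1) \<rho>(1)] unfolding U_def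
    by (metis atLeastAtMost_iff)
  have argV: "\<exists>r. T0 \<le> r \<and> r \<le> T \<and> \<bar>r - t\<bar> < \<rho> \<and> V y t = - v (y, r) - k * (t - r)\<^sup>2"
    if y: "y \<in> \<Gamma>" and t: "t \<in> {T0..T}" for y t
    using sup_conv_argmax_near[OF mvcont y T0T' t M(3) k(2,1) \<rho>(1)] unfolding V_def
    by (metis atLeastAtMost_iff)
  have suppU: "\<exists>b. \<bar>b\<bar> \<le> 2 * k * (T - T0) \<and> (\<forall>t'. U y t + b * (t' - t) - k * (t' - t)\<^sup>2 \<le> U y t')"
    if y: "y \<in> \<Gamma>" and t: "t \<in> {T0..T}" for y t
    using sup_conv_support[OF ucont y T0T' t less_imp_le[OF k(1)]] unfolding U_def by metis
  have suppV: "\<exists>b. \<bar>b\<bar> \<le> 2 * k * (T - T0) \<and> (\<forall>t'. V y t + b * (t' - t) - k * (t' - t)\<^sup>2 \<le> V y t')"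
    if y: "y \<in> \<Gamma>" and t: "t \<in> {T0..T}" for y t
    using sup_conv_support[OF mvcont y T0T' t less_imp_le[OF k(1)]] unfolding V_def by metis
  have Ucont: "continuous_on (\<Gamma> \<times> {T0..T}) (\<lambda>(y, t). U y t)"
    unfolding U_def by (rule continuous_on_sup_conv[OF ucont \<Gamma> T0T less_imp_le[OF k(1)]])
  have Vcont: "continuous_on (\<Gamma> \<times> {T0..T}) (\<lambda>(y, t). V y t)"
    unfolding V_def by (rule continuous_on_sup_conv[OF mvcont \<Gamma> T0T less_imp_le[OF k(1)]])
  define \<eta> where "\<eta> = \<kappa> / (t1 - \<tau>0)"
  \<comment> \<open>At \<tau>1 the sum \<open>U + V\<close> is at most \<open>2 * M\<close>, while
    the value to beat is at least \<open>- 2 * M - \<kappa>\<close>; the penalty at \<tau>1 exceeds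
    the difference.\<close>
  define D where "D = (4 * M + 2 * \<kappa>) / (\<tau>1 - t1)\<^sup>2"
  have \<eta>: "\<eta> > 0" "\<eta> * (t1 - \<tau>0) = \<kappa>" using \<kappa> \<tau> by (auto simp: \<eta>_def)
  have D: "D > 0" "D * (\<tau>1 - t1)\<^sup>2 = 4 * M + 2 * \<kappa>" using \<kappa> \<tau> M(1) by (auto simp: D_def add_nonneg_pos)
  \<comment> \<open>The linear part makes the slope strictly positive, which gives the surplus
    \<open>d\<close> at the contact. The squared positive part excludes late maxima, costs nothing
    at \<open>t1\<close>, and still admits an upper parabola everywhere.\<close>
  define \<zeta> where "\<zeta> = (\<lambda>t. \<eta> * (t - \<tau>0) + D * (max 0 (t - t1))\<^sup>2)"
  define W where "W = (\<lambda>(y, t). U y t + V y t - \<zeta> t)"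
  have subZ: "\<Gamma> \<times> {\<tau>0..\<tau>1} \<subseteq> \<Gamma> \<times> {T0..T}" using \<tau> by auto
  have "continuous_on (\<Gamma> \<times> {\<tau>0..\<tau>1}) (\<lambda>z. U (fst z) (snd z))" "continuous_on (\<Gamma> \<times> {\<tau>0..\<tau>1}) (\<lambda>z. V (fst z) (snd z))"
    using continuous_on_subset[OF Ucont subZ] continuous_on_subset[OF Vcont subZ]
    by (simp_all add: case_prod_unfold)
  hence "continuous_on (\<Gamma> \<times> {\<tau>0..\<tau>1}) W"
    unfolding W_def \<zeta>_def case_prod_beta by (intro continuous_intros)
  moreover have "compact (\<Gamma> \<times> {\<tau>0..\<tau>1})" by (intro compact_Times \<Gamma>) auto
  moreover have "(y1, t1) \<in> \<Gamma> \<times> {\<tau>0..\<tau>1}" using y1 \<tau> by auto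
  ultimately obtain z0 where z0: "z0 \<in> \<Gamma> \<times> {\<tau>0..\<tau>1}" "\<And>z. z \<in> \<Gamma> \<times> {\<tau>0..\<tau>1} \<Longrightarrow> W z \<le> W z0"
    using continuous_attains_sup[of "\<Gamma> \<times> {\<tau>0..\<tau>1}" W] by blast
  obtain y0 t0 where z0_eq: "z0 = (y0, t0)" by fastforce
  have y0: "y0 \<in> \<Gamma>" and t0I: "t0 \<in> {\<tau>0..\<tau>1}" using z0 by (auto simp: z0_eq)
  have max: "W (y, t) \<le> W (y0, t0)" if "y \<in> \<Gamma>" "t \<in> {\<tau>0..\<tau>1}" for y t
    using z0(2)[of "(y, t)"] that by (simp add: z0_eq)
  have Wge: "m + 3 * \<kappa> \<le> W (y0, t0)"
  proof -
    have "u (y1, t1) \<le> U y1 t1" unfolding U_def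
      using sup_conv_attained(2)[OF ucont y1, of t1 k t1] T0T \<tau> by simp
    moreover have "- v (y1, t1) \<le> V y1 t1" unfolding V_def
      using sup_conv_attained(2)[OF mvcont y1, of t1 k t1] T0T \<tau> by simp
    ultimately have "m + 3 * \<kappa> \<le> W (y1, t1)" using \<kappa>(2) \<eta>(2) by (simp add: W_def \<zeta>_def)
    also have "\<dots> \<le> W (y0, t0)" using y1 \<tau> by (intro max) auto
    finally show ?thesis .
  qed
  have "t0 \<noteq> \<tau>0"
  proof
    assume eq: "t0 = \<tau>0"
    have \<tau>0I: "\<tau>0 \<in> {T0..T}" using \<tau> by auto
    obtain r where r: "T0 \<le> r" "r \<le> T" "\<bar>r - \<tau>0\<bar> < \<rho>" "U y0 \<tau>0 = u (y0, r) - k * (\<tau>0 - r)\<^sup>2"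
      using argU[OF y0 \<tau>0I] by blast
    obtain r' where r': "T0 \<le> r'" "r' \<le> T" "\<bar>r' - \<tau>0\<bar> < \<rho>" "V y0 \<tau>0 = - v (y0, r') - k * (\<tau>0 - r')\<^sup>2"
      using argV[OF y0 \<tau>0I] by blast
    have "dist (u (y0, r)) (u (y0, T0)) < \<kappa>"
      by (rule \<omega>1(2)) (use r y0 T0T \<rho> in \<open>auto simp: dist_Pair_Pair dist_real_def \<tau>0_def abs_less_iff\<close>)
    moreover have "dist (v (y0, r')) (v (y0, T0)) < \<kappa>"
      by (rule \<omega>2(2)) (use r' y0 T0T \<rho> in \<open>auto simp: dist_Pair_Pair dist_real_def \<tau>0_def abs_less_iff\<close>)
    moreover have "u (y0, T0) - v (y0, T0) \<le> m" using init y0 by (simp add: \<Gamma>_def)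
    moreover have "k * (\<tau>0 - r)\<^sup>2 \<ge> 0" "k * (\<tau>0 - r')\<^sup>2 \<ge> 0" using k by auto
    moreover have "W (y0, t0) = U y0 \<tau>0 + V y0 \<tau>0" using \<tau> by (simp add: W_def \<zeta>_def eq)
    ultimately show False using r(4) r'(4) Wge \<kappa>(1) unfolding dist_real_def by linarith
  qed
  moreover have "t0 \<noteq> \<tau>1"
  proof
    assume eq: "t0 = \<tau>1"
    have \<tau>1I: "\<tau>1 \<in> {T0..T}" using \<tau> by auto
    obtain r where r: "T0 \<le> r" "r \<le> T" "\<bar>r - \<tau>1\<bar> < \<rho>" "U y0 \<tau>1 = u (y0, r) - k * (\<tau>1 - r)\<^sup>2"
      using argU[OF y0 \<tau>1I] by blast
    obtain r' where r': "T0 \<le> r'" "r' \<le> T" "\<bar>r' - \<tau>1\<bar> < \<rho>" "V y0 \<tau>1 = - v (y0, r') - k * (\<tau>1 - r')\<^sup>2"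
      using argV[OF y0 \<tau>1I] by blast
    have "\<bar>u (y0, r)\<bar> \<le> M" "\<bar>- v (y0, r')\<bar> \<le> M" "\<bar>u (y1, t1)\<bar> \<le> M" "\<bar>- v (y1, t1)\<bar> \<le> M"
      using M(2)[of "(y0, r)"] M(3)[of "(y0, r')"] M(2)[of "(y1, t1)"] M(3)[of "(y1, t1)"] y0 y1 r r' \<tau> by auto
    moreover have "k * (\<tau>1 - r)\<^sup>2 \<ge> 0" "k * (\<tau>1 - r')\<^sup>2 \<ge> 0" using k by auto
    moreover have "W (y0, t0) \<le> U y0 \<tau>1 + V y0 \<tau>1 - (4 * M + 2 * \<kappa>)"
      using \<tau> \<eta> D by (simp add: W_def \<zeta>_def eq)
    ultimately show False using r(4) r'(4) Wge \<kappa> by linarith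
  qed
  ultimately have t0: "\<tau>0 < t0" "t0 < \<tau>1" using t0I by auto
  define d where "d = \<eta> + 2 * D * max 0 (t0 - t1)"
  have d: "d > 0" using \<eta> D by (simp add: d_def add_pos_nonneg)
  define C where "C = k + D"
  have C: "C \<ge> 0" "k \<le> C" "D \<le> C" using k D by (auto simp: C_def)
  have \<zeta>_le: "\<zeta> t - \<zeta> t0 \<le> d * (t - t0) + D * (t - t0)\<^sup>2" for t
  proof -
    define a where "a = max 0 (t0 - t1)"
    define b where "b = max 0 (t - t1)"
    have "b \<le> \<bar>a + (t - t0)\<bar>" "b \<ge> 0" by (auto simp: a_def b_def max_def abs_if)
    hence "b\<^sup>2 \<le> (a + (t - t0))\<^sup>2" using power_mono[of b "\<bar>a + (t - t0)\<bar>" 2] by simp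
    hence "D * b\<^sup>2 \<le> D * (a + (t - t0))\<^sup>2" using D by (intro mult_left_mono) auto
    thus ?thesis unfolding \<zeta>_def d_def a_def[symmetric] b_def[symmetric]
      by (simp add: power2_eq_square algebra_simps)
  qed
  define r0 where "r0 = min (t0 - \<tau>0) (\<tau>1 - t0) / 2"
  have r0: "r0 > 0" "\<tau>0 < t0 - r0" "t0 + r0 < \<tau>1"
    using t0 by (auto simp: r0_def min_def field_simps)
  have box: "t \<in> {T0..T}" "t \<in> {\<tau>0..\<tau>1}" if "\<bar>t - t0\<bar> \<le> r0" for t
    using that r0 \<tau> by (auto simp: abs_le_iff)
  have touch0: "U y t + V y t \<le> U y0 t0 + V y0 t0 + d * (t - t0) + C * (t - t0)\<^sup>2"
    if "y \<in> \<Gamma>" "\<bar>t - t0\<bar> \<le> r0" for y t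
  proof -
    have "D * (t - t0)\<^sup>2 \<le> C * (t - t0)\<^sup>2" using C by (intro mult_right_mono) auto
    thus ?thesis using max[OF that(1) box(2)[OF that(2)]] \<zeta>_le[of t] by (simp add: W_def)
  qed
  have int: "r \<in> einterval T0 T1" "T0 < r" "r < T" if "\<bar>r - t\<bar> < \<rho>" "\<tau>0 \<le> t" "t \<le> \<tau>1" for r t
  proof -
    show r: "T0 < r" "r < T" using that by (auto simp: \<tau>0_def \<tau>1_def abs_less_iff)
    show "r \<in> einterval T0 T1" unfolding einterval_real using r less_trans[of "ereal r" "ereal T" T1] T(2) by simp
  qed
  \<comment> \<open>One statement for interior points and vertices: the condition on end jets is
    vacuous unless \<open>s0 = 1\<close>.\<close>
  have core: False
    if \<gamma>: "\<gamma> \<in> E" and s0: "0 < s0" "s0 \<le> 1" "\<gamma> s0 = y0"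
      and ends: "\<And>p a. s0 = 1 \<Longrightarrow> end_subjet (\<lambda>s t. - V (\<gamma> s) t) t0 p a \<Longrightarrow> 0 \<le> a + H \<gamma> 1 p" for \<gamma> s0
  proof -
    have \<gamma>\<Gamma>: "\<gamma> s \<in> \<Gamma>" if "s \<in> {0..1}" for s
      using network_arc(2)[OF net \<gamma> that] by (simp add: \<Gamma>_def)
    have \<gamma>cont: "continuous_on {0..1} \<gamma>" by (rule network_arc(1)[OF net \<gamma>])
    have hcont: "continuous_on ({0..1} \<times> UNIV) (\<lambda>(s, p). H \<gamma> s p)" using ham \<gamma> by (simp add: hamiltonians_def)
    have comp: "continuous_on ({0..1} \<times> I) (\<lambda>(s, t). F (\<gamma> s) t)"
      if "continuous_on (\<Gamma> \<times> {T0..T}) (\<lambda>(y, t). F y t)" "I \<subseteq> {T0..T}" for F :: "'a \<Rightarrow> real \<Rightarrow> real" and I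
    proof -
      have "continuous_on ({0..1} \<times> I) ((\<lambda>(y, t). F y t) \<circ> (\<lambda>z. (\<gamma> (fst z), snd z)))"
        by (rule continuous_on_compose)
          (use that \<gamma>\<Gamma> in \<open>force intro!: continuous_intros continuous_on_compose2[OF \<gamma>cont] continuous_on_subset[OF that(1)]\<close>)+
      thus ?thesis by (simp add: o_def case_prod_unfold)
    qed
    have boxsub: "{t0 - r0..t0 + r0} \<subseteq> {T0..T}" using r0 \<tau> by auto
    have Usub: "a + H \<gamma> s p \<le> 0"
      if s: "0 < s" "s < 1" and t: "\<tau>0 \<le> t" "t \<le> \<tau>1" and jet: "superjet2 (\<lambda>s t. U (\<gamma> s) t) s t p a" for s t p a
    proof -
      have "t \<in> {T0..T}" "\<gamma> s \<in> \<Gamma>" using t \<tau> s \<gamma>\<Gamma> by auto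
      then obtain r where r: "\<bar>r - t\<bar> < \<rho>" "U (\<gamma> s) t = u (\<gamma> s, r) - k * (t - r)\<^sup>2" using argU by blast
      note ri = int[OF r(1) t]
      have "superjet2 (\<lambda>s t. u (\<gamma> s, t)) s r p a"
        by (rule superjet2_sup_conv[OF ucont T0T' \<gamma>\<Gamma> s ri(2,3) r(2)[unfolded U_def] jet[unfolded U_def]])
      hence "superjet2 (\<lambda>s t. along u \<gamma> (s, t)) s r p a" by (simp add: along_def)
      thus ?thesis using arc_subsolution_superjet2 s ri u \<gamma> unfolding HJ_subsolution_def by blast
    qed
    have Vsup: "0 \<le> a + H \<gamma> s p"
      if s: "0 < s" "s < 1" and t: "\<tau>0 \<le> t" "t \<le> \<tau>1"
        and jet: "superjet2 (\<lambda>s t. V (\<gamma> s) t) s t (- p) (- a)" for s t p a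
    proof -
      have "t \<in> {T0..T}" "\<gamma> s \<in> \<Gamma>" using t \<tau> s \<gamma>\<Gamma> by auto
      then obtain r where r: "\<bar>r - t\<bar> < \<rho>" "V (\<gamma> s) t = - v (\<gamma> s, r) - k * (t - r)\<^sup>2" using argV by blast
      note ri = int[OF r(1) t]
      have "superjet2 (\<lambda>s t. - v (\<gamma> s, t)) s r (- p) (- a)"
        by (rule superjet2_sup_conv[OF mvcont T0T' \<gamma>\<Gamma> s ri(2,3) r(2)[unfolded V_def] jet[unfolded V_def]])
      hence "superjet2 (\<lambda>s t. - along v \<gamma> (s, t)) s r (- p) (- a)" by (simp add: along_def)
      thus ?thesis using arc_supersolution_superjet2 s ri v \<gamma> unfolding HJ_supersolution_def by blast
    qed
    \<comment> \<open>All time slopes of \<open>U\<close> are at least \<open>- \<Lambda>\<close>,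
      so on a time slice the Hamiltonian is at most \<Lambda> at every superjet and coercivity
      bounds the space slopes. The additional 1 below makes the inequality strict.\<close>
    define \<Lambda> where "\<Lambda> = 2 * k * (T - T0)"
    obtain L where L: "L \<ge> 0" "\<And>s p. s \<in> {0..1} \<Longrightarrow> H \<gamma> s p < \<Lambda> + 1 \<Longrightarrow> \<bar>p\<bar> \<le> L"
      using hamiltonian_coercive[OF ham \<gamma>] by metis
    have Ulip: "\<bar>U (\<gamma> s) t - U (\<gamma> s') t\<bar> \<le> L * \<bar>s - s'\<bar>"
      if s: "s \<in> {0..1}" "s' \<in> {0..1}" and t: "\<bar>t - t0\<bar> \<le> r0" for s s' t
    proof (rule superjet1_bounded_imp_lipschitz[OF _ _ s])
      have "continuous_on {0..1} ((\<lambda>(s, t). U (\<gamma> s) t) \<circ> (\<lambda>s. (s, t)))"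
        by (rule continuous_on_compose)
          (use t in \<open>auto intro!: continuous_intros continuous_on_subset[OF comp[OF Ucont boxsub]] simp: abs_le_iff\<close>)
      thus "continuous_on {0..1} (\<lambda>s. U (\<gamma> s) t)" by (simp add: o_def)
    next
      fix s p assume s: "0 < s" "s < 1" and jet: "superjet1 (\<lambda>s. U (\<gamma> s) t) s p"
      define r1 where "r1 = min (t - \<tau>0) (\<tau>1 - t)"
      have r1: "r1 > 0" "\<tau>0 \<le> t - r1" "t + r1 \<le> \<tau>1"
        using t r0 by (auto simp: r1_def abs_le_iff)
      have "- \<Lambda> + H \<gamma> s p \<le> 0"
      proof (rule superjet1_slice_subsolution[where w = "\<lambda>s t. U (\<gamma> s) t" and ?t0.0 = t and r = r1, OF _ hcont r1(1) s _ _ jet])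
        show "continuous_on ({0..1} \<times> {t - r1..t + r1}) (\<lambda>(s, t). U (\<gamma> s) t)"
          by (rule comp[OF Ucont]) (use r1 \<tau> in auto)
      next
        fix s t' p a assume A: "\<bar>t' - t\<bar> < r1" "0 < s" "s < 1" "superjet2 (\<lambda>s t. U (\<gamma> s) t) s t' p a"
        show "a + H \<gamma> s p \<le> 0" by (rule Usub[OF A(2,3) _ _ A(4)]) (use A(1) r1 in \<open>auto simp: abs_less_iff\<close>)
      next
        fix s t' a assume A: "\<bar>t' - t\<bar> < r1" "0 < s" "s < 1" "superjet1 (U (\<gamma> s)) t' a"
        have "t' \<in> {T0..T}" "\<gamma> s \<in> \<Gamma>" using A r1 \<tau> \<gamma>\<Gamma> by (auto simp: abs_less_iff)
        then obtain b where b: "\<bar>b\<bar> \<le> \<Lambda>" "\<And>t''. U (\<gamma> s) t' + b * (t'' - t') - k * (t'' - t')\<^sup>2 \<le> U (\<gamma> s) t''"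
          using suppU unfolding \<Lambda>_def by meson
        have "a = b" by (rule superjet1_support[OF A(4), of 1]) (use b in auto)
        thus "- \<Lambda> \<le> a" using b by (simp add: abs_le_iff)
      qed
      thus "\<bar>p\<bar> \<le> L" by (intro L(2)[of s]) (use s in auto)
    qed
    show False
    proof (rule no_touching_on_arc[OF r0(1) s0(1,2) C(1) L(1) d hcont comp[OF Ucont boxsub]])
      show "continuous_on ({0..1} \<times> {t0 - r0..t0 + r0}) (\<lambda>(s, t). - V (\<gamma> s) t)"
        using continuous_on_minus[OF comp[OF Vcont boxsub]] by (simp add: case_prod_unfold)
    next
      fix s t p a assume A: "0 < s" "s < 1" "\<bar>t - t0\<bar> < r0" "superjet2 (\<lambda>s t. U (\<gamma> s) t) s t p a"
      show "a + H \<gamma> s p \<le> 0" by (rule Usub[OF A(1,2) _ _ A(4)]) (use A(3) box[of t] in auto)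
    next
      fix s t p a assume A: "0 < s" "s < 1" "\<bar>t - t0\<bar> < r0"
        "superjet2 (\<lambda>s t. - (- V (\<gamma> s) t)) s t (- p) (- a)"
      show "0 \<le> a + H \<gamma> s p" by (rule Vsup[OF A(1,2)]) (use A(3,4) box[of t] in auto)
    next
      fix p a assume "s0 = 1" "end_subjet (\<lambda>s t. - V (\<gamma> s) t) t0 p a"
      thus "0 \<le> a + H \<gamma> 1 p" by (rule ends)
    next
      fix s t :: real assume "s \<in> {0..1}" "\<bar>t - t0\<bar> \<le> r0"
      then obtain b where b: "\<And>t'. U (\<gamma> s) t + b * (t' - t) - k * (t' - t)\<^sup>2 \<le> U (\<gamma> s) t'"
        using suppU[OF \<gamma>\<Gamma> box(1)] by meson
      have "U (\<gamma> s) t + b * (t' - t) - C * (t' - t)\<^sup>2 \<le> U (\<gamma> s) t'" for t'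
        using b[of t'] mult_right_mono[OF C(2), of "(t' - t)\<^sup>2"] by simp
      thus "\<exists>b. \<forall>t'. \<bar>t' - t0\<bar> \<le> r0 \<longrightarrow> U (\<gamma> s) t + b * (t' - t) - C * (t' - t)\<^sup>2 \<le> U (\<gamma> s) t'" by blast
    next
      fix s t :: real assume "s \<in> {0..1}" "\<bar>t - t0\<bar> \<le> r0"
      then obtain b where b: "\<And>t'. V (\<gamma> s) t + b * (t' - t) - k * (t' - t)\<^sup>2 \<le> V (\<gamma> s) t'"
        using suppV[OF \<gamma>\<Gamma> box(1)] by meson
      have "- V (\<gamma> s) t' \<le> - V (\<gamma> s) t + (- b) * (t' - t) + C * (t' - t)\<^sup>2" for t'
        using b[of t'] mult_right_mono[OF C(2), of "(t' - t)\<^sup>2"] by simp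
      thus "\<exists>b. \<forall>t'. \<bar>t' - t0\<bar> \<le> r0 \<longrightarrow> - V (\<gamma> s) t' \<le> - V (\<gamma> s) t + b * (t' - t) + C * (t' - t)\<^sup>2" by blast
    next
      fix s s' t :: real assume "s \<in> {0..1}" "s' \<in> {0..1}" "\<bar>t - t0\<bar> \<le> r0"
      thus "\<bar>U (\<gamma> s) t - U (\<gamma> s') t\<bar> \<le> L * \<bar>s - s'\<bar>" by (rule Ulip)
    next
      fix s t :: real assume "s \<in> {0..1}" "\<bar>t - t0\<bar> \<le> r0"
      thus "U (\<gamma> s) t - - V (\<gamma> s) t \<le> U (\<gamma> s0) t0 - - V (\<gamma> s0) t0 + d * (t - t0) + C * (t - t0)\<^sup>2"
        using touch0[OF \<gamma>\<Gamma>] s0(3) by simp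
    qed
  qed
  show False
  proof (cases "y0 \<in> vertices E")
    case False
    obtain \<gamma> s where \<gamma>: "\<gamma> \<in> E" "s \<in> {0..1}" "y0 = \<gamma> s"
      using y0 by (auto simp: \<Gamma>_def support_def path_image_def)
    have "s \<noteq> 0" "s \<noteq> 1" using False \<gamma> by (auto simp: vertices_def pathstart_def pathfinish_def)
    thus False using core[of \<gamma> s] \<gamma> by auto
  next
    case True
    have t0T: "t0 \<in> {T0..T}" using t0 \<tau> by auto
    obtain bu where bu: "\<And>t. U y0 t0 + bu * (t - t0) - k * (t - t0)\<^sup>2 \<le> U y0 t"
      using suppU[OF y0 t0T] by blast
    obtain bv where bv: "\<And>t. V y0 t0 + bv * (t - t0) - k * (t - t0)\<^sup>2 \<le> V y0 t"
      using suppV[OF y0 t0T] by blast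
    have bubv: "bu + bv = d"
    proof (rule slope_unique[OF r0(1)])
      fix x assume "\<bar>x\<bar> < r0"
      thus "(bu + bv) * x \<le> d * x + (C + 2 * k) * x\<^sup>2"
        using touch0[OF y0, of "t0 + x"] bu[of "t0 + x"] bv[of "t0 + x"] by (simp add: algebra_simps)
    qed
    have "superjet1 (U y0) t0 bu"
      unfolding superjet1_def
    proof (intro exI conjI allI impI)
      fix t assume "\<bar>t - t0\<bar> < r0"
      thus "U y0 t \<le> U y0 t0 + bu * (t - t0) + (C + k) * (t - t0)\<^sup>2"
        using touch0[OF y0, of t] bv[of t] bubv[symmetric] by (simp add: algebra_simps)
    qed (use r0 in simp)
    moreover obtain r where r: "\<bar>r - t0\<bar> < \<rho>" "U y0 t0 = u (y0, r) - k * (t0 - r)\<^sup>2"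
      using argU[OF y0 t0T] by blast
    note ri = int[OF r(1) less_imp_le[OF t0(1)] less_imp_le[OF t0(2)]]
    ultimately have "superjet1 (\<lambda>t. u (y0, t)) r bu"
      using superjet1_sup_conv[OF ucont T0T' y0 ri(2,3)] r(2) unfolding U_def by blast
    hence "bu \<le> c y0" by (rule HJ_subsolution_vertex_superjet1[OF u True ri(1)])
    \<comment> \<open>\<open>- bv\<close> is the time slope of the regularised supersolution. The
      surplus \<open>d\<close> turns the weak bound on \<open>bu\<close> into the strict inequality
      that activates the vertex condition.\<close>
    hence bvc: "- bv < c y0" using bubv d by simp
    have "superjet1 (V y0) t0 bv"
      unfolding superjet1_def
    proof (intro exI conjI allI impI)
      fix t assume "\<bar>t - t0\<bar> < r0"
      thus "V y0 t \<le> V y0 t0 + bv * (t - t0) + (C + k) * (t - t0)\<^sup>2"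
        using touch0[OF y0, of t] bu[of t] bubv[symmetric] by (simp add: algebra_simps)
    qed (use r0 in simp)
    moreover obtain r' where r': "\<bar>r' - t0\<bar> < \<rho>" "V y0 t0 = - v (y0, r') - k * (t0 - r')\<^sup>2"
      using argV[OF y0 t0T] by blast
    note ri' = int[OF r'(1) less_imp_le[OF t0(1)] less_imp_le[OF t0(2)]]
    ultimately have "superjet1 (\<lambda>t. - v (y0, t)) r' (- (- bv))"
      using superjet1_sup_conv[OF mvcont T0T' y0 ri'(2,3)] r'(2) unfolding V_def by simp
    then obtain \<gamma> where \<gamma>: "\<gamma> \<in> arcs_into E y0"
      "\<And>p a. end_subjet (\<lambda>s t. v (\<gamma> s, t)) r' p a \<Longrightarrow> 0 \<le> a + H \<gamma> 1 p"
      using HJ_supersolution_vertex_superjet1[OF v True ri'(1) _ bvc] by metis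
    have \<gamma>E: "\<gamma> \<in> E" "\<gamma> 1 = y0" using \<gamma>(1) by (auto simp: arcs_into_def pathfinish_def)
    have \<gamma>\<Gamma>: "\<gamma> s \<in> \<Gamma>" if "s \<in> {0..1}" for s
      using network_arc(2)[OF net \<gamma>E(1) that] by (simp add: \<Gamma>_def)
    show False
    proof (rule core[OF \<gamma>E(1) _ _ \<gamma>E(2)])
      fix p a assume "end_subjet (\<lambda>s t. - V (\<gamma> s) t) t0 p a"
      hence "end_subjet (\<lambda>s t. v (\<gamma> s, t)) r' p a"
        using end_subjet_inf_conv[OF mvcont T0T' \<gamma>\<Gamma> ri'(2,3)] r'(2) \<gamma>E(2) unfolding V_def by simp
      thus "0 \<le> a + H \<gamma> 1 p" by (rule \<gamma>(2))
    qed auto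
  qed
qed

subsection \<open>Stability under uniform limits\<close>

lemma C1_near_norm_square:
  fixes z0 :: "'e::real_inner"
  shows "C1_near (\<lambda>z. b * (norm (z - z0))\<^sup>2) z"
proof (rule C1_nearI_gradient[OF open_UNIV UNIV_I])
  show "continuous_on UNIV (\<lambda>z. (2 * b) *\<^sub>R (z - z0))" by (intro continuous_intros)
  show "((\<lambda>z. b * (norm (z - z0))\<^sup>2) has_derivative (\<lambda>h. ((2 * b) *\<^sub>R (w - z0)) \<bullet> h)) (at w)" for w
    unfolding power2_norm_eq_inner
    by (auto intro!: derivative_eq_intros simp: algebra_simps inner_commute)
qed

lemma norm_square_has_derivative:
  fixes z0 :: "'e::real_inner"
  shows "((\<lambda>z. (norm (z - z0))\<^sup>2) has_derivative (\<lambda>h. 2 * ((z - z0) \<bullet> h))) (at z)"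
  unfolding power2_norm_eq_inner
  by (auto intro!: derivative_eq_intros simp: algebra_simps inner_commute)

text \<open>The added square makes the maximum strict: on the sphere of radius \<open>r\<close> it
  costs \<open>r^2\<close>, while the uniform error contributes less than half of that. The
  approximating functions therefore attain their maximum inside the ball. The gradient of the square
  vanishes at \<open>z0\<close>, so the extra term disappears from the equation in the
  limit.\<close>

lemma supertangent_stable:
  fixes w :: "'e::euclidean_space \<Rightarrow> real"
  assumes V: "open V" "z0 \<in> V" and cont: "\<And>n. continuous_on V (wn n)"
    and lim: "uniform_limit V wn w sequentially"
    and tan: "supertangent w z0 \<phi>" and e: "e > 0"
  obtains n z where "z \<in> V" "dist z z0 < e" "supertangent (wn n) z (\<lambda>z. \<phi> z + (norm (z - z0))\<^sup>2)"
proof -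
  obtain U D where U: "open U" "z0 \<in> U" "continuous_on U D"
    "\<And>w. w \<in> U \<Longrightarrow> (\<phi> has_derivative blinfun_apply (D w)) (at w)"
    using tan unfolding constrained_supertangent_def C1_near_def by blast
  obtain d where d: "d > 0" "\<And>z. dist z z0 < d \<Longrightarrow> w z - \<phi> z \<le> w z0 - \<phi> z0"
    using tan unfolding constrained_supertangent_def eventually_at by (metis UNIV_I order_refl)
  obtain r' where r': "r' > 0" "cball z0 r' \<subseteq> U \<inter> V"
    using open_contains_cball[of "U \<inter> V"] U V by blast
  define r where "r = min (min r' (d / 2)) (e / 2)"
  have r: "r > 0" "r \<le> r'" "r < d" "r < e" using r' d e by (auto simp: r_def)
  have sub: "cball z0 r \<subseteq> U" "cball z0 r \<subseteq> V" using r' r by (auto simp: subset_eq)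
  have "\<forall>\<^sub>F n in sequentially. \<forall>z\<in>V. dist (wn n z) (w z) < r\<^sup>2 / 4"
    using uniform_limitD[OF lim, of "r\<^sup>2 / 4"] r by simp
  then obtain n where n: "\<And>z. z \<in> V \<Longrightarrow> \<bar>wn n z - w z\<bar> < r\<^sup>2 / 4"
    unfolding eventually_sequentially dist_real_def by blast
  let ?F = "\<lambda>z. wn n z - \<phi> z - (norm (z - z0))\<^sup>2"
  have "continuous_on U \<phi>"
    by (rule has_derivative_continuous_on[where f' = "\<lambda>w. blinfun_apply (D w)"])
      (rule has_derivative_at_withinI[OF U(4)])
  hence "continuous_on (cball z0 r) ?F"
    using continuous_on_subset[OF cont sub(2)] continuous_on_subset[OF _ sub(1)] by (intro continuous_intros) auto
  then obtain z where z: "z \<in> cball z0 r" "\<And>z'. z' \<in> cball z0 r \<Longrightarrow> ?F z' \<le> ?F z"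
    using continuous_attains_sup[of "cball z0 r" ?F] r by auto
  have zV: "z \<in> V" and zU: "z \<in> U" using sub z by auto
  have "wn n z0 - \<phi> z0 \<le> ?F z" using z(2)[of z0] r by simp
  moreover have "w z - \<phi> z \<le> w z0 - \<phi> z0" using z(1) r by (intro d) (auto simp: dist_commute)
  moreover have "r\<^sup>2 > 0" using r by simp
  ultimately have "(norm (z - z0))\<^sup>2 < r\<^sup>2" using n[OF zV] n[OF V(2)] by linarith
  hence near: "dist z z0 < r" using r by (simp add: dist_norm power2_less_imp_less)
  show ?thesis
  proof (rule that[OF zV])
    show "dist z z0 < e" using near r by simp
    have "C1_near \<phi> z" unfolding C1_near_def using U zU by blast
    moreover have "C1_near (\<lambda>z. 1 * (norm (z - z0))\<^sup>2) z" by (rule C1_near_norm_square)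
    ultimately have "C1_near (\<lambda>z. \<phi> z + (norm (z - z0))\<^sup>2) z"
      using C1_near_add[of \<phi> z "\<lambda>z. 1 * (norm (z - z0))\<^sup>2"] by simp
    moreover have "\<forall>\<^sub>F y in at z. wn n y - (\<phi> y + (norm (y - z0))\<^sup>2) \<le> wn n z - (\<phi> z + (norm (z - z0))\<^sup>2)"
      unfolding eventually_at
    proof (intro exI conjI ballI impI)
      show "r - dist z z0 > 0" using near by simp
      fix y assume "y \<noteq> z \<and> dist y z < r - dist z z0"
      hence "dist z0 y \<le> r" using dist_triangle[of y z0 z] by (simp add: dist_commute)
      thus "wn n y - (\<phi> y + (norm (y - z0))\<^sup>2) \<le> wn n z - (\<phi> z + (norm (z - z0))\<^sup>2)"
        using z(2)[of y] by (simp add: algebra_simps)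
    qed
    ultimately show "supertangent (wn n) z (\<lambda>z. \<phi> z + (norm (z - z0))\<^sup>2)"
      unfolding constrained_supertangent_def by simp
  qed
qed

lemma arc_subsolution_uniform_limit:
  assumes sub: "\<And>n. arc_subsolution h T0 T1 (wn n)"
    and hcont: "continuous_on ({0..1} \<times> UNIV) (\<lambda>(s, p). h s p)"
    and cont: "\<And>n. continuous_on ({0<..<1} \<times> einterval T0 T1) (wn n)"
    and lim: "uniform_limit ({0<..<1} \<times> einterval T0 T1) wn w sequentially"
  shows "arc_subsolution h T0 T1 w"
  unfolding arc_subsolution_def
proof (intro ballI allI impI)
  fix s t \<phi> assume s: "s \<in> {0<..<1}" and t: "t \<in> einterval T0 T1" and tan: "supertangent w (s, t) \<phi>"
  let ?V = "{0<..<1::real} \<times> einterval T0 T1"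
  have V: "open ?V" "(s, t) \<in> ?V" using s t by (auto intro!: open_Times)
  obtain U D where U: "open U" "(s, t) \<in> U" "continuous_on U D"
    "\<And>w. w \<in> U \<Longrightarrow> (\<phi> has_derivative blinfun_apply (D w)) (at w)"
    using tan unfolding constrained_supertangent_def C1_near_def by blast
  define F where "F = (\<lambda>z. (D z (0, 1) + 2 * (snd z - t)) + h (fst z) (D z (1, 0) + 2 * (fst z - s)))"
  have Dc: "continuous_on (?V \<inter> U) (\<lambda>z. D z v)" for v
    using continuous_on_subset[OF U(3), of "?V \<inter> U"] by (intro continuous_intros) auto
  have "continuous_on (?V \<inter> U) ((\<lambda>(s, p). h s p) \<circ> (\<lambda>z. (fst z, D z (1, 0) + 2 * (fst z - s))))"
  proof (rule continuous_on_compose)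
    show "continuous_on (?V \<inter> U) (\<lambda>z. (fst z, D z (1, 0) + 2 * (fst z - s)))"
      by (intro continuous_intros Dc)
    show "continuous_on ((\<lambda>z. (fst z, D z (1, 0) + 2 * (fst z - s))) ` (?V \<inter> U)) (\<lambda>(s, p). h s p)"
      by (rule continuous_on_subset[OF hcont]) auto
  qed
  hence hc: "continuous_on (?V \<inter> U) (\<lambda>z. h (fst z) (D z (1, 0) + 2 * (fst z - s)))" by (simp add: o_def)
  have Fcont: "continuous_on (?V \<inter> U) F"
    unfolding F_def by (intro continuous_intros Dc hc)
  have stVU: "(s, t) \<in> ?V \<inter> U" using V U by auto
  have "F (s, t) \<le> 0"
  proof (rule ccontr)
    assume "\<not> ?thesis"
    hence pos: "F (s, t) > 0" by simp
    obtain d where d: "d > 0" "\<And>z. z \<in> ?V \<inter> U \<Longrightarrow> dist z (s, t) < d \<Longrightarrow> dist (F z) (F (s, t)) < F (s, t)"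
      using Fcont stVU pos unfolding continuous_on_iff by metis
    obtain d' where d': "d' > 0" "ball (s, t) d' \<subseteq> U" using U open_contains_ball by blast
    obtain n z where z: "z \<in> ?V" "dist z (s, t) < min d d'"
      "supertangent (wn n) z (\<lambda>z. \<phi> z + (norm (z - (s, t)))\<^sup>2)"
      by (rule supertangent_stable[OF V cont lim tan, of "min d d'"]) (use d d' in auto)
    have zU: "z \<in> U" using z(2) d' by (auto simp: dist_commute subset_eq)
    obtain s1 t1 where z_eq: "z = (s1, t1)" by fastforce
    have der: "((\<lambda>z. \<phi> z + (norm (z - (s, t)))\<^sup>2) has_derivative (\<lambda>h. D z h + 2 * ((z - (s, t)) \<bullet> h))) (at z)"
      by (rule has_derivative_add[OF U(4)[OF zU] norm_square_has_derivative])
    have "time_deriv (\<lambda>z. \<phi> z + (norm (z - (s, t)))\<^sup>2) s1 t1 + h s1 (space_deriv (\<lambda>z. \<phi> z + (norm (z - (s, t)))\<^sup>2) s1 t1) \<le> 0"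
      using sub[of n] z(1,3) unfolding arc_subsolution_def by (auto simp: z_eq)
    hence "F z \<le> 0"
      using space_deriv_eq[OF der[unfolded z_eq]] time_deriv_eq[OF der[unfolded z_eq]]
      by (simp add: F_def z_eq inner_prod_def)
    moreover have "dist (F z) (F (s, t)) < F (s, t)" by (rule d(2)) (use z zU in auto)
    ultimately show False by (simp add: dist_real_def)
  qed
  thus "time_deriv \<phi> s t + h s (space_deriv \<phi> s t) \<le> 0"
    using space_deriv_eq[OF U(4)[OF U(2)]] time_deriv_eq[OF U(4)[OF U(2)]] by (simp add: F_def)
qed

text \<open>Reduces the stability of supersolutions to that of subsolutions. The latter is stated
  for a merely continuous \<open>h\<close> because reflecting a convex Hamiltonian produces a
  concave one.\<close>

lemma arc_supersolution_iff:
  "arc_supersolution h T0 T1 w \<longleftrightarrow> arc_subsolution (\<lambda>s p. - h s (- p)) T0 T1 (\<lambda>z. - w z)"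
proof -
  have tan: "subtangent w z \<phi> \<longleftrightarrow> supertangent (\<lambda>z. - w z) z (\<lambda>z. - \<phi> z)" for z and \<phi> :: "real \<times> real \<Rightarrow> real"
    using C1_near_minus[of \<phi> z] C1_near_minus[of "\<lambda>z. - \<phi> z" z]
    unfolding constrained_subtangent_def constrained_supertangent_def
    by (auto simp: algebra_simps)
  have der: "space_deriv (\<lambda>z. - \<phi> z) s t = - space_deriv \<phi> s t" "time_deriv (\<lambda>z. - \<phi> z) s t = - time_deriv \<phi> s t"
    if C1: "C1_near \<phi> (s, t)" for \<phi> s t
  proof -
    obtain D where D: "(\<phi> has_derivative D) (at (s, t))" using C1 unfolding C1_near_def by blast
    show "space_deriv (\<lambda>z. - \<phi> z) s t = - space_deriv \<phi> s t" "time_deriv (\<lambda>z. - \<phi> z) s t = - time_deriv \<phi> s t"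
      using space_deriv_eq[OF D] space_deriv_eq[OF has_derivative_minus[OF D]]
        time_deriv_eq[OF D] time_deriv_eq[OF has_derivative_minus[OF D]] by simp_all
  qed
  show ?thesis
  proof
    assume L: "arc_supersolution h T0 T1 w"
    show "arc_subsolution (\<lambda>s p. - h s (- p)) T0 T1 (\<lambda>z. - w z)"
      unfolding arc_subsolution_def
    proof (intro ballI allI impI)
      fix s t \<phi> assume st: "s \<in> {0<..<1}" "t \<in> einterval T0 T1" and \<phi>: "supertangent (\<lambda>z. - w z) (s, t) \<phi>"
      have "subtangent w (s, t) (\<lambda>z. - \<phi> z)" using tan[of "(s, t)" "\<lambda>z. - \<phi> z"] \<phi> by simp
      moreover have "C1_near \<phi> (s, t)" using \<phi> by (simp add: constrained_supertangent_def)
      ultimately show "time_deriv \<phi> s t + - h s (- space_deriv \<phi> s t) \<le> 0"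
        using L st der[of \<phi> s t] unfolding arc_supersolution_def by fastforce
    qed
  next
    assume R: "arc_subsolution (\<lambda>s p. - h s (- p)) T0 T1 (\<lambda>z. - w z)"
    show "arc_supersolution h T0 T1 w"
      unfolding arc_supersolution_def
    proof (intro ballI allI impI)
      fix s t \<phi> assume st: "s \<in> {0<..<1}" "t \<in> einterval T0 T1" and \<phi>: "subtangent w (s, t) \<phi>"
      have "C1_near \<phi> (s, t)" using \<phi> by (simp add: constrained_subtangent_def)
      thus "0 \<le> time_deriv \<phi> s t + h s (space_deriv \<phi> s t)"
        using R st der[of \<phi> s t] \<phi>[unfolded tan] unfolding arc_subsolution_def by fastforce
    qed
  qed
qed

lemma arc_supersolution_uniform_limit:
  assumes sub: "\<And>n. arc_supersolution h T0 T1 (wn n)"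
    and hcont: "continuous_on ({0..1} \<times> UNIV) (\<lambda>(s, p). h s p)"
    and cont: "\<And>n. continuous_on ({0<..<1} \<times> einterval T0 T1) (wn n)"
    and lim: "uniform_limit ({0<..<1} \<times> einterval T0 T1) wn w sequentially"
  shows "arc_supersolution h T0 T1 w"
  unfolding arc_supersolution_iff
proof (rule arc_subsolution_uniform_limit)
  show "arc_subsolution (\<lambda>s p. - h s (- p)) T0 T1 (\<lambda>z. - wn n z)" for n
    using sub unfolding arc_supersolution_iff .
  show "continuous_on ({0..1} \<times> UNIV) (\<lambda>(s, p). - h s (- p))"
    by (rule continuous_on_reflect_snd[OF hcont])
  show "continuous_on ({0<..<1} \<times> einterval T0 T1) (\<lambda>z. - wn n z)" for n by (intro continuous_intros cont)
  show "uniform_limit ({0<..<1} \<times> einterval T0 T1) (\<lambda>n z. - wn n z) (\<lambda>z. - w z) sequentially"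
    by (intro uniform_limit_intros lim)
qed

lemma supertangent_slope_uniform_limit:
  fixes w :: "real \<Rightarrow> real"
  assumes sub: "\<And>n t \<psi>. t \<in> V \<Longrightarrow> supertangent (wn n) t \<psi> \<Longrightarrow> deriv \<psi> t \<le> c"
    and V: "open V" and cont: "\<And>n. continuous_on V (wn n)"
    and lim: "uniform_limit V wn w sequentially"
    and t: "t \<in> V" and tan: "supertangent w t \<psi>"
  shows "deriv \<psi> t \<le> c"
proof -
  obtain U D where U: "open U" "t \<in> U" "continuous_on U D"
    "\<And>w. w \<in> U \<Longrightarrow> (\<psi> has_derivative blinfun_apply (D w)) (at w)"
    using tan unfolding constrained_supertangent_def C1_near_def by blast
  have dU: "(\<psi> has_real_derivative blinfun_apply (D w) 1) (at w)" if "w \<in> U" for w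
    by (rule has_derivative_imp_DERIV[OF U(4)[OF that]])
  define F where "F = (\<lambda>z. D z 1 + 2 * (z - t))"
  have Fcont: "continuous_on (V \<inter> U) F"
    unfolding F_def using continuous_on_subset[OF U(3), of "V \<inter> U"] by (intro continuous_intros) auto
  have "F t \<le> c"
  proof (rule ccontr)
    assume "\<not> ?thesis"
    hence pos: "F t - c > 0" by simp
    obtain d where d: "d > 0" "\<And>z. z \<in> V \<inter> U \<Longrightarrow> dist z t < d \<Longrightarrow> dist (F z) (F t) < F t - c"
      using Fcont pos t U(2) unfolding continuous_on_iff by (metis IntI)
    obtain d' where d': "d' > 0" "ball t d' \<subseteq> U" using U open_contains_ball by blast
    obtain n z where z: "z \<in> V" "dist z t < min d d'"
      "supertangent (wn n) z (\<lambda>z. \<psi> z + (norm (z - t))\<^sup>2)"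
      by (rule supertangent_stable[OF V t cont lim tan, of "min d d'"]) (use d d' in auto)
    have zU: "z \<in> U" using z(2) d' by (auto simp: dist_commute subset_eq)
    have "((\<lambda>z. \<psi> z + (norm (z - t))\<^sup>2) has_real_derivative F z) (at z)"
      unfolding F_def real_norm_def power2_abs
      by (auto intro!: derivative_eq_intros dU[OF zU])
    hence "F z \<le> c" using sub[OF z(1,3)] by (simp add: DERIV_imp_deriv)
    moreover have "dist (F z) (F t) < F t - c" by (rule d(2)) (use z zU in auto)
    ultimately show False by (simp add: dist_real_def)
  qed
  thus ?thesis using DERIV_imp_deriv[OF dU[OF U(2)]] by (simp add: F_def)
qed

section \<open>The smoothed minimum of affine functions (log-sum-exp with Gibbs weights)\<close>

definition soft_weight ::
    "real \<Rightarrow> 'j set \<Rightarrow> ('j \<Rightarrow> real) \<Rightarrow> ('j \<Rightarrow> real) \<Rightarrow> real \<Rightarrow> real \<times> real \<Rightarrow> 'j \<Rightarrow> real" where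
  "soft_weight k J A P t0 z j = exp (- k * (A j * (snd z - t0) + P j * (fst z - 1))) /
     (\<Sum>i\<in>J. exp (- k * (A i * (snd z - t0) + P i * (fst z - 1))))"

text \<open>A smooth lower approximation of the minimum of finitely many affine functions; its gradient is
  a convex combination of theirs, with the weights \<^const>\<open>soft_weight\<close>.\<close>

definition soft_min ::
    "real \<Rightarrow> 'j set \<Rightarrow> ('j \<Rightarrow> real) \<Rightarrow> ('j \<Rightarrow> real) \<Rightarrow> real \<Rightarrow> real \<times> real \<Rightarrow> real" where
  "soft_min k J A P t0 z =
     - (1 / k) * ln (\<Sum>j\<in>J. exp (- k * (A j * (snd z - t0) + P j * (fst z - 1))))"

context
  fixes k :: real and J :: "'j set"
  assumes k: "k > 0" and J: "finite J" "J \<noteq> {}"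
begin

lemma soft_sum_pos: "0 < (\<Sum>j\<in>J. exp (f j :: real))"
  using J by (intro sum_pos) auto

lemma soft_weight_nonneg: "0 \<le> soft_weight k J A P t0 z j"
  unfolding soft_weight_def using soft_sum_pos by (intro divide_nonneg_pos) auto

lemma sum_soft_weight: "(\<Sum>j\<in>J. soft_weight k J A P t0 z j) = 1"
  unfolding soft_weight_def sum_divide_distrib[symmetric]
  by (rule divide_self) (use soft_sum_pos less_irrefl in metis)

text \<open>An index whose affine function exceeds the smoothed minimum by at most
  \<open>C / k\<close> has weight at least \<open>exp (- C)\<close>, whatever \<open>k\<close> is.
  This is how the weights are bounded below.\<close>

lemma soft_weight_eq:
  "soft_weight k J A P t0 z j = exp (- (k * (A j * (snd z - t0) + P j * (fst z - 1) - soft_min k J A P t0 z)))"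
proof -
  define S where "S = (\<Sum>j\<in>J. exp (- k * (A j * (snd z - t0) + P j * (fst z - 1))))"
  have S: "S > 0" unfolding S_def by (rule soft_sum_pos)
  have "- (k * (A j * (snd z - t0) + P j * (fst z - 1) - soft_min k J A P t0 z))
      = - k * (A j * (snd z - t0) + P j * (fst z - 1)) - ln S"
    using k unfolding soft_min_def S_def[symmetric] by (simp add: algebra_simps)
  thus ?thesis unfolding soft_weight_def S_def[symmetric] using S by (simp add: exp_diff)
qed

lemma soft_min_le:
  assumes "j \<in> J"
  shows "soft_min k J A P t0 z \<le> A j * (snd z - t0) + P j * (fst z - 1)"
proof -
  have "soft_weight k J A P t0 z j \<le> 1"
    unfolding sum_soft_weight[of A P t0 z, symmetric]
    by (rule member_le_sum[OF assms _ J(1)]) (rule soft_weight_nonneg)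
  thus ?thesis unfolding soft_weight_eq using k by (simp add: zero_le_mult_iff)
qed

text \<open>All the affine functions vanish at the base point, so the exact value is
  \<open>- ln (card J) / k\<close>; the cruder bound is enough.\<close>

lemma soft_min_base: "soft_min k J A P t0 (1, t0) \<ge> - (real (card J) / k)"
proof -
  have "card J > 0" using J by (simp add: card_gt_0_iff)
  hence "ln (real (card J)) \<le> real (card J)" using ln_le_minus_one[of "real (card J)"] by simp
  thus ?thesis unfolding soft_min_def using k by (simp add: field_simps)
qed

lemma soft_min_has_derivative:
  "(soft_min k J A P t0 has_derivative
     (\<lambda>h. (\<Sum>j\<in>J. soft_weight k J A P t0 z j * P j, \<Sum>j\<in>J. soft_weight k J A P t0 z j * A j) \<bullet> h)) (at z)"
proof -
  define e where "e = (\<lambda>z j. exp (- k * (A j * (snd z - t0) + P j * (fst z - 1))))"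
  define S where "S = (\<lambda>z. \<Sum>j\<in>J. e z j)"
  have S: "S z > 0" unfolding S_def e_def by (rule soft_sum_pos)
  have "((\<lambda>z. e z j) has_derivative (\<lambda>h. e z j * (- k * (A j * snd h + P j * fst h)))) (at z)" for j
    unfolding e_def by (auto intro!: derivative_eq_intros simp: algebra_simps)
  hence "(S has_derivative (\<lambda>h. \<Sum>j\<in>J. e z j * (- k * (A j * snd h + P j * fst h)))) (at z)"
    unfolding S_def by (intro has_derivative_sum)
  from has_derivative_mult_right[OF has_derivative_ln[OF S this], of "- (1 / k)"]
  have "((\<lambda>z. - (1 / k) * ln (S z)) has_derivative
      (\<lambda>h. - (1 / k) * ((\<Sum>j\<in>J. e z j * (- k * (A j * snd h + P j * fst h))) * inverse (S z)))) (at z)" .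
  moreover have w: "soft_weight k J A P t0 z j = e z j / S z" for j
    by (simp add: soft_weight_def e_def S_def)
  have "- (1 / k) * ((\<Sum>j\<in>J. e z j * (- k * (A j * snd h + P j * fst h))) * inverse (S z))
     = (\<Sum>j\<in>J. soft_weight k J A P t0 z j * P j, \<Sum>j\<in>J. soft_weight k J A P t0 z j * A j) \<bullet> h" for h
  proof -
    have "- (1 / k) * ((\<Sum>j\<in>J. e z j * (- k * (A j * snd h + P j * fst h))) * inverse (S z))
       = (\<Sum>j\<in>J. - (1 / k) * (e z j * (- k * (A j * snd h + P j * fst h)) * inverse (S z)))"
      by (simp only: sum_distrib_left sum_distrib_right)
    also have "\<dots> = (\<Sum>j\<in>J. soft_weight k J A P t0 z j * P j * fst h + soft_weight k J A P t0 z j * A j * snd h)"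
      using k S by (intro sum.cong) (auto simp: w field_simps)
    finally show ?thesis by (simp add: inner_prod_def sum.distrib sum_distrib_right)
  qed
  ultimately show ?thesis
    unfolding soft_min_def[abs_def] S_def e_def by simp
qed

lemma continuous_on_soft_weight: "continuous_on UNIV (\<lambda>z. soft_weight k J A P t0 z j)"
  unfolding soft_weight_def
  by (intro continuous_intros) (use soft_sum_pos less_irrefl in metis)

end

section \<open>The supersolution condition at a vertex under uniform limits\<close>

text \<open>Reduces a test function to its two slopes at the price of a first-order error with a
  small constant. The test functions given on the various arcs are unrelated, and only their slopes
  can be combined.\<close>

lemma constrained_subtangent_expansion:
  assumes tan: "constrained_subtangent ({0..1} \<times> closure I) w (1, t0) \<phi>"
    and I: "open I" "t0 \<in> I" and \<epsilon>: "\<epsilon> > 0"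
  shows "\<exists>\<rho>>0. \<forall>s t. s \<in> {0..1} \<longrightarrow> norm ((s, t) - (1, t0)) < \<rho> \<longrightarrow>
    w (1, t0) + time_deriv \<phi> 1 t0 * (t - t0) + space_deriv \<phi> 1 t0 * (s - 1)
      - \<epsilon> * norm ((s, t) - (1, t0)) \<le> w (s, t)"
proof -
  obtain D where D: "(\<phi> has_derivative D) (at (1, t0))"
    using tan unfolding constrained_subtangent_def C1_near_def by blast
  obtain d1 where d1: "d1 > 0" "\<And>z. z \<in> {0..1} \<times> closure I \<Longrightarrow> dist z (1, t0) < d1 \<Longrightarrow>
      w (1, t0) - \<phi> (1, t0) \<le> w z - \<phi> z"
    using tan unfolding constrained_subtangent_def eventually_at by (metis order_refl)
  obtain d2 where d2: "d2 > 0" "\<And>z. norm (z - (1, t0)) < d2 \<Longrightarrow>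
      norm (\<phi> z - \<phi> (1, t0) - D (z - (1, t0))) \<le> \<epsilon> * norm (z - (1, t0))"
    using D \<epsilon> unfolding has_derivative_at_alt by blast
  obtain d3 where d3: "d3 > 0" "ball t0 d3 \<subseteq> I" using I open_contains_ball by blast
  show ?thesis
  proof (intro exI conjI allI impI)
    show "min d1 (min d2 d3) > 0" using d1 d2 d3 by simp
    fix s t :: real assume s: "s \<in> {0..1}" and near: "norm ((s, t) - (1, t0)) < min d1 (min d2 d3)"
    have "\<bar>t - t0\<bar> < d3" using near norm_snd_le[of "t - t0" "s - 1"] by simp
    hence "t \<in> closure I" using d3 closure_subset[of I] by (auto simp: subset_eq dist_real_def abs_minus_commute)
    hence 1: "w (1, t0) - \<phi> (1, t0) \<le> w (s, t) - \<phi> (s, t)"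
      using s near by (intro d1) (auto simp: dist_norm)
    have lin: "linear D" by (rule has_derivative_linear[OF D])
    have "(s, t) - (1, t0) = (s - 1) *\<^sub>R (1, 0) + (t - t0) *\<^sub>R (0, 1)" by simp
    hence "D ((s, t) - (1, t0)) = (s - 1) * D (1, 0) + (t - t0) * D (0, 1)"
      by (simp only: linear_add[OF lin] linear_scale[OF lin] real_scaleR_def)
    moreover have "\<bar>\<phi> (s, t) - \<phi> (1, t0) - D ((s, t) - (1, t0))\<bar> \<le> \<epsilon> * norm ((s, t) - (1, t0))"
      using d2(2)[of "(s, t)"] near by simp
    ultimately show "w (1, t0) + time_deriv \<phi> 1 t0 * (t - t0) + space_deriv \<phi> 1 t0 * (s - 1)
      - \<epsilon> * norm ((s, t) - (1, t0)) \<le> w (s, t)"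
      using 1 space_deriv_eq[OF D] time_deriv_eq[OF D] by (simp add: abs_le_iff algebra_simps)
  qed
qed

lemma subtangent_expansion:
  fixes f :: "real \<Rightarrow> real"
  assumes tan: "subtangent f t0 \<phi>" and \<epsilon>: "\<epsilon> > 0"
  shows "\<exists>\<rho>>0. \<forall>t. \<bar>t - t0\<bar> < \<rho> \<longrightarrow> f t0 + deriv \<phi> t0 * (t - t0) - \<epsilon> * \<bar>t - t0\<bar> \<le> f t"
proof -
  obtain D where D: "(\<phi> has_derivative D) (at t0)"
    using tan unfolding constrained_subtangent_def C1_near_def by blast
  obtain d1 where d1: "d1 > 0" "\<And>t. dist t t0 < d1 \<Longrightarrow> f t0 - \<phi> t0 \<le> f t - \<phi> t"
    using tan unfolding constrained_subtangent_def eventually_at by (metis UNIV_I order_refl)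
  obtain d2 where d2: "d2 > 0" "\<And>t. norm (t - t0) < d2 \<Longrightarrow>
      norm (\<phi> t - \<phi> t0 - D (t - t0)) \<le> \<epsilon> * norm (t - t0)"
    using D \<epsilon> unfolding has_derivative_at_alt by blast
  have "deriv \<phi> t0 = D 1" by (rule DERIV_imp_deriv[OF has_derivative_imp_DERIV[OF D]])
  hence Dh: "D h = deriv \<phi> t0 * h" for h
    using linear_scale[OF has_derivative_linear[OF D], of h 1] by (metis mult.commute mult.right_neutral real_scaleR_def)
  show ?thesis
  proof (intro exI conjI allI impI)
    show "min d1 d2 > 0" using d1 d2 by simp
    fix t assume "\<bar>t - t0\<bar> < min d1 d2"
    hence "f t0 - \<phi> t0 \<le> f t - \<phi> t" "\<bar>\<phi> t - \<phi> t0 - D (t - t0)\<bar> \<le> \<epsilon> * \<bar>t - t0\<bar>"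
      using d1(2)[of t] d2(2)[of t] by (auto simp: dist_real_def)
    thus "f t0 + deriv \<phi> t0 * (t - t0) - \<epsilon> * \<bar>t - t0\<bar> \<le> f t"
      unfolding Dh by linarith
  qed
qed

lemma hamiltonian_attains_min:
  assumes ham: "hamiltonians E H" and \<gamma>: "\<gamma> \<in> E" and s: "s \<in> {0..1}"
  obtains q where "\<And>p. H \<gamma> s q \<le> H \<gamma> s p"
proof -
  have hcont: "continuous_on ({0..1} \<times> UNIV) (\<lambda>(s, p). H \<gamma> s p)" using ham \<gamma> by (simp add: hamiltonians_def)
  obtain L where L: "L \<ge> 0" "\<And>s' p. s' \<in> {0..1} \<Longrightarrow> H \<gamma> s' p < H \<gamma> s 0 \<Longrightarrow> \<bar>p\<bar> \<le> L"
    using hamiltonian_coercive[OF ham \<gamma>, of "H \<gamma> s 0"] by metis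
  have "continuous_on {-L..L} ((\<lambda>(s, p). H \<gamma> s p) \<circ> (\<lambda>p. (s, p)))" for L
    by (rule continuous_on_compose) (use s in \<open>auto intro!: continuous_intros continuous_on_subset[OF hcont]\<close>)
  hence cont: "continuous_on {-L..L} (H \<gamma> s)" for L by (simp add: o_def)
  obtain q where q: "q \<in> {- L..L}" "\<And>p. p \<in> {- L..L} \<Longrightarrow> H \<gamma> s q \<le> H \<gamma> s p"
    using continuous_attains_inf[OF _ _ cont[of L]] L(1) by fastforce
  show ?thesis
  proof (rule that)
    fix p
    show "H \<gamma> s q \<le> H \<gamma> s p"
    proof (cases "H \<gamma> s p < H \<gamma> s 0")
      case True
      from L(2)[OF s this] show ?thesis by (intro q(2)) (auto simp: abs_le_iff)
    next
      case False
      thus ?thesis using q(2)[of 0] L(1) by auto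
    qed
  qed
qed

text \<open>The limiter is bounded by minus the maximum over the arc of the minimal Hamiltonian, in
  particular by minus the minimum at the vertex. So every arc has a space slope that is compatible
  with all time slopes up to \<open>c x\<close>.\<close>

lemma flux_limiter_hamiltonian:
  fixes E :: "(real \<Rightarrow> 'a::euclidean_space) set"
  assumes net: "network E" and ham: "hamiltonians E H" and flux: "flux_limiter E H c"
    and x: "x \<in> vertices E" and \<gamma>: "\<gamma> \<in> arcs_into E x"
  obtains q where "H \<gamma> 1 q \<le> - c x"
proof -
  have \<gamma>E: "\<gamma> \<in> E" using \<gamma> by (simp add: arcs_into_def)
  have min: "\<exists>q. \<forall>p. H \<gamma> s q \<le> H \<gamma> s p" if s: "s \<in> {0..1}" for s
    using hamiltonian_attains_min[OF ham \<gamma>E s] by metis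
  have hcont: "continuous_on ({0..1} \<times> UNIV) (\<lambda>(s, p). H \<gamma> s p)" using ham \<gamma>E by (simp add: hamiltonians_def)
  have "continuous_on {0..1} ((\<lambda>(s, p). H \<gamma> s p) \<circ> (\<lambda>s. (s, 0)))"
    by (rule continuous_on_compose) (auto intro!: continuous_intros continuous_on_subset[OF hcont])
  hence "compact ((\<lambda>s. H \<gamma> s 0) ` {0..1})" by (intro compact_continuous_image) (auto simp: o_def)
  then obtain B where "\<forall>y \<in> (\<lambda>s. H \<gamma> s 0) ` {0..1}. \<bar>y\<bar> \<le> B"
    using compact_imp_bounded bounded_real by blast
  hence B: "H \<gamma> s 0 \<le> B" if "s \<in> {0..1}" for s using that by (force simp: abs_le_iff)
  have "(INF p. H \<gamma> s p) \<le> B" if s: "s \<in> {0..1}" for s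
  proof -
    have "bdd_below (range (H \<gamma> s))" using min[OF s] unfolding bdd_below_def by blast
    hence "(INF p. H \<gamma> s p) \<le> H \<gamma> s 0" by (rule cINF_lower) simp
    thus ?thesis using B[OF s] by simp
  qed
  hence "bdd_above ((\<lambda>s. INF p. H \<gamma> s p) ` {0..1})" unfolding bdd_above_def by blast
  hence "(INF p. H \<gamma> 1 p) \<le> (SUP s\<in>{0..1}. INF p. H \<gamma> s p)" by (intro cSUP_upper) auto
  moreover have "c x \<le> arc_const (H \<gamma>)"
  proof -
    have "c x \<le> (MIN \<gamma>\<in>arcs_into E x. arc_const (H \<gamma>))" using flux x by (simp add: flux_limiter_def)
    also have "\<dots> \<le> arc_const (H \<gamma>)"
      using net \<gamma> by (intro Min_le) (auto simp: network_def arcs_into_def)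
    finally show ?thesis .
  qed
  moreover obtain q where q: "\<And>p. H \<gamma> 1 q \<le> H \<gamma> 1 p" using min[of 1] by auto
  moreover have "H \<gamma> 1 q \<le> (INF p. H \<gamma> 1 p)" by (rule cINF_greatest) (use q in auto)
  ultimately show ?thesis by (intro that[of q]) (simp add: arc_const_def)
qed

lemma arcs_into_nonempty:
  assumes "network E" "x \<in> vertices E"
  shows "arcs_into E x \<noteq> {}"
proof -
  obtain \<gamma> where "\<gamma> \<in> E" "x = pathstart \<gamma> \<or> x = pathfinish \<gamma>"
    using assms by (auto simp: vertices_def)
  thus ?thesis using assms pathfinish_reversepath[of \<gamma>] by (auto simp: arcs_into_def network_def)
qed

text \<open>With \<open>y = N / \<rho>\<close>, multiplication by \<open>k\<close> gives
  \<open>k * g + 4 * m * (y^2 - y/2) <= 1/2 + m\<close>. The value \<open>y = 1\<close> is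
  impossible since \<open>m >= 1\<close>, and the minimum \<open>- 1/16\<close> of the bracket
  bounds \<open>k * g\<close>. In the application \<open>N\<close> is the distance of the contact
  from the base point and \<open>g\<close> the gap between one affine function and the smoothed
  minimum.\<close>

lemma contact_estimate:
  fixes g N :: real
  assumes "g + \<epsilon> * (N\<^sup>2 / \<rho> - N / 2) \<le> 2 * e + m / k" "0 \<le> g" "0 \<le> N" "N \<le> \<rho>"
    and k: "k > 0" "k * \<epsilon> * \<rho> = 4 * m" "4 * k * e = 1" and m: "m \<ge> 1" and \<rho>: "\<rho> > 0"
  shows "N < \<rho>" "k * g \<le> 2 * m + 1"
proof -
  define y where "y = N / \<rho>"
  have N: "N = y * \<rho>" using \<rho> by (simp add: y_def)
  have "N\<^sup>2 / \<rho> - N / 2 = \<rho> * (y\<^sup>2 - y / 2)" using \<rho> by (simp add: N power2_eq_square field_simps)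
  hence "k * (g + \<epsilon> * (\<rho> * (y\<^sup>2 - y / 2))) \<le> k * (2 * e + m / k)"
    using assms(1) k(1) by (intro mult_left_mono) auto
  moreover have "k * (g + \<epsilon> * (\<rho> * (y\<^sup>2 - y / 2))) = k * g + (k * \<epsilon> * \<rho>) * (y\<^sup>2 - y / 2)" by (simp add: algebra_simps)
  moreover have "k * (2 * e + m / k) = (4 * k * e) / 2 + m" using k(1) by (simp add: field_simps)
  ultimately have main: "k * g + 4 * m * (y\<^sup>2 - y / 2) \<le> 1 / 2 + m" unfolding k by simp
  show "N < \<rho>"
  proof (rule ccontr)
    assume "\<not> ?thesis"
    hence "y = 1" using assms(4) \<rho> by (simp add: y_def)
    moreover have "k * g \<ge> 0" using k assms(2) by simp
    ultimately show False using main m by (simp add: algebra_simps)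
  qed
  have "y\<^sup>2 - y / 2 = (y - 1/4)\<^sup>2 - 1 / 16" by (simp add: power2_eq_square algebra_simps)
  hence "y\<^sup>2 - y / 2 \<ge> - 1 / 16" by simp
  hence "4 * m * (y\<^sup>2 - y / 2) \<ge> 4 * m * (- 1 / 16)" using m by (intro mult_left_mono) auto
  thus "k * g \<le> 2 * m + 1" using main m by (simp add: algebra_simps)
qed

text \<open>
  The arc provided by the vertex condition depends on the time, so a condition on a single arc does
  not pass to the limit. If every arc is violated, with slopes \<open>(p \<gamma>, a \<gamma>)\<close>, the minimum over \<open>j\<close> of
  the affine functions with slopes \<open>(P \<gamma> j, A j)\<close> is a strict subsolution on all arcs and has the
  same trace at the vertex along all of them; smoothing the minimum makes it a test function.
\<close>

lemma vertex_supersolution_uniform_limit: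
  fixes E :: "(real \<Rightarrow> 'a::euclidean_space) set"
  assumes net: "network E" and ham: "hamiltonians E H" and flux: "flux_limiter E H c"
    and un: "\<And>n. HJ_supersolution E H c T0 T1 (un n)"
    and lim: "uniform_limit (spacetime E T0 T1) un u sequentially"
    and usub: "HJ_subsolution E H c T0 T1 u"
    and x: "x \<in> vertices E" and t0: "t0 \<in> einterval T0 T1"
    and \<phi>0: "subtangent (\<lambda>t. u (x, t)) t0 \<phi>0" "deriv \<phi>0 t0 < c x"
  shows "\<exists>\<gamma>\<in>arcs_into E x. \<forall>\<phi>.
           constrained_subtangent ({0..1} \<times> closure (einterval T0 T1)) (along u \<gamma>) (1, t0) \<phi> \<longrightarrow>
           time_deriv \<phi> 1 t0 + H \<gamma> 1 (space_deriv \<phi> 1 t0) \<ge> 0"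
proof (rule ccontr)
  define G where "G = arcs_into E x"
  define I where "I = einterval (ereal T0) T1"
  assume "\<not> ?thesis"
  hence "\<forall>\<gamma>\<in>G. \<exists>\<phi>. constrained_subtangent ({0..1} \<times> closure I) (along u \<gamma>) (1, t0) \<phi> \<and>
           time_deriv \<phi> 1 t0 + H \<gamma> 1 (space_deriv \<phi> 1 t0) < 0" unfolding G_def I_def by force
  then obtain \<Phi> where \<Phi>: "\<And>\<gamma>. \<gamma> \<in> G \<Longrightarrow> constrained_subtangent ({0..1} \<times> closure I) (along u \<gamma>) (1, t0) (\<Phi> \<gamma>)"
    "\<And>\<gamma>. \<gamma> \<in> G \<Longrightarrow> time_deriv (\<Phi> \<gamma>) 1 t0 + H \<gamma> 1 (space_deriv (\<Phi> \<gamma>) 1 t0) < 0"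
    by metis
  have I: "open I" "t0 \<in> I" using t0 by (auto simp: I_def)
  have GE: "\<gamma> \<in> E" "\<gamma> 1 = x" if "\<gamma> \<in> G" for \<gamma>
    using that by (auto simp: G_def arcs_into_def pathfinish_def)
  have G: "finite G" "G \<noteq> {}"
    using net arcs_into_nonempty[OF net x] by (auto simp: G_def network_def arcs_into_def)
  have st: "(\<gamma> s, t) \<in> spacetime E T0 T1" if "\<gamma> \<in> G" "s \<in> {0..1}" "t \<in> I" for \<gamma> s t
    using that network_arc(2)[OF net GE(1)] by (auto simp: spacetime_def I_def einterval_real)
  obtain \<gamma>0 where \<gamma>0: "\<gamma>0 \<in> G" using G by blast
  have xst: "(x, t) \<in> spacetime E T0 T1" if "t \<in> I" for t
    using st[OF \<gamma>0, of 1 t] GE(2)[OF \<gamma>0] that by simp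
  have ucont: "continuous_on (spacetime E T0 T1) u" using usub by (simp add: HJ_subsolution_def)
  define a0 where "a0 = deriv \<phi>0 t0"
  define a where "a = (\<lambda>\<gamma>. time_deriv (\<Phi> \<gamma>) 1 t0)"
  define p where "p = (\<lambda>\<gamma>. space_deriv (\<Phi> \<gamma>) 1 t0)"
  have "\<forall>\<gamma>\<in>G. \<exists>q. H \<gamma> 1 q \<le> - c x"
    using flux_limiter_hamiltonian[OF net ham flux x] unfolding G_def by blast
  then obtain q where q: "\<And>\<gamma>. \<gamma> \<in> G \<Longrightarrow> H \<gamma> 1 (q \<gamma>) \<le> - c x" by metis
  \<comment> \<open>Index \<open>None\<close> stands for the test function of the trace at the
    vertex, \<open>Some \<gamma>\<close> for the one on the arc \<gamma>.\<close>
  define A where "A = case_option a0 a"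
  \<comment> \<open>If \<open>A j\<close> is at most the time slope of the violating test function
    on \<gamma>, its space slope \<open>p \<gamma>\<close> still violates; otherwise
    \<open>q \<gamma>\<close> works, because \<open>A j\<close> does not exceed the limiter. In
    particular \<open>P \<gamma> (Some \<gamma>) = p \<gamma>\<close>.\<close>
  define P where "P = (\<lambda>\<gamma> j. if A j \<le> a \<gamma> then p \<gamma> else q \<gamma>)"
  define J where "J = insert None (Some ` G)"
  have J: "finite J" "J \<noteq> {}" "None \<in> J" "\<And>\<gamma>. \<gamma> \<in> G \<Longrightarrow> Some \<gamma> \<in> J" using G by (auto simp: J_def)
  obtain r where r: "r > 0" "cball t0 r \<subseteq> I" using I open_contains_cball by blast
  have decr: "u (x, t) - u (x, t0) \<le> c x * (t - t0)" if t: "t0 \<le> t" "t \<le> t0 + r" for t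
  proof (rule superjet1_slope_imp_lipschitz[where \<alpha> = t0 and \<beta> = "t0 + r" and f = "\<lambda>t. u (x, t)"])
    have "{t0..t0 + r} \<subseteq> I" using r by (auto simp: subset_eq dist_real_def)
    thus "continuous_on {t0..t0 + r} (\<lambda>t. u (x, t))"
      by (intro continuous_on_compose2[OF ucont]) (auto intro!: continuous_intros xst)
    fix s p assume s: "t0 < s" "s < t0 + r" and jet: "superjet1 (\<lambda>t. u (x, t)) s p"
    have "s \<in> I" using s r(2) by (auto simp: subset_eq dist_real_def)
    thus "p \<le> c x" using HJ_subsolution_vertex_superjet1[OF usub x _ jet] by (simp add: I_def)
  qed (use t in auto)
  have expand: "\<exists>\<rho>>0. \<forall>s t. s \<in> {0..1} \<longrightarrow> norm ((s, t) - (1, t0)) < \<rho> \<longrightarrow>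
      u (x, t0) + a \<gamma> * (t - t0) + p \<gamma> * (s - 1) - \<epsilon> * norm ((s, t) - (1, t0)) \<le> u (\<gamma> s, t)"
    if \<gamma>: "\<gamma> \<in> G" and "\<epsilon> > 0" for \<gamma> \<epsilon>
    using constrained_subtangent_expansion[OF \<Phi>(1)[OF \<gamma>] I \<open>\<epsilon> > 0\<close>] GE(2)[OF \<gamma>]
    by (simp add: along_def a_def p_def)
  \<comment> \<open>Here the subsolution property of the limit enters: after \<open>t0\<close> the
    trace of \<open>u\<close> grows at rate at most \<open>c x\<close>, and it is bounded from below
    by the expansion along \<gamma> taken at \<open>s = 1\<close>.\<close>
  have a_le: "a \<gamma> \<le> c x" if \<gamma>: "\<gamma> \<in> G" for \<gamma>
  proof (rule field_le_epsilon)
    fix \<epsilon> :: real assume \<epsilon>: "\<epsilon> > 0"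
    obtain \<rho> where \<rho>: "\<rho> > 0" "\<And>s t. s \<in> {0..1} \<Longrightarrow> norm ((s, t) - (1, t0)) < \<rho> \<Longrightarrow>
      u (x, t0) + a \<gamma> * (t - t0) + p \<gamma> * (s - 1) - \<epsilon> * norm ((s, t) - (1, t0)) \<le> u (\<gamma> s, t)"
      using expand[OF \<gamma> \<epsilon>] by blast
    define y where "y = min (r / 2) (\<rho> / 2)"
    have y: "y > 0" "y < r" "y < \<rho>" using r \<rho> by (auto simp: y_def)
    have "u (x, t0) + a \<gamma> * y - \<epsilon> * y \<le> u (x, t0 + y)"
      using \<rho>(2)[of 1 "t0 + y"] y GE(2)[OF \<gamma>] by (simp add: norm_Pair)
    also have "\<dots> \<le> u (x, t0) + c x * y" using decr[of "t0 + y"] y by simp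
    finally have "a \<gamma> * y \<le> (c x + \<epsilon>) * y" by (simp add: algebra_simps)
    thus "a \<gamma> \<le> c x + \<epsilon>" using y by simp
  qed
  have a0: "a0 < c x" using \<phi>0 by (simp add: a0_def)
  have A_le: "A j \<le> c x" if "j \<in> J" for j using that a_le a0 by (auto simp: J_def A_def)
  have viol: "A j + H \<gamma> 1 (P \<gamma> j) \<le> 0" if "\<gamma> \<in> G" "j \<in> J" for \<gamma> j
    using \<Phi>(2)[OF that(1)] q[OF that(1)] A_le[OF that(2)] by (auto simp: P_def a_def p_def)
  \<comment> \<open>A strict inequality is guaranteed only for the own index of an arc, and for
    \<open>None\<close> in the trace; the remaining indices may give equality. Hence the need to
    bound the weights of these particular indices from below.\<close>
  define \<theta> where "\<theta> = Min (insert (c x - a0) ((\<lambda>\<gamma>. - (a \<gamma> + H \<gamma> 1 (p \<gamma>))) ` G))"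
  have \<theta>: "\<theta> > 0" "\<theta> \<le> c x - a0" "\<And>\<gamma>. \<gamma> \<in> G \<Longrightarrow> a \<gamma> + H \<gamma> 1 (p \<gamma>) \<le> - \<theta>"
  proof -
    have "0 < - (a \<gamma> + H \<gamma> 1 (p \<gamma>))" if "\<gamma> \<in> G" for \<gamma>
      using \<Phi>(2)[OF that] by (simp add: a_def p_def)
    thus "\<theta> > 0" unfolding \<theta>_def using G a0 by (subst Min_gr_iff) (simp_all add: ball_simps)
    show "\<theta> \<le> c x - a0" unfolding \<theta>_def using G by (intro Min_le) auto
    fix \<gamma> assume "\<gamma> \<in> G"
    hence "\<theta> \<le> - (a \<gamma> + H \<gamma> 1 (p \<gamma>))" unfolding \<theta>_def using G by (intro Min_le) auto
    thus "a \<gamma> + H \<gamma> 1 (p \<gamma>) \<le> - \<theta>" by simp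
  qed
  define m where "m = real (card J)"
  have m: "m \<ge> 1" using J by (simp add: m_def Suc_leI card_gt_0_iff)
  \<comment> \<open>The lower bound on those weights that \<open>contact_estimate\<close> will
    supply. It depends only on the number of indices, so \<delta>, \<epsilon>, \<rho> and finally
    \<open>k\<close> can be chosen after it.\<close>
  define \<omega> where "\<omega> = exp (- (2 * m + 1))"
  have \<omega>: "\<omega> > 0" by (simp add: \<omega>_def)
  define B where "B = (\<Sum>\<gamma>\<in>G. \<bar>p \<gamma>\<bar> + \<bar>q \<gamma>\<bar>)"
  have PB: "\<bar>P \<gamma> j\<bar> \<le> B" if "\<gamma> \<in> G" for \<gamma> j
  proof -
    have "\<bar>p \<gamma>\<bar> + \<bar>q \<gamma>\<bar> \<le> B" unfolding B_def by (rule member_le_sum[OF that _ G(1)]) simp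
    thus ?thesis by (auto simp: P_def)
  qed
  have "\<forall>\<^sub>F \<delta> in at_right 0. \<forall>s p p'. s \<in> {0..1} \<longrightarrow> \<bar>p\<bar> \<le> B \<longrightarrow> \<bar>p' - p\<bar> \<le> \<delta> \<longrightarrow> \<bar>s - 1\<bar> \<le> \<delta> \<longrightarrow>
      H \<gamma> s p' \<le> H \<gamma> 1 p + \<omega> * \<theta> / 4" if \<gamma>: "\<gamma> \<in> G" for \<gamma>
  proof -
    have hcont: "continuous_on ({0..1} \<times> UNIV) (\<lambda>(s, p). H \<gamma> s p)" using ham GE(1)[OF \<gamma>] by (simp add: hamiltonians_def)
    have "uniformly_continuous_on ({0..1} \<times> {-(B+1)..B+1}) (\<lambda>(s, p). H \<gamma> s p)"
      by (intro compact_uniformly_continuous continuous_on_subset[OF hcont] compact_Times) auto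
    moreover have "\<omega> * \<theta> / 4 > 0" using \<omega> \<theta> by simp
    ultimately obtain d where d: "d > 0" "\<And>z z'. z \<in> {0..1} \<times> {-(B+1)..B+1} \<Longrightarrow> z' \<in> {0..1} \<times> {-(B+1)..B+1} \<Longrightarrow>
       dist z' z < d \<Longrightarrow> dist ((\<lambda>(s, p). H \<gamma> s p) z') ((\<lambda>(s, p). H \<gamma> s p) z) < \<omega> * \<theta> / 4"
      unfolding uniformly_continuous_on_def by metis
    show ?thesis unfolding eventually_at_right_field
    proof (intro exI conjI allI impI)
      show "0 < min 1 (d / 2)" using d by simp
      fix \<delta> s p p' :: real assume \<delta>: "0 < \<delta>" "\<delta> < min 1 (d / 2)" and s: "s \<in> {0..1}" and p: "\<bar>p\<bar> \<le> B"
        and p': "\<bar>p' - p\<bar> \<le> \<delta>" and s1: "\<bar>s - 1\<bar> \<le> \<delta>"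
      have "dist (s, p') (1, p) \<le> \<bar>s - 1\<bar> + \<bar>p' - p\<bar>" by (rule dist_Pair_le)
      hence "dist (s, p') (1, p) < d" using p' s1 \<delta> by simp
      moreover have "- (B + 1) \<le> p" "p \<le> B + 1" "- (B + 1) \<le> p'" "p' \<le> B + 1"
        using p p' \<delta> by (auto simp: abs_le_iff)
      ultimately have "\<bar>H \<gamma> s p' - H \<gamma> 1 p\<bar> < \<omega> * \<theta> / 4"
        using d(2)[of "(1, p)" "(s, p')"] s by (simp add: dist_real_def)
      thus "H \<gamma> s p' \<le> H \<gamma> 1 p + \<omega> * \<theta> / 4" by linarith
    qed
  qed
  hence "\<forall>\<^sub>F \<delta> in at_right 0. \<forall>\<gamma>\<in>G. \<forall>s p p'. s \<in> {0..1} \<longrightarrow> \<bar>p\<bar> \<le> B \<longrightarrow> \<bar>p' - p\<bar> \<le> \<delta> \<longrightarrow> \<bar>s - 1\<bar> \<le> \<delta> \<longrightarrow>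
      H \<gamma> s p' \<le> H \<gamma> 1 p + \<omega> * \<theta> / 4" by (intro eventually_ball_finite[OF G(1)]) blast
  moreover have "\<forall>\<^sub>F \<delta> in at_right (0::real). \<delta> > 0" by (rule eventually_at_right_less)
  ultimately have "\<forall>\<^sub>F \<delta> in at_right 0. \<delta> > 0 \<and> (\<forall>\<gamma>\<in>G. \<forall>s p p'. s \<in> {0..1} \<longrightarrow> \<bar>p\<bar> \<le> B \<longrightarrow> \<bar>p' - p\<bar> \<le> \<delta> \<longrightarrow>
     \<bar>s - 1\<bar> \<le> \<delta> \<longrightarrow> H \<gamma> s p' \<le> H \<gamma> 1 p + \<omega> * \<theta> / 4)" by eventually_elim blast
  from eventually_happens[OF this] obtain \<delta> where \<delta>: "\<delta> > 0"
    "\<And>\<gamma> s p p'. \<gamma> \<in> G \<Longrightarrow> s \<in> {0..1} \<Longrightarrow> \<bar>p\<bar> \<le> B \<Longrightarrow> \<bar>p' - p\<bar> \<le> \<delta> \<Longrightarrow> \<bar>s - 1\<bar> \<le> \<delta> \<Longrightarrow>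
      H \<gamma> s p' \<le> H \<gamma> 1 p + \<omega> * \<theta> / 4" by (auto simp: trivial_limit_at_right_real)
  \<comment> \<open>Out of the gain \<open>\<omega> * \<theta>\<close>, a quarter goes to the
    modulus of the Hamiltonian and an eighth to the time derivative of the quadratic
    penalty.\<close>
  define \<epsilon> where "\<epsilon> = min (\<omega> * \<theta> / 16) (\<delta> / 2)"
  have \<epsilon>: "\<epsilon> > 0" "2 * \<epsilon> \<le> \<omega> * \<theta> / 8" "2 * \<epsilon> \<le> \<delta>" using \<omega> \<theta> \<delta> by (auto simp: \<epsilon>_def)
  have "\<forall>\<^sub>F \<rho> in at_right 0. \<forall>\<gamma>\<in>G. \<forall>s t. s \<in> {0..1} \<longrightarrow> norm ((s, t) - (1, t0)) \<le> \<rho> \<longrightarrow>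
      u (x, t0) + a \<gamma> * (t - t0) + p \<gamma> * (s - 1) - \<epsilon> / 2 * norm ((s, t) - (1, t0)) \<le> u (\<gamma> s, t)"
  proof (intro eventually_ball_finite[OF G(1)] ballI)
    fix \<gamma> assume "\<gamma> \<in> G"
    then obtain \<rho> where "\<rho> > 0" "\<And>s t. s \<in> {0..1} \<Longrightarrow> norm ((s, t) - (1, t0)) < \<rho> \<Longrightarrow>
      u (x, t0) + a \<gamma> * (t - t0) + p \<gamma> * (s - 1) - \<epsilon> / 2 * norm ((s, t) - (1, t0)) \<le> u (\<gamma> s, t)"
      using expand[of \<gamma> "\<epsilon> / 2"] \<epsilon> by auto
    thus "\<forall>\<^sub>F \<rho> in at_right 0. \<forall>s t. s \<in> {0..1} \<longrightarrow> norm ((s, t) - (1, t0)) \<le> \<rho> \<longrightarrow>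
      u (x, t0) + a \<gamma> * (t - t0) + p \<gamma> * (s - 1) - \<epsilon> / 2 * norm ((s, t) - (1, t0)) \<le> u (\<gamma> s, t)"
      unfolding eventually_at_right_field by (intro exI[of _ \<rho>]) force
  qed
  moreover have "\<forall>\<^sub>F \<rho> in at_right 0. \<forall>t. \<bar>t - t0\<bar> \<le> \<rho> \<longrightarrow>
      u (x, t0) + a0 * (t - t0) - \<epsilon> / 2 * \<bar>t - t0\<bar> \<le> u (x, t)"
  proof -
    obtain \<rho> where "\<rho> > 0" "\<And>t. \<bar>t - t0\<bar> < \<rho> \<Longrightarrow> u (x, t0) + a0 * (t - t0) - \<epsilon> / 2 * \<bar>t - t0\<bar> \<le> u (x, t)"
      using subtangent_expansion[OF \<phi>0(1), of "\<epsilon> / 2"] \<epsilon> by (auto simp: a0_def)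
    thus ?thesis unfolding eventually_at_right_field by (intro exI[of _ \<rho>]) force
  qed
  moreover have "\<forall>\<^sub>F \<rho> in at_right 0. 0 < \<rho> \<and> \<rho> < min r (min \<delta> (1/2))"
    unfolding eventually_at_right_field by (intro exI[of _ "min r (min \<delta> (1/2))"]) (use r \<delta> in auto)
  ultimately have "\<forall>\<^sub>F \<rho> in at_right 0. (0 < \<rho> \<and> \<rho> < min r (min \<delta> (1/2))) \<and>
      (\<forall>t. \<bar>t - t0\<bar> \<le> \<rho> \<longrightarrow> u (x, t0) + a0 * (t - t0) - \<epsilon> / 2 * \<bar>t - t0\<bar> \<le> u (x, t)) \<and>
      (\<forall>\<gamma>\<in>G. \<forall>s t. s \<in> {0..1} \<longrightarrow> norm ((s, t) - (1, t0)) \<le> \<rho> \<longrightarrow>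
      u (x, t0) + a \<gamma> * (t - t0) + p \<gamma> * (s - 1) - \<epsilon> / 2 * norm ((s, t) - (1, t0)) \<le> u (\<gamma> s, t))"
    by eventually_elim blast
  from eventually_happens[OF this] obtain \<rho> where \<rho>: "0 < \<rho>" "\<rho> < r" "\<rho> < \<delta>" "\<rho> < 1/2"
    and exp0: "\<And>t. \<bar>t - t0\<bar> \<le> \<rho> \<Longrightarrow> u (x, t0) + a0 * (t - t0) - \<epsilon> / 2 * \<bar>t - t0\<bar> \<le> u (x, t)"
    and exp\<gamma>: "\<And>\<gamma> s t. \<gamma> \<in> G \<Longrightarrow> s \<in> {0..1} \<Longrightarrow> norm ((s, t) - (1, t0)) \<le> \<rho> \<Longrightarrow>
      u (x, t0) + a \<gamma> * (t - t0) + p \<gamma> * (s - 1) - \<epsilon> / 2 * norm ((s, t) - (1, t0)) \<le> u (\<gamma> s, t)"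
    by (auto simp: trivial_limit_at_right_real)
  \<comment> \<open>At distance \<rho> the penalty exceeds the expansion error by
    \<open>\<epsilon> * \<rho> / 2 = 2 * m / k\<close>, more than the smoothing error
    \<open>m / k\<close> plus the approximation error \<open>2 * e = 1 / (2 * k)\<close>.\<close>
  define k where "k = 4 * m / (\<epsilon> * \<rho>)"
  have k: "k > 0" "k * \<epsilon> * \<rho> = 4 * m" using m \<epsilon> \<rho> by (auto simp: k_def)
  define e where "e = 1 / (4 * k)"
  have e: "e > 0" "4 * k * e = 1" using k by (auto simp: e_def)
  obtain n where n: "\<And>z. z \<in> spacetime E T0 T1 \<Longrightarrow> \<bar>un n z - u z\<bar> < e"
    using uniform_limitD[OF lim e(1)] unfolding eventually_sequentially dist_real_def by blast
  define z1 where "z1 = (1::real, t0)"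
  define wt where "wt = (\<lambda>\<gamma> z j. soft_weight k J A (P \<gamma>) t0 z j)"
  \<comment> \<open>The subtracted square confines the contact to the interior of the half ball. It
    is the same on all arcs, so the traces at \<open>s = 1\<close> still agree.\<close>
  define \<Psi> where "\<Psi> = (\<lambda>\<gamma> z. soft_min k J A (P \<gamma>) t0 z + (- (\<epsilon> / \<rho>)) * (norm (z - z1))\<^sup>2)"
  define Q where "Q = cball z1 \<rho> \<inter> ({0..1} \<times> UNIV)"
  have Q: "fst z \<in> {0..1}" "\<bar>fst z - 1\<bar> \<le> \<rho>" "\<bar>snd z - t0\<bar> \<le> \<rho>" "snd z \<in> I" "norm (z - z1) \<le> \<rho>" if "z \<in> Q" for z
  proof -
    show n: "norm (z - z1) \<le> \<rho>" using that by (simp add: Q_def dist_norm norm_minus_commute)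
    show "fst z \<in> {0..1}" using that by (auto simp: Q_def)
    show "\<bar>fst z - 1\<bar> \<le> \<rho>" "\<bar>snd z - t0\<bar> \<le> \<rho>"
      using n dist_fst_le[of z z1] dist_snd_le[of z z1] by (simp_all add: z1_def dist_norm)
    thus "snd z \<in> I" using r(2) \<rho>(2) by (auto simp: subset_eq dist_real_def)
  qed
  have \<Psi>der: "(\<Psi> \<gamma> has_derivative (\<lambda>h.
       ((\<Sum>j\<in>J. wt \<gamma> z j * P \<gamma> j) - 2 * (\<epsilon> / \<rho>) * (fst z - 1), (\<Sum>j\<in>J. wt \<gamma> z j * A j) - 2 * (\<epsilon> / \<rho>) * (snd z - t0)) \<bullet> h)) (at z)" for \<gamma> z
  proof -
    have "((\<lambda>z. - (\<epsilon> / \<rho>) * (norm (z - z1))\<^sup>2) has_derivative (\<lambda>h. - (\<epsilon> / \<rho>) * (2 * ((z - z1) \<bullet> h)))) (at z)"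
      by (rule has_derivative_mult_right[OF norm_square_has_derivative])
    from has_derivative_add[OF soft_min_has_derivative[OF k(1) J(1,2)] this] show ?thesis
      unfolding \<Psi>_def wt_def by (rule has_derivative_eq_rhs) (auto simp: inner_prod_def z1_def algebra_simps diff_divide_distrib add_divide_distrib)
  qed
  have C1\<Psi>: "C1_near (\<Psi> \<gamma>) z" for \<gamma> z
    by (rule C1_nearI_gradient[OF open_UNIV UNIV_I _ \<Psi>der])
      (use \<rho>(1) continuous_on_soft_weight[OF k(1) J(1,2)] in \<open>auto intro!: continuous_intros simp: wt_def\<close>)
  note \<Psi>x = space_deriv_eq[OF \<Psi>der] and \<Psi>t = time_deriv_eq[OF \<Psi>der]
  define F where "F = (\<lambda>\<gamma> z. un n (\<gamma> (fst z), snd z) - \<Psi> \<gamma> z)"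
  have z1Q: "z1 \<in> Q" using \<rho> by (auto simp: Q_def z1_def)
  have cptQ: "compact Q" unfolding Q_def
    by (intro compact_Int_closed) (auto intro: closed_Times)
  have Fcont: "continuous_on Q (F \<gamma>)" if \<gamma>: "\<gamma> \<in> G" for \<gamma>
  proof -
    have \<gamma>c: "continuous_on {0..1} \<gamma>" by (rule network_arc(1)[OF net GE(1)[OF \<gamma>]])
    have pc: "continuous_on Q (\<lambda>z. (\<gamma> (fst z), snd z))"
      by (intro continuous_intros continuous_on_compose2[OF \<gamma>c]) (use Q in auto)
    have "continuous_on (spacetime E T0 T1) (un n)" using un by (simp add: HJ_supersolution_def)
    hence "continuous_on Q (\<lambda>z. un n (\<gamma> (fst z), snd z))"
      by (rule continuous_on_compose2[OF _ pc]) (use Q st[OF \<gamma>] in blast)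
    moreover have "continuous_on Q (\<Psi> \<gamma>)"
      by (rule has_derivative_continuous_on[OF has_derivative_at_withinI[OF \<Psi>der]])
    ultimately show ?thesis unfolding F_def by (intro continuous_intros)
  qed
  have "\<exists>z\<in>Q. \<forall>z'\<in>Q. F \<gamma> z \<le> F \<gamma> z'" if "\<gamma> \<in> G" for \<gamma>
    by (rule continuous_attains_inf[OF cptQ _ Fcont[OF that]]) (use z1Q in blast)
  then have "\<forall>\<gamma>\<in>G. \<exists>z. z \<in> Q \<and> (\<forall>z'\<in>Q. F \<gamma> z \<le> F \<gamma> z')" by blast
  from bchoice[OF this] obtain Z where Z: "\<And>\<gamma>. \<gamma> \<in> G \<Longrightarrow> Z \<gamma> \<in> Q"
    "\<And>\<gamma> z'. \<gamma> \<in> G \<Longrightarrow> z' \<in> Q \<Longrightarrow> F \<gamma> (Z \<gamma>) \<le> F \<gamma> z'"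
    by blast
  \<comment> \<open>The vertex condition of \<open>un n\<close> may return any arc, so the contact
    has to be minimal along all arcs together.\<close>
  define \<gamma>1 where "\<gamma>1 = arg_min_on (\<lambda>\<gamma>. F \<gamma> (Z \<gamma>)) G"
  have \<gamma>1: "\<gamma>1 \<in> G" "\<And>\<gamma>. \<gamma> \<in> G \<Longrightarrow> F \<gamma>1 (Z \<gamma>1) \<le> F \<gamma> (Z \<gamma>)"
    unfolding \<gamma>1_def using arg_min_if_finite(1)[OF G, of "\<lambda>\<gamma>. F \<gamma> (Z \<gamma>)"] arg_min_least[OF G, of _ "\<lambda>\<gamma>. F \<gamma> (Z \<gamma>)"] by auto
  define z where "z = Z \<gamma>1"
  have zQ: "z \<in> Q" unfolding z_def by (rule Z(1)[OF \<gamma>1(1)])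
  have zmin: "F \<gamma>1 z \<le> F \<gamma> z'" if "\<gamma> \<in> G" "z' \<in> Q" for \<gamma> z'
    using \<gamma>1(2)[OF that(1)] Z(2)[OF that] by (simp add: z_def)
  have F1: "F \<gamma>1 z \<le> u (x, t0) + e + m / k"
  proof -
    have "F \<gamma>1 z \<le> F \<gamma>1 z1" by (rule zmin[OF \<gamma>1(1) z1Q])
    also have "\<dots> \<le> un n (x, t0) + m / k"
      using soft_min_base[OF k(1) J(1,2), of A "P \<gamma>1" t0] GE(2)[OF \<gamma>1(1)] by (simp add: F_def \<Psi>_def z1_def m_def)
    also have "\<dots> \<le> u (x, t0) + e + m / k" using n[OF xst[OF I(2)]] by (simp add: abs_less_iff)
    finally show ?thesis .
  qed
  \<comment> \<open>The expansion of \<open>u\<close> along \<gamma> itself is compared with the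
    contact value: the own affine function of the arc cannot lie far above the smoothed minimum, so
    its weight is not small.\<close>
  have weight: "norm (z - z1) < \<rho>" "\<omega> \<le> wt \<gamma> z (Some \<gamma>)"
    if \<gamma>: "\<gamma> \<in> G" and F\<gamma>: "F \<gamma> z \<le> u (x, t0) + e + m / k" for \<gamma>
  proof -
    obtain s t where z_eq: "z = (s, t)" by fastforce
    define N where "N = norm (z - z1)"
    define g where "g = A (Some \<gamma>) * (snd z - t0) + P \<gamma> (Some \<gamma>) * (fst z - 1) - soft_min k J A (P \<gamma>) t0 z"
    have g0: "0 \<le> g" using soft_min_le[OF k(1) J(1,2) J(4)[OF \<gamma>], of A "P \<gamma>" t0 z] by (simp add: g_def)
    have "u (x, t0) + a \<gamma> * (t - t0) + p \<gamma> * (s - 1) - \<epsilon> / 2 * N \<le> u (\<gamma> s, t)"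
      using exp\<gamma>[OF \<gamma>, of s t] Q[OF zQ] by (simp add: N_def z_eq z1_def)
    moreover have "\<bar>un n (\<gamma> s, t) - u (\<gamma> s, t)\<bar> < e" using Q[OF zQ] by (intro n st[OF \<gamma>]) (auto simp: z_eq)
    moreover have "F \<gamma> z = un n (\<gamma> s, t) - soft_min k J A (P \<gamma>) t0 z + \<epsilon> / \<rho> * N\<^sup>2"
      by (simp add: F_def \<Psi>_def N_def z_eq)
    moreover have "g = a \<gamma> * (t - t0) + p \<gamma> * (s - 1) - soft_min k J A (P \<gamma>) t0 z"
      by (simp add: g_def A_def P_def z_eq)
    ultimately have "g + (\<epsilon> / \<rho> * N\<^sup>2 - \<epsilon> / 2 * N) \<le> 2 * e + m / k" using F\<gamma> by linarith
    hence main: "g + \<epsilon> * (N\<^sup>2 / \<rho> - N / 2) \<le> 2 * e + m / k" by (simp add: algebra_simps)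
    have N: "0 \<le> N" "N \<le> \<rho>" using Q[OF zQ] by (auto simp: N_def)
    note est = contact_estimate[OF main g0 N k e(2) m \<rho>(1)]
    show "norm (z - z1) < \<rho>" using est(1) by (simp add: N_def)
    show "\<omega> \<le> wt \<gamma> z (Some \<gamma>)"
      using est(2) unfolding wt_def soft_weight_eq[OF k(1) J(1,2)] g_def[symmetric] \<omega>_def by simp
  qed
  have shift: "\<bar>2 * (\<epsilon> / \<rho>) * y\<bar> \<le> 2 * \<epsilon>" if "\<bar>y\<bar> \<le> \<rho>" for y
  proof -
    have "\<bar>2 * (\<epsilon> / \<rho>) * y\<bar> = 2 * (\<epsilon> / \<rho>) * \<bar>y\<bar>" using \<epsilon> \<rho> by (simp add: abs_mult)
    also have "\<dots> \<le> 2 * (\<epsilon> / \<rho>) * \<rho>" using \<epsilon> \<rho> that by (intro mult_left_mono) auto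
    finally show ?thesis using \<rho> by simp
  qed
  \<comment> \<open>Convexity turns the average of the slopes into an average of the inequalities
    \<open>viol\<close>; the own index contributes at most \<open>- \<omega> * \<theta>\<close> and
    the others nothing positive.\<close>
  have strict: "time_deriv (\<Psi> \<gamma>) (fst z) (snd z) + H \<gamma> (fst z) (space_deriv (\<Psi> \<gamma>) (fst z) (snd z)) < 0"
    if \<gamma>: "\<gamma> \<in> G" and w: "\<omega> \<le> wt \<gamma> z (Some \<gamma>)" for \<gamma>
  proof -
    have w0: "0 \<le> wt \<gamma> z j" for j unfolding wt_def by (rule soft_weight_nonneg[OF k(1) J(1,2)])
    have w1: "(\<Sum>j\<in>J. wt \<gamma> z j) = 1" unfolding wt_def by (rule sum_soft_weight[OF k(1) J(1,2)])
    define p0 where "p0 = (\<Sum>j\<in>J. wt \<gamma> z j * P \<gamma> j)"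
    have "\<bar>p0\<bar> \<le> (\<Sum>j\<in>J. \<bar>wt \<gamma> z j * P \<gamma> j\<bar>)" unfolding p0_def by (rule sum_abs)
    also have "\<dots> \<le> (\<Sum>j\<in>J. wt \<gamma> z j * B)"
      using PB[OF \<gamma>] w0 by (intro sum_mono) (simp add: abs_mult mult_left_mono)
    also have "\<dots> = B" using w1 by (simp add: sum_distrib_right[symmetric])
    finally have p0: "\<bar>p0\<bar> \<le> B" .
    have conv: "convex_on UNIV (H \<gamma> 1)" using ham GE(1)[OF \<gamma>] by (simp add: hamiltonians_def)
    have "H \<gamma> 1 (\<Sum>j\<in>J. wt \<gamma> z j *\<^sub>R P \<gamma> j) \<le> (\<Sum>j\<in>J. wt \<gamma> z j * H \<gamma> 1 (P \<gamma> j))"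
      by (rule convex_on_sum[OF J(1,2) conv w1]) (use w0 in auto)
    hence "H \<gamma> 1 p0 \<le> (\<Sum>j\<in>J. wt \<gamma> z j * H \<gamma> 1 (P \<gamma> j))" by (simp add: p0_def)
    hence "(\<Sum>j\<in>J. wt \<gamma> z j * A j) + H \<gamma> 1 p0 \<le> (\<Sum>j\<in>J. wt \<gamma> z j * (A j + H \<gamma> 1 (P \<gamma> j)))"
      by (simp add: distrib_left sum.distrib)
    also have "\<dots> = wt \<gamma> z (Some \<gamma>) * (A (Some \<gamma>) + H \<gamma> 1 (P \<gamma> (Some \<gamma>))) +
        (\<Sum>j\<in>J - {Some \<gamma>}. wt \<gamma> z j * (A j + H \<gamma> 1 (P \<gamma> j)))"
      by (rule sum.remove[OF J(1) J(4)[OF \<gamma>]])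
    also have "(\<Sum>j\<in>J - {Some \<gamma>}. wt \<gamma> z j * (A j + H \<gamma> 1 (P \<gamma> j))) \<le> 0"
      using viol[OF \<gamma>] w0 by (intro sum_nonpos mult_nonneg_nonpos) auto
    also have "wt \<gamma> z (Some \<gamma>) * (A (Some \<gamma>) + H \<gamma> 1 (P \<gamma> (Some \<gamma>))) \<le> wt \<gamma> z (Some \<gamma>) * (- \<theta>)"
      using \<theta>(3)[OF \<gamma>] w0 by (intro mult_left_mono) (auto simp: A_def P_def)
    also have "\<dots> \<le> \<omega> * (- \<theta>)" using w \<theta>(1) by simp
    finally have 1: "(\<Sum>j\<in>J. wt \<gamma> z j * A j) + H \<gamma> 1 p0 \<le> - (\<omega> * \<theta>)" by simp
    have 2: "H \<gamma> (fst z) (p0 - 2 * (\<epsilon> / \<rho>) * (fst z - 1)) \<le> H \<gamma> 1 p0 + \<omega> * \<theta> / 4"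
      using Q[OF zQ] shift[of "fst z - 1"] \<epsilon> \<rho> by (intro \<delta>(2)[OF \<gamma> _ p0]) auto
    have 3: "- (2 * (\<epsilon> / \<rho>) * (snd z - t0)) \<le> 2 * \<epsilon>" using shift[OF Q(3)[OF zQ]] by linarith
    have "\<omega> * \<theta> > 0" using \<omega> \<theta> by simp
    hence "((\<Sum>j\<in>J. wt \<gamma> z j * A j) - 2 * (\<epsilon> / \<rho>) * (snd z - t0)) + H \<gamma> (fst z) (p0 - 2 * (\<epsilon> / \<rho>) * (fst z - 1)) < 0"
      using 1 2 3 \<epsilon>(2) by linarith
    thus ?thesis using \<Psi>x[of \<gamma> "fst z" "snd z"] \<Psi>t[of \<gamma> "fst z" "snd z"] by (simp add: inner_prod_def p0_def)
  qed
  have zint: "norm (z - z1) < \<rho>" by (rule weight(1)[OF \<gamma>1(1) F1])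
  define d where "d = \<rho> - norm (z - z1)"
  have d: "d > 0" using zint by (simp add: d_def)
  have ballQ: "z' \<in> Q" if "dist z' z < d" "fst z' \<in> {0..1}" for z'
  proof -
    have "dist z1 z' \<le> \<rho>" using that(1) dist_triangle[of z1 z' z] by (simp add: d_def dist_norm norm_minus_commute)
    thus ?thesis using that(2) by (auto simp: Q_def mem_Times_iff)
  qed
  show False
  proof (cases "fst z = 1")
    case False
    have s: "0 < fst z" "fst z < 1" using False Q[OF zQ] \<rho>(4) by (auto simp: abs_le_iff)
    have "subtangent (along (un n) \<gamma>1) z (\<Psi> \<gamma>1)"
      unfolding constrained_subtangent_def
    proof (intro conjI C1\<Psi>)
      show "\<forall>\<^sub>F w in at z. along (un n) \<gamma>1 z - \<Psi> \<gamma>1 z \<le> along (un n) \<gamma>1 w - \<Psi> \<gamma>1 w"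
        unfolding eventually_at
      proof (intro exI conjI ballI impI)
        show "min d (min (fst z) (1 - fst z)) > 0" using d s by simp
        fix w assume w: "w \<noteq> z \<and> dist w z < min d (min (fst z) (1 - fst z))"
        have "\<bar>fst w - fst z\<bar> < min (fst z) (1 - fst z)"
          using w dist_fst_le[of w z] by (simp add: dist_real_def)
        hence "fst w \<in> {0..1}" by (auto simp: abs_less_iff)
        hence "w \<in> Q" using w by (intro ballQ) auto
        from zmin[OF \<gamma>1(1) this] show "along (un n) \<gamma>1 z - \<Psi> \<gamma>1 z \<le> along (un n) \<gamma>1 w - \<Psi> \<gamma>1 w"
          by (simp add: F_def along_def case_prod_unfold)
      qed
    qed
    hence "0 \<le> time_deriv (\<Psi> \<gamma>1) (fst z) (snd z) + H \<gamma>1 (fst z) (space_deriv (\<Psi> \<gamma>1) (fst z) (snd z))"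
      using un[of n] GE(1)[OF \<gamma>1(1)] s Q(4)[OF zQ] unfolding HJ_supersolution_def arc_supersolution_def I_def
      by (metis greaterThanLessThan_iff prod.collapse)
    thus False using strict[OF \<gamma>1(1) weight(2)[OF \<gamma>1(1) F1]] by simp
  next
    case True
    define t where "t = snd z"
    have z_eq: "z = (1, t)" using True by (simp add: t_def prod_eq_iff)
    have tI: "t \<in> I" using Q(4)[OF zQ] by (simp add: t_def)
    have soft1: "soft_min k J A (P \<gamma>) t0 (1, t') = soft_min k J A (P \<gamma>') t0 (1, t')"
      "soft_weight k J A (P \<gamma>) t0 (1, t') j = soft_weight k J A (P \<gamma>') t0 (1, t') j" for \<gamma> \<gamma>' t' j
      by (simp_all add: soft_min_def soft_weight_def)
    have same: "F \<gamma> z = F \<gamma>1 z" if "\<gamma> \<in> G" for \<gamma>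
      using soft1(1)[of \<gamma> t \<gamma>1] GE(2)[OF that] GE(2)[OF \<gamma>1(1)] by (simp add: F_def \<Psi>_def z_eq)
    have sub1: "subtangent (\<lambda>t. un n (x, t)) t (\<lambda>t. \<Psi> \<gamma>1 (1, t))"
      unfolding constrained_subtangent_def
    proof (intro conjI)
      show "C1_near (\<lambda>t. \<Psi> \<gamma>1 (1, t)) t"
      proof (rule C1_nearI_gradient[OF open_UNIV UNIV_I])
        show "continuous_on UNIV (\<lambda>t. (\<Sum>j\<in>J. wt \<gamma>1 (1, t) j * A j) - 2 * (\<epsilon> / \<rho>) * (t - t0))"
          unfolding wt_def
          by (intro continuous_intros continuous_on_compose2[OF continuous_on_soft_weight[OF k(1) J(1,2)]]) auto
        fix \<tau> :: real
        have "((\<lambda>t. (1::real, t)) has_derivative (\<lambda>h. (0, h))) (at \<tau>)" by (auto intro!: derivative_eq_intros)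
        from diff_chain_at[OF this \<Psi>der[of \<gamma>1 "(1, \<tau>)"]]
        show "((\<lambda>t. \<Psi> \<gamma>1 (1, t)) has_derivative (\<lambda>h. ((\<Sum>j\<in>J. wt \<gamma>1 (1, \<tau>) j * A j) - 2 * (\<epsilon> / \<rho>) * (\<tau> - t0)) \<bullet> h)) (at \<tau>)"
          by (simp add: o_def inner_prod_def)
      qed
      show "\<forall>\<^sub>F w in at t. un n (x, t) - \<Psi> \<gamma>1 (1, t) \<le> un n (x, w) - \<Psi> \<gamma>1 (1, w)"
        unfolding eventually_at
      proof (intro exI conjI ballI impI)
        show "d > 0" by fact
        fix t' assume "t' \<noteq> t \<and> dist t' t < d"
        hence "(1, t') \<in> Q" by (intro ballQ) (auto simp: z_eq dist_Pair_Pair)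
        from zmin[OF \<gamma>1(1) this] show "un n (x, t) - \<Psi> \<gamma>1 (1, t) \<le> un n (x, t') - \<Psi> \<gamma>1 (1, t')"
          using GE(2)[OF \<gamma>1(1)] by (simp add: F_def z_eq)
      qed
    qed
    have "deriv (\<lambda>t. \<Psi> \<gamma>1 (1, t)) t < c x"
    proof -
      define N where "N = norm (z - z1)"
      have N: "N = \<bar>t - t0\<bar>" by (simp add: N_def z_eq z1_def norm_Pair)
      \<comment> \<open>The estimate of \<open>weight\<close> once more, now with the expansion of
        the trace: index \<open>None\<close> carries weight at least \<omega>, which pushes the time
        slope strictly below the limiter.\<close>
      define g where "g = A None * (snd z - t0) + P \<gamma>1 None * (fst z - 1) - soft_min k J A (P \<gamma>1) t0 z"
      have g0: "0 \<le> g" using soft_min_le[OF k(1) J(1,2,3), of A "P \<gamma>1" t0 z] by (simp add: g_def)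
      have NQ: "N \<le> \<rho>" "0 \<le> N" using Q(5)[OF zQ] by (auto simp: N_def)
      have "u (x, t0) + a0 * (t - t0) - \<epsilon> / 2 * N \<le> u (x, t)" using exp0[of t] NQ by (simp add: N)
      moreover have "\<bar>un n (x, t) - u (x, t)\<bar> < e" by (intro n xst tI)
      moreover have "F \<gamma>1 z = un n (x, t) - soft_min k J A (P \<gamma>1) t0 z + \<epsilon> / \<rho> * N\<^sup>2"
        using GE(2)[OF \<gamma>1(1)] by (simp add: F_def \<Psi>_def N_def z_eq)
      moreover have "g = a0 * (t - t0) - soft_min k J A (P \<gamma>1) t0 z" by (simp add: g_def A_def z_eq)
      ultimately have "g + (\<epsilon> / \<rho> * N\<^sup>2 - \<epsilon> / 2 * N) \<le> 2 * e + m / k" using F1 by linarith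
      hence "g + \<epsilon> * (N\<^sup>2 / \<rho> - N / 2) \<le> 2 * e + m / k" by (simp add: algebra_simps)
      from contact_estimate(2)[OF this g0 NQ(2,1) k e(2) m \<rho>(1)]
      have w: "\<omega> \<le> wt \<gamma>1 z None"
        unfolding wt_def soft_weight_eq[OF k(1) J(1,2)] g_def[symmetric] \<omega>_def by simp
      have w0: "0 \<le> wt \<gamma>1 z j" for j unfolding wt_def by (rule soft_weight_nonneg[OF k(1) J(1,2)])
      have w1: "(\<Sum>j\<in>J. wt \<gamma>1 z j) = 1" unfolding wt_def by (rule sum_soft_weight[OF k(1) J(1,2)])
      have "(\<Sum>j\<in>J. wt \<gamma>1 z j * A j) - c x = (\<Sum>j\<in>J. wt \<gamma>1 z j * (A j - c x))"
        using w1 by (simp add: right_diff_distrib sum_subtractf sum_distrib_right[symmetric])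
      also have "\<dots> = wt \<gamma>1 z None * (A None - c x) + (\<Sum>j\<in>J - {None}. wt \<gamma>1 z j * (A j - c x))"
        by (rule sum.remove[OF J(1) J(3)])
      also have "(\<Sum>j\<in>J - {None}. wt \<gamma>1 z j * (A j - c x)) \<le> 0"
        using A_le w0 by (intro sum_nonpos mult_nonneg_nonpos) auto
      also have "wt \<gamma>1 z None * (A None - c x) \<le> wt \<gamma>1 z None * (- \<theta>)"
        using \<theta>(2) w0 by (intro mult_left_mono) (auto simp: A_def)
      also have "\<dots> \<le> \<omega> * (- \<theta>)" using w \<theta>(1) by simp
      finally have 1: "(\<Sum>j\<in>J. wt \<gamma>1 z j * A j) \<le> c x - \<omega> * \<theta>" by simp
      have "- (2 * (\<epsilon> / \<rho>) * (t - t0)) \<le> 2 * \<epsilon>"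
        using shift[of "t - t0"] NQ(1) unfolding N by linarith
      moreover have "\<omega> * \<theta> > 0" using \<omega> \<theta> by simp
      ultimately have "(\<Sum>j\<in>J. wt \<gamma>1 z j * A j) - 2 * (\<epsilon> / \<rho>) * (t - t0) < c x" using 1 \<epsilon>(2) by linarith
      moreover have "deriv (\<lambda>t. \<Psi> \<gamma>1 (1, t)) t = (\<Sum>j\<in>J. wt \<gamma>1 z j * A j) - 2 * (\<epsilon> / \<rho>) * (t - t0)"
        using \<Psi>t[of \<gamma>1 1 t] unfolding time_deriv_def by (simp add: inner_prod_def z_eq)
      ultimately show ?thesis by simp
    qed
    \<comment> \<open>This arc may differ from \<gamma>1. As the contact value at the vertex is the
      same along every arc, \<open>\<Psi> \<gamma>\<close> touches along it as well and
      \<open>strict\<close> applies to it.\<close>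
    with sub1 un[of n] x tI obtain \<gamma> where \<gamma>: "\<gamma> \<in> G"
      "\<And>\<phi>. constrained_subtangent ({0..1} \<times> closure I) (along (un n) \<gamma>) (1, t) \<phi> \<Longrightarrow>
           time_deriv \<phi> 1 t + H \<gamma> 1 (space_deriv \<phi> 1 t) \<ge> 0"
      unfolding HJ_supersolution_def G_def I_def by metis
    have "constrained_subtangent ({0..1} \<times> closure I) (along (un n) \<gamma>) (1, t) (\<Psi> \<gamma>)"
      unfolding constrained_subtangent_def
    proof (intro conjI C1\<Psi>)
      show "\<forall>\<^sub>F w in at (1, t) within {0..1} \<times> closure I.
          along (un n) \<gamma> (1, t) - \<Psi> \<gamma> (1, t) \<le> along (un n) \<gamma> w - \<Psi> \<gamma> w"
        unfolding eventually_at
      proof (intro exI conjI ballI impI)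
        show "d > 0" by fact
        fix w :: "real \<times> real" assume "w \<in> {0..1} \<times> closure I" "w \<noteq> (1, t) \<and> dist w (1, t) < d"
        hence "w \<in> Q" by (intro ballQ) (auto simp: z_eq)
        from zmin[OF \<gamma>(1) this] show "along (un n) \<gamma> (1, t) - \<Psi> \<gamma> (1, t) \<le> along (un n) \<gamma> w - \<Psi> \<gamma> w"
          unfolding same[OF \<gamma>(1), symmetric] by (simp add: F_def along_def case_prod_unfold z_eq)
      qed
    qed
    from \<gamma>(2)[OF this] have "0 \<le> time_deriv (\<Psi> \<gamma>) 1 t + H \<gamma> 1 (space_deriv (\<Psi> \<gamma>) 1 t)" .
    moreover have "F \<gamma> z \<le> u (x, t0) + e + m / k" using F1 same[OF \<gamma>(1)] by simp
    ultimately show False using strict[OF \<gamma>(1) weight(2)[OF \<gamma>(1)]] by (simp add: z_eq)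
  qed
qed

section \<open>Stability of solutions and convergence of the sequence\<close>

lemma HJ_solution_uniform_limit:
  fixes E :: "(real \<Rightarrow> 'a::euclidean_space) set"
  assumes net: "network E" and ham: "hamiltonians E H" and flux: "flux_limiter E H c"
    and un: "\<And>n. HJ_solution E H c T0 T1 (un n)"
    and lim: "uniform_limit (spacetime E T0 T1) un u sequentially"
  shows "HJ_solution E H c T0 T1 u"
proof -
  have un': "HJ_subsolution E H c T0 T1 (un n)" "HJ_supersolution E H c T0 T1 (un n)" for n
    using un[of n] by (auto simp: HJ_solution_def)
  have cont: "continuous_on (spacetime E T0 T1) (un n)" for n
    using un'(1)[of n] by (simp add: HJ_subsolution_def)
  have ucont: "continuous_on (spacetime E T0 T1) u"
    by (rule uniform_limit_theorem[OF _ lim]) (auto simp: cont)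
  let ?V = "{0<..<1::real} \<times> einterval (ereal T0) T1"
  have arc: "continuous_on ?V (along (un n) \<gamma>)"
    "uniform_limit ?V (\<lambda>n. along (un n) \<gamma>) (along u \<gamma>) sequentially"
    if \<gamma>: "\<gamma> \<in> E" for \<gamma> n
  proof -
    have mem: "(\<gamma> (fst z), snd z) \<in> spacetime E T0 T1" if "z \<in> ?V" for z
      using that network_arc(2)[OF net \<gamma>, of "fst z"] by (auto simp: spacetime_def einterval_real)
    have "continuous_on ?V (\<lambda>z. \<gamma> (fst z))"
      by (rule continuous_on_compose2[OF network_arc(1)[OF net \<gamma>]]) (auto intro!: continuous_intros)
    hence "continuous_on ?V (\<lambda>z. (\<gamma> (fst z), snd z))" by (intro continuous_intros)
    from continuous_on_compose2[OF cont this]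
    show "continuous_on ?V (along (un n) \<gamma>)" using mem by (auto simp: along_def case_prod_unfold)
    show "uniform_limit ?V (\<lambda>n. along (un n) \<gamma>) (along u \<gamma>) sequentially"
      unfolding uniform_limit_iff
    proof (intro allI impI)
      fix e :: real assume "e > 0"
      from uniform_limitD[OF lim this]
      show "\<forall>\<^sub>F n in sequentially. \<forall>z\<in>?V. dist (along (un n) \<gamma> z) (along u \<gamma> z) < e"
        by eventually_elim (use mem in \<open>fastforce simp: along_def\<close>)
    qed
  qed
  have hcont: "continuous_on ({0..1} \<times> UNIV) (\<lambda>(s, p). H \<gamma> s p)" if "\<gamma> \<in> E" for \<gamma>
    using ham that by (simp add: hamiltonians_def)
  \<comment> \<open>This half has to come first: the vertex condition for supersolutions is obtained
    from it.\<close>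
  have sub: "HJ_subsolution E H c T0 T1 u"
    unfolding HJ_subsolution_def
  proof (intro conjI ballI allI impI)
    fix \<gamma> assume \<gamma>: "\<gamma> \<in> E"
    show "arc_subsolution (H \<gamma>) T0 T1 (along u \<gamma>)"
      by (rule arc_subsolution_uniform_limit[OF _ hcont[OF \<gamma>] arc[OF \<gamma>]])
        (use un'(1) \<gamma> in \<open>simp add: HJ_subsolution_def\<close>)
  next
    fix x t0 \<psi> assume x: "x \<in> vertices E" and t0: "t0 \<in> einterval T0 T1"
      and \<psi>: "supertangent (\<lambda>t. u (x, t)) t0 \<psi>"
    obtain \<gamma> where "\<gamma> \<in> E" "x = \<gamma> 1"
      using arcs_into_nonempty[OF net x] by (auto simp: arcs_into_def pathfinish_def)
    hence "x \<in> support E" using network_arc(2)[OF net, of \<gamma> 1] by auto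
    hence mem: "(x, t) \<in> spacetime E T0 T1" if "t \<in> einterval T0 T1" for t
      using that by (auto simp: spacetime_def einterval_real)
    show "deriv \<psi> t0 \<le> c x"
    proof (rule supertangent_slope_uniform_limit[OF _ open_einterval _ _ t0 \<psi>])
      show "deriv \<psi> t \<le> c x" if "t \<in> einterval T0 T1" "supertangent (\<lambda>t. un n (x, t)) t \<psi>" for n t \<psi>
        using un'(1)[of n] x that unfolding HJ_subsolution_def by blast
      show "continuous_on (einterval T0 T1) (\<lambda>t. un n (x, t))" for n
        by (rule continuous_on_compose2[OF cont]) (use mem in \<open>auto intro!: continuous_intros\<close>)
      show "uniform_limit (einterval T0 T1) (\<lambda>n t. un n (x, t)) (\<lambda>t. u (x, t)) sequentially"
        unfolding uniform_limit_iff
      proof (intro allI impI)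
        fix e :: real assume "e > 0"
        from uniform_limitD[OF lim this]
        show "\<forall>\<^sub>F n in sequentially. \<forall>t\<in>einterval T0 T1. dist (un n (x, t)) (u (x, t)) < e"
          by eventually_elim (use mem in blast)
      qed
    qed
  qed (rule ucont)
  moreover have "HJ_supersolution E H c T0 T1 u"
    unfolding HJ_supersolution_def
  proof (intro conjI ballI impI)
    fix \<gamma> assume \<gamma>: "\<gamma> \<in> E"
    show "arc_supersolution (H \<gamma>) T0 T1 (along u \<gamma>)"
      by (rule arc_supersolution_uniform_limit[OF _ hcont[OF \<gamma>] arc[OF \<gamma>]])
        (use un'(2) \<gamma> in \<open>simp add: HJ_supersolution_def\<close>)
  next
    fix x t0 assume x: "x \<in> vertices E" and t0: "t0 \<in> einterval T0 T1"
      and "\<exists>\<phi>. subtangent (\<lambda>t. u (x, t)) t0 \<phi> \<and> deriv \<phi> t0 < c x"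
    then obtain \<phi> where "subtangent (\<lambda>t. u (x, t)) t0 \<phi>" "deriv \<phi> t0 < c x" by blast
    from vertex_supersolution_uniform_limit[OF net ham flux un'(2) lim sub x t0 this]
    show "\<exists>\<gamma>\<in>arcs_into E x. \<forall>\<phi>.
           constrained_subtangent ({0..1} \<times> closure (einterval T0 T1)) (along u \<gamma>) (1, t0) \<phi> \<longrightarrow>
           time_deriv \<phi> 1 t0 + H \<gamma> 1 (space_deriv \<phi> 1 t0) \<ge> 0" .
  qed (rule ucont)
  ultimately show ?thesis by (simp add: HJ_solution_def)
qed

lemma HJ_solution_contraction:
  fixes E :: "(real \<Rightarrow> 'a::euclidean_space) set"
  assumes "network E" "hamiltonians E H" "HJ_solution E H c T0 T1 u" "HJ_solution E H c T0 T1 v"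
    and init: "\<And>x. x \<in> support E \<Longrightarrow> \<bar>u (x, T0) - v (x, T0)\<bar> \<le> B"
    and z: "z \<in> spacetime E T0 T1"
  shows "\<bar>u z - v z\<bar> \<le> B"
proof -
  obtain y t where yt: "z = (y, t)" by fastforce
  have "u (y, t) - v (y, t) \<le> B"
    by (rule HJ_comparison[of E H c T0 T1]) (use assms yt in \<open>auto simp: HJ_solution_def abs_le_iff\<close>)
  moreover have "v (y, t) - u (y, t) \<le> B"
    by (rule HJ_comparison[of E H c T0 T1]) (use assms yt in \<open>auto simp: HJ_solution_def abs_le_iff\<close>)
  ultimately show ?thesis by (simp add: yt abs_le_iff)
qed

theorem corollary7p3:
  fixes E :: "(real \<Rightarrow> 'a::euclidean_space) set"
    and H :: "(real \<Rightarrow> 'a) \<Rightarrow> real \<Rightarrow> real \<Rightarrow> real"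
    and c :: "'a \<Rightarrow> real"
    and T0 :: real and T1 :: ereal
    and g :: "'a \<Rightarrow> real" and g_seq :: "nat \<Rightarrow> 'a \<Rightarrow> real"
    and u_seq :: "nat \<Rightarrow> 'a \<times> real \<Rightarrow> real"
  assumes "0 \<le> T0" and "ereal T0 < T1"
    and "network E" and "hamiltonians E H" and "flux_limiter E H c"
    and "\<And>n. continuous_on (support E) (g_seq n)"
    and "uniform_limit (support E) g_seq g sequentially"
    and "\<And>n. HJ_solution E H c T0 T1 (u_seq n)"
    and "\<And>n. uniformly_continuous_on (spacetime E T0 T1) (u_seq n)"
    and "\<And>n x. x \<in> support E \<Longrightarrow> u_seq n (x, T0) = g_seq n x"
  shows "\<exists>u. HJ_solution E H c T0 T1 u \<and>
             (\<forall>x\<in>support E. u (x, T0) = g x) \<and>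
             uniform_limit (spacetime E T0 T1) u_seq u sequentially \<and>
             (\<forall>n. uniform_norm (spacetime E T0 T1) (\<lambda>z. u_seq n z - u z)
                    \<le> uniform_norm (support E) (\<lambda>x. g_seq n x - g x))"
proof -
  let ?S = "spacetime E T0 T1"
  \<comment> \<open>No solution with initial datum \<open>g\<close> is available yet, so the
    approximating solutions are compared with each other; the Cauchy property then produces the
    limit.\<close>
  have contraction: "\<bar>u_seq n z - u_seq k z\<bar> \<le> B"
    if "\<And>x. x \<in> support E \<Longrightarrow> \<bar>g_seq n x - g_seq k x\<bar> \<le> B" "z \<in> ?S" for n k B z
    by (rule HJ_solution_contraction[OF assms(3,4,8,8)]) (use that assms(10) in auto)
  have "uniformly_Cauchy_on ?S u_seq"
  proof (rule uniformly_Cauchy_onI)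
    fix e :: real assume "e > 0"
    have "uniformly_Cauchy_on (support E) g_seq"
      using assms(7) uniformly_convergent_Cauchy uniformly_convergent_on_def by blast
    then obtain M where M: "\<And>n k x. n \<ge> M \<Longrightarrow> k \<ge> M \<Longrightarrow> x \<in> support E \<Longrightarrow> dist (g_seq n x) (g_seq k x) < e / 2"
      using \<open>e > 0\<close> unfolding uniformly_Cauchy_on_def by (meson half_gt_zero)
    have "dist (u_seq n z) (u_seq k z) < e" if "n \<ge> M" "k \<ge> M" "z \<in> ?S" for n k z
    proof -
      have "\<bar>u_seq n z - u_seq k z\<bar> \<le> e / 2"
        by (rule contraction[OF _ that(3)]) (use M[OF that(1,2)] in \<open>force simp: dist_real_def\<close>)
      thus ?thesis using \<open>e > 0\<close> by (simp add: dist_real_def)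
    qed
    thus "\<exists>M. \<forall>z\<in>?S. \<forall>n\<ge>M. \<forall>k\<ge>M. dist (u_seq n z) (u_seq k z) < e" by blast
  qed
  then obtain u where lim: "uniform_limit ?S u_seq u sequentially"
    using Cauchy_uniformly_convergent uniformly_convergent_on_def by blast
  show ?thesis
  proof (intro exI[of _ u] conjI ballI allI lim)
    show "HJ_solution E H c T0 T1 u"
      by (rule HJ_solution_uniform_limit[OF assms(3-5,8) lim])
  next
    fix x assume x: "x \<in> support E"
    hence "(x, T0) \<in> ?S" using assms(2) by (simp add: spacetime_def)
    from tendsto_uniform_limitI[OF lim this] have "(\<lambda>n. g_seq n x) \<longlonglongrightarrow> u (x, T0)"
      using assms(10)[OF x] by simp
    thus "u (x, T0) = g x"
      using tendsto_uniform_limitI[OF assms(7) x] LIMSEQ_unique by blast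
  next
    fix n
    let ?R = "uniform_norm (support E) (\<lambda>x. g_seq n x - g x)"
    show "uniform_norm ?S (\<lambda>z. u_seq n z - u z) \<le> ?R"
    proof (cases "?R = top")
      case False
      define B where "B = enn2real ?R"
      have B: "ennreal B = ?R" "B \<ge> 0" using False by (auto simp: B_def less_top)
      have gB: "\<bar>g_seq n x - g x\<bar> \<le> B" if "x \<in> support E" for x
      proof -
        have "ennreal \<bar>g_seq n x - g x\<bar> \<le> ennreal B"
          unfolding B uniform_norm_def using that by (rule SUP_upper)
        thus ?thesis using B(2) by simp
      qed
      have "\<bar>u_seq n z - u z\<bar> \<le> B" if z: "z \<in> ?S" for z
      proof (rule field_le_epsilon)
        \<comment> \<open>For large \<open>k\<close> the data of \<open>u_seq n\<close> and
          \<open>u_seq k\<close> differ by at most \<open>B + e\<close>; letting \<open>k\<close>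
          tend to infinity replaces \<open>u_seq k\<close> by \<open>u\<close>.\<close>
        fix e :: real assume "e > 0"
        have "\<forall>\<^sub>F k in sequentially. \<bar>u_seq n z - u_seq k z\<bar> \<le> B + e"
          using uniform_limitD[OF assms(7) \<open>e > 0\<close>]
        proof eventually_elim
          case (elim k)
          show ?case
          proof (rule contraction[OF _ z])
            fix x assume "x \<in> support E"
            thus "\<bar>g_seq n x - g_seq k x\<bar> \<le> B + e"
              using gB[of x] elim unfolding dist_real_def by (smt (verit))
          qed
        qed
        moreover have "(\<lambda>k. \<bar>u_seq n z - u_seq k z\<bar>) \<longlonglongrightarrow> \<bar>u_seq n z - u z\<bar>"
          by (intro tendsto_intros tendsto_uniform_limitI[OF lim z])
        ultimately show "\<bar>u_seq n z - u z\<bar> \<le> B + e"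
          by (intro tendsto_upperbound[of _ _ sequentially]) auto
      qed
      thus ?thesis unfolding B(1)[symmetric] uniform_norm_def[of ?S] by (intro SUP_least ennreal_leI)
    qed simp
  qed
qed

end
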